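(* Let $K$ be a hyperbolic knot in $S^3$. Then the knot group $G(K)$ does not admit a generalized torsion element of order two.
   Context: The knot group of a knot $K\subset S^3$ is $G(K)=\pi_1(E(K))$, where the exterior $E(K)$ is the complement of an open tubular neighborhood of $K$. A knot is hyperbolic if its complement admits a complete hyperbolic structure of finite volume. In a group $G$ write $g^a=a^{-1}ga$. A non-trivial element $g\in G$ is a generalized torsion element if $g^{a_1}g^{a_2}\cdots g^{a_n}=1$ for some $n\ge 2$ and some $a_1,\dots,a_n\in G$. The minimum such number $n$ of conjugates yielding the identity is the order of $g$. *)

theory Defs
  imports "HOL-Analysis.Analysis" "HOL-Algebra.Group"
begin

section \<open>Generalized torsion\<close>

definition conjugate :: "('a, 'b) monoid_scheme \<Rightarrow> 'a \<Rightarrow> 'a \<Rightarrow> 'a"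
  where "conjugate G g a = inv\<^bsub>G\<^esub> a \<otimes>\<^bsub>G\<^esub> g \<otimes>\<^bsub>G\<^esub> a"

definition conjugates_product :: "('a, 'b) monoid_scheme \<Rightarrow> 'a \<Rightarrow> 'a list \<Rightarrow> 'a"
  where "conjugates_product G g as = foldr (\<lambda>a p. conjugate G g a \<otimes>\<^bsub>G\<^esub> p) as \<one>\<^bsub>G\<^esub>"

definition conjugates_yield_one :: "('a, 'b) monoid_scheme \<Rightarrow> 'a \<Rightarrow> nat \<Rightarrow> bool"
  where "conjugates_yield_one G g n \<longleftrightarrow>
    n \<ge> 2 \<and> (\<exists>as. set as \<subseteq> carrier G \<and> length as = n \<and> conjugates_product G g as = \<one>\<^bsub>G\<^esub>)"

definition generalized_torsion_element :: "('a, 'b) monoid_scheme \<Rightarrow> 'a \<Rightarrow> bool"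
  where "generalized_torsion_element G g \<longleftrightarrow>
    g \<in> carrier G \<and> g \<noteq> \<one>\<^bsub>G\<^esub> \<and> (\<exists>n. conjugates_yield_one G g n)"

text \<open>Only meaningful when \<^term>\<open>g\<close> is a generalized torsion element.\<close>

definition generalized_torsion_order :: "('a, 'b) monoid_scheme \<Rightarrow> 'a \<Rightarrow> nat"
  where "generalized_torsion_order G g = (LEAST n. conjugates_yield_one G g n)"


section \<open>The fundamental group\<close>

definition based_loops :: "'a::topological_space set \<Rightarrow> 'a \<Rightarrow> (real \<Rightarrow> 'a) set"
  where "based_loops S x =
    {p. path p \<and> path_image p \<subseteq> S \<and> pathstart p = x \<and> pathfinish p = x}"

definition path_class :: "'a::topological_space set \<Rightarrow> (real \<Rightarrow> 'a) \<Rightarrow> (real \<Rightarrow> 'a) set"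
  where "path_class S p = {q. homotopic_paths S p q}"

definition fundamental_group :: "'a::topological_space set \<Rightarrow> 'a \<Rightarrow> (real \<Rightarrow> 'a) set monoid"
  where "fundamental_group S x =
    \<lparr>carrier = path_class S ` based_loops S x,
     mult = (\<lambda>A B. \<Union>p\<in>A. \<Union>q\<in>B. path_class S (p +++ q)),
     one = path_class S (\<lambda>_. x)\<rparr>"

lemma path_class_cong:
  assumes "homotopic_paths S p q"
  shows "path_class S p = path_class S q"
proof (rule Set.set_eqI)
  fix r
  show "r \<in> path_class S p \<longleftrightarrow> r \<in> path_class S q"
    using homotopic_paths_trans[OF assms, of r]
      homotopic_paths_trans[OF homotopic_paths_sym[OF assms], of r]
    unfolding path_class_def mem_Collect_eq by iprover
qed

lemma const_in_based_loops: "x \<in> S \<Longrightarrow> (\<lambda>_. x) \<in> based_loops S x"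
  by (auto simp: based_loops_def path_def path_image_def pathstart_def pathfinish_def)

lemma join_in_based_loops:
  "p \<in> based_loops S x \<Longrightarrow> q \<in> based_loops S x \<Longrightarrow> p +++ q \<in> based_loops S x"
  by (auto simp: based_loops_def path_image_join)

lemma mult_path_class:
  assumes "p \<in> based_loops S x" "q \<in> based_loops S x"
  shows "path_class S p \<otimes>\<^bsub>fundamental_group S x\<^esub> path_class S q = path_class S (p +++ q)"
proof -
  have refl: "homotopic_paths S p p" "homotopic_paths S q q"
    using assms by (simp_all add: based_loops_def)
  have join: "homotopic_paths S (p +++ q) (p' +++ q')"
    if "homotopic_paths S p p'" "homotopic_paths S q q'" for p' q'
    using that assms by (intro homotopic_paths_join) (simp_all add: based_loops_def)
  have "path_class S (p' +++ q') = path_class S (p +++ q)"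
    if "p' \<in> path_class S p" "q' \<in> path_class S q" for p' q'
    using that path_class_cong[OF join[of p' q']] by (simp add: path_class_def)
  moreover have "p \<in> path_class S p" "q \<in> path_class S q"
    using refl by (simp_all add: path_class_def)
  ultimately have "(\<Union>p'\<in>path_class S p. \<Union>q'\<in>path_class S q. path_class S (p' +++ q')) =
      path_class S (p +++ q)"
    by blast
  then show ?thesis
    by (simp add: fundamental_group_def)
qed

lemma group_fundamental_group:
  fixes x :: "'a::real_normed_vector"
  assumes "x \<in> S"
  shows "group (fundamental_group S x)"
proof -
  let ?G = "fundamental_group S x"
  have const: "(\<lambda>_. x) = linepath x x"
    by (simp add: fun_eq_iff linepath_def flip: scaleR_add_left)
  have car: "carrier ?G = path_class S ` based_loops S x" 
    and one: "\<one>\<^bsub>?G\<^esub> = path_class S (linepath x x)"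
    by (auto simp: fundamental_group_def const)
  note c = const_in_based_loops[OF assms, unfolded const]
  show ?thesis
  proof (rule groupI)
    fix A B assume "A \<in> carrier ?G" "B \<in> carrier ?G"
    then show "A \<otimes>\<^bsub>?G\<^esub> B \<in> carrier ?G"
      by (auto simp: car mult_path_class join_in_based_loops)
  next
    show "\<one>\<^bsub>?G\<^esub> \<in> carrier ?G"
      using c by (auto simp: car one)
  next
    fix A B C assume "A \<in> carrier ?G" "B \<in> carrier ?G" "C \<in> carrier ?G"
    then obtain p q r where pqr: "p \<in> based_loops S x" "q \<in> based_loops S x" "r \<in> based_loops S x"
      and eq: "A = path_class S p" "B = path_class S q" "C = path_class S r"
      by (auto simp: car)
    have "homotopic_paths S ((p +++ q) +++ r) (p +++ (q +++ r))"
      using pqr by (intro homotopic_paths_sym[OF homotopic_paths_assoc]) (auto simp: based_loops_def)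
    then show "(A \<otimes>\<^bsub>?G\<^esub> B) \<otimes>\<^bsub>?G\<^esub> C = A \<otimes>\<^bsub>?G\<^esub> (B \<otimes>\<^bsub>?G\<^esub> C)"
      using pqr by (simp add: eq mult_path_class join_in_based_loops path_class_cong)
  next
    fix A assume "A \<in> carrier ?G"
    then obtain p where p: "p \<in> based_loops S x" and eq: "A = path_class S p"
      by (auto simp: car)
    have "homotopic_paths S (linepath x x +++ p) p"
      using p by (intro homotopic_paths_lid') (auto simp: based_loops_def)
    then show "\<one>\<^bsub>?G\<^esub> \<otimes>\<^bsub>?G\<^esub> A = A"
      using p c by (simp add: eq one mult_path_class join_in_based_loops path_class_cong)
    have r: "reversepath p \<in> based_loops S x"
      using p by (auto simp: based_loops_def)
    have "homotopic_paths S (reversepath p +++ p) (linepath x x)"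
      using homotopic_paths_linv[of p S] p by (auto simp: based_loops_def)
    then show "\<exists>B\<in>carrier ?G. B \<otimes>\<^bsub>?G\<^esub> A = \<one>\<^bsub>?G\<^esub>"
      using p r c
      by (intro bexI[of _ "path_class S (reversepath p)"])
         (auto simp: eq one mult_path_class join_in_based_loops path_class_cong car)
  qed
qed


section \<open>Smooth knots and their exteriors\<close>

text \<open>The derivative of order \<^term>\<open>Suc k\<close> is controlled through all directional derivatives.
  These notions are only intended for open sets \<^term>\<open>S\<close>.\<close>

primrec C_diff_on ::
  "nat \<Rightarrow> 'a::real_normed_vector set \<Rightarrow> ('a \<Rightarrow> 'b::real_normed_vector) \<Rightarrow> bool" where
  "C_diff_on 0 S f \<longleftrightarrow> continuous_on S f"
| "C_diff_on (Suc k) S f \<longleftrightarrow>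
    (\<exists>f'. (\<forall>x\<in>S. (f has_derivative f' x) (at x)) \<and> (\<forall>v. C_diff_on k S (\<lambda>x. f' x v)))"

definition smooth_immersion_on ::
  "'a::real_normed_vector set \<Rightarrow> ('a \<Rightarrow> 'b::real_normed_vector) \<Rightarrow> bool"
  where "smooth_immersion_on S f \<longleftrightarrow>
    (\<forall>k. C_diff_on k S f) \<and> (\<forall>x\<in>S. inj (frechet_derivative f (at x)))"

abbreviation S3 :: "(real^4) set"
  where "S3 \<equiv> sphere 0 1"

text \<open>Maps on the circle are written as \<open>2\<pi>\<close>-periodic maps of the angle, so injectivity is
  injectivity in \<^term>\<open>cis s\<close>.\<close>

definition knot :: "(real^4) set \<Rightarrow> bool"
  where "knot K \<longleftrightarrow>
    (\<exists>\<gamma> :: real \<Rightarrow> real^4.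
       smooth_immersion_on UNIV \<gamma> \<and>
       (\<forall>s. \<gamma> (s + 2 * pi) = \<gamma> s) \<and>
       (\<forall>s t. \<gamma> s = \<gamma> t \<longrightarrow> cis s = cis t) \<and>
       range \<gamma> = K \<and> K \<subseteq> S3)"

text \<open>An open tubular neighborhood is the open unit disk bundle of a smooth embedding of
  \<open>S\<^sup>1 \<times> D\<close> in the 3-sphere, where \<open>D\<close> is an open disk of radius \<open>r > 1\<close>.  The larger radius
  ensures that the closure is a smoothly embedded closed solid torus.\<close>

definition open_tubular_neighborhood :: "(real^4) set \<Rightarrow> (real^4) set \<Rightarrow> bool"
  where "open_tubular_neighborhood K N \<longleftrightarrow>
    (\<exists>(h :: real \<times> (real^2) \<Rightarrow> real^4) r. r > 1 \<and>
       smooth_immersion_on (UNIV \<times> ball 0 r) h \<and>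
       (\<forall>s. \<forall>z\<in>ball 0 r. h (s + 2 * pi, z) = h (s, z)) \<and>
       (\<forall>s t. \<forall>z\<in>ball 0 r. \<forall>w\<in>ball 0 r. h (s, z) = h (t, w) \<longrightarrow> cis s = cis t \<and> z = w) \<and>
       h ` (UNIV \<times> ball 0 r) \<subseteq> S3 \<and>
       h ` (UNIV \<times> {0}) = K \<and>
       h ` (UNIV \<times> ball 0 1) = N)"

definition knot_exterior :: "(real^4) set \<Rightarrow> (real^4) set \<Rightarrow> bool"
  where "knot_exterior K E \<longleftrightarrow> (\<exists>N. open_tubular_neighborhood K N \<and> E = S3 - N)"


section \<open>Hyperbolic structures on 3-manifolds\<close>

text \<open>Upper half-space model of hyperbolic 3-space.\<close>

definition H3 :: "(real^3) set"
  where "H3 = {p. p $ 3 > 0}"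

definition hyp_dist :: "real^3 \<Rightarrow> real^3 \<Rightarrow> real"
  where "hyp_dist p q = arcosh (1 + (dist p q)\<^sup>2 / (2 * p $ 3 * q $ 3))"

definition hyp_volume :: "(real^3) measure"
  where "hyp_volume = density lborel (\<lambda>p. ennreal (indicator H3 p / (p $ 3) ^ 3))"

definition hyperbolic_chart ::
  "'a set \<Rightarrow> ('a \<Rightarrow> 'a \<Rightarrow> real) \<Rightarrow> 'a set \<Rightarrow> ('a \<Rightarrow> real^3) \<Rightarrow> bool"
  where "hyperbolic_chart M d U f \<longleftrightarrow>
    openin (Metric_space.mtopology M d) U \<and> open (f ` U) \<and> f ` U \<subseteq> H3 \<and>
    (\<forall>x\<in>U. \<forall>y\<in>U. hyp_dist (f x) (f y) = d x y)"

text \<open>Any two points are joined by paths of length arbitrarily close to their distance,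
  the length of a path being the supremum over all partitions.\<close>

definition length_metric :: "'a set \<Rightarrow> ('a \<Rightarrow> 'a \<Rightarrow> real) \<Rightarrow> bool"
  where "length_metric M d \<longleftrightarrow>
    (\<forall>x\<in>M. \<forall>y\<in>M. \<forall>e>0. \<exists>g. pathin (Metric_space.mtopology M d) g \<and> g 0 = x \<and> g 1 = y \<and>
       (\<forall>n t. mono t \<and> range t \<subseteq> {0..1} \<longrightarrow>
          (\<Sum>i<n. d (g (t i)) (g (t (Suc i)))) \<le> d x y + e))"

text \<open>A hyperbolic structure is given by its path metric: a length metric locally isometric
  to hyperbolic 3-space.\<close>

definition hyperbolic_metric :: "'a set \<Rightarrow> ('a \<Rightarrow> 'a \<Rightarrow> real) \<Rightarrow> bool"
  where "hyperbolic_metric M d \<longleftrightarrow>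
    Metric_space M d \<and> length_metric M d \<and> (\<forall>x\<in>M. \<exists>U f. x \<in> U \<and> hyperbolic_chart M d U f)"

text \<open>The hyperbolic volume is the unique Borel measure that agrees with the volume of
  hyperbolic 3-space in every chart.\<close>

definition finite_hyperbolic_volume :: "'a set \<Rightarrow> ('a \<Rightarrow> 'a \<Rightarrow> real) \<Rightarrow> bool"
  where "finite_hyperbolic_volume M d \<longleftrightarrow>
    (\<exists>\<mu>. sets \<mu> = sets (sigma M {U. openin (Metric_space.mtopology M d) U}) \<and>
       (\<forall>U f A. hyperbolic_chart M d U f \<and> A \<in> sets \<mu> \<and> A \<subseteq> U \<longrightarrow>
          emeasure \<mu> A = emeasure hyp_volume (f ` A)) \<and>
       emeasure \<mu> M < \<infinity>)"

definition hyperbolic_knot :: "(real^4) set \<Rightarrow> bool"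
  where "hyperbolic_knot K \<longleftrightarrow> knot K \<and>
    (\<exists>d. hyperbolic_metric (S3 - K) d \<and>
       Metric_space.mtopology (S3 - K) d = top_of_set (S3 - K) \<and>
       Metric_space.mcomplete (S3 - K) d \<and>
       finite_hyperbolic_volume (S3 - K) d)"

end

(* The complement M of a hyperbolic knot is the quotient of hyperbolic 3-space by the group of deck
transformations: completeness lets a chart be continued along an exhaustion by balls to a local isometry
p from all of H^3 to M, and p is a covering.  The deck transformations act freely by Lorentz
transformations, and since M retracts onto the knot exterior E, the knot group embeds in this deck group.

A product of two conjugates of g that is trivial gives c with g c g = c, i.e. c inverts g.  By Brouwer's
fixed point theorem on the projectivised light cone, g fixes a null direction.  If it is an expanding or
contracting direction of g, then c swaps the two ends of the axis of g and fixes a point of it, contradicting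
freeness.  Otherwise c fixes the null direction too, and with this direction at infinity both g and c act
as similarities of the upper half-space.  If both preserve orientation, then g is a translation and c is
a rotation by pi, which has a fixed point.  The other possibility, a Klein bottle group in the cusp, is excluded
because M embeds in R^3: along a path from x to its image the local degree of p is constant, so the
linear part of an orientation reversing similarity would be homotopic to the identity on the 2-sphere,
whereas it is homotopic to a reflection, which has degree -1. *)

theory Submission
  imports Defs "HOL-Homology.Homology"
begin

section \<open>Lorentz geometry of the upper half-space\<close>

text \<open>The relation \<open>g c g = c\<close> is consistent with a free action on H^3 as long as
  isometries may reverse orientation, and a metric carries no orientation. The geometry is therefore
  arranged so that a single topological question remains: can a deck transformation be an
  orientation-reversing similarity in suitable half-space coordinates? It is answered with homotopy
  classes of maps of the 2-sphere, without computing any invariant of M.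

  All gluing rests on rigidity. A distance-preserving map on a nonempty open subset of H^3 is the
  restriction of a unique linear map, so two local isometries into M that agree on a nonempty open
  part of a connected domain agree on all of it. Balls and intersections of balls are convex, so no
  continuation ever depends on a choice of path.

  Freeness says nothing about a trivial \<open>c\<close>. In that case the relation reads
  \<open>g g = 1\<close>, and an involution fixes the midpoint between a point and its image, which
  the freeness of \<open>g\<close> forbids.\<close>

text \<open>The hyperboloid model in null coordinates: the Lorentz form is \<open>a b - |w|\<^sup>2\<close> on
  vectors \<open>(a, b, w)\<close>, and its value on two points of the hyperboloid is the hyperbolic cosine
  of their distance, so that hyperbolic isometries become linear.\<close>

type_synonym lvec = "real \<times> real \<times> complex"

definition lf :: "lvec \<Rightarrow> lvec \<Rightarrow> real"
  where "lf v w = (fst v * fst (snd w) + fst (snd v) * fst w) / 2 - snd (snd v) \<bullet> snd (snd w)"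

text \<open>On the level set the product of the two null coordinates is 1 + |w|^2, so their common
  sign separates two sheets; the condition picks one.\<close>

definition hyperboloid :: "lvec set"
  where "hyperboloid = {v. lf v v = 1 \<and> fst (snd v) > 0}"

text \<open>These are the entries of the Hermitian matrix of determinant 1 that represents the point
  z + t j. The second coordinate is the reciprocal of the height, so (1, 0, 0) is the direction of
  the boundary point at infinity.\<close>

definition lor :: "real^3 \<Rightarrow> lvec"
  where "lor x = ((norm x)\<^sup>2 / x$3, 1 / x$3, Complex (x$1 / x$3) (x$2 / x$3))"

definition unlor :: "lvec \<Rightarrow> real^3"
  where "unlor v = vector [Re (snd (snd v)) / fst (snd v), Im (snd (snd v)) / fst (snd v), 1 / fst (snd v)]"

text \<open>Preserving the sheet rules out time reversal. No determinant is prescribed, so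
  isometries that reverse orientation are included.\<close>

definition lorentz :: "(lvec \<Rightarrow> lvec) \<Rightarrow> bool"
  where "lorentz A \<longleftrightarrow> linear A \<and> (\<forall>v w. lf (A v) (A w) = lf v w) \<and> A ` hyperboloid \<subseteq> hyperboloid"

definition act :: "(lvec \<Rightarrow> lvec) \<Rightarrow> real^3 \<Rightarrow> real^3"
  where "act A x = unlor (A (lor x))"

lemma bilinear_lf: "bilinear lf"
  unfolding bilinear_def
  by (auto intro!: linearI simp: lf_def algebra_simps inner_add_left inner_add_right add_divide_distrib)

lemmas lf_simps = bilinear_ladd[OF bilinear_lf] bilinear_radd[OF bilinear_lf]
  bilinear_lsub[OF bilinear_lf] bilinear_rsub[OF bilinear_lf]
  bilinear_lmul[OF bilinear_lf] bilinear_rmul[OF bilinear_lf]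
  bilinear_lneg[OF bilinear_lf] bilinear_rneg[OF bilinear_lf]
  bilinear_lzero[OF bilinear_lf] bilinear_rzero[OF bilinear_lf]

lemma lf_commute: "lf v w = lf w v"
  by (simp add: lf_def inner_commute algebra_simps)

lemma norm_vec3: "(norm (x::real^3))\<^sup>2 = (x$1)\<^sup>2 + (x$2)\<^sup>2 + (x$3)\<^sup>2"
  unfolding power2_norm_eq_inner by (simp add: inner_vec_def sum_3 power2_eq_square)

lemma H3_iff: "x \<in> H3 \<longleftrightarrow> x$3 > 0"
  by (simp add: H3_def)

lemma lf_lor:
  assumes "x \<in> H3" "y \<in> H3"
  shows "lf (lor x) (lor y) = 1 + (dist x y)\<^sup>2 / (2 * x$3 * y$3)"
  using assms unfolding dist_norm norm_vec3 lf_def lor_def H3_iff inner_complex_def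
  by (simp add: norm_vec3 field_simps power2_eq_square)

lemma lor_in_hyperboloid: "x \<in> H3 \<Longrightarrow> lor x \<in> hyperboloid"
  unfolding hyperboloid_def using lf_lor[of x x] by (simp add: lor_def H3_iff)

lemma unlor_in_H3: "v \<in> hyperboloid \<Longrightarrow> unlor v \<in> H3"
  by (simp add: hyperboloid_def unlor_def H3_iff)

lemma unlor_lor [simp]: "x \<in> H3 \<Longrightarrow> unlor (lor x) = x"
  by (simp add: unlor_def lor_def H3_iff vec_eq_iff forall_3)

lemma lor_unlor [simp]:
  assumes "v \<in> hyperboloid"
  shows "lor (unlor v) = v"
proof -
  obtain a b w where v: "v = (a, b, w)" by (cases v) auto
  have b: "b > 0" and "a * b = 1 + (Re w)\<^sup>2 + (Im w)\<^sup>2"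
    using assms by (auto simp: v hyperboloid_def lf_def inner_complex_def power2_eq_square)
  then have "a = (1 + (Re w)\<^sup>2 + (Im w)\<^sup>2) / b"
    by (simp add: field_simps)
  then show ?thesis
    using b unfolding v lor_def unlor_def
    by (simp add: norm_vec3 complex_eq_iff) (simp add: field_simps power2_eq_square)
qed

lemma hyp_dist_eq_iff:
  assumes "x \<in> H3" "y \<in> H3" "x' \<in> H3" "y' \<in> H3"
  shows "hyp_dist x y = hyp_dist x' y' \<longleftrightarrow> lf (lor x) (lor y) = lf (lor x') (lor y')"
proof -
  have *: "lf (lor x) (lor y) \<ge> 1" if "x \<in> H3" "y \<in> H3" for x y
    using that by (simp add: lf_lor H3_iff)
  have "hyp_dist x y = arcosh (lf (lor x) (lor y))" if "x \<in> H3" "y \<in> H3" for x y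
    using that by (simp add: hyp_dist_def lf_lor)
  then show ?thesis
    using * assms by (metis cosh_arcosh_real)
qed

lemma cosh_hyp_dist:
  assumes "x \<in> H3" "y \<in> H3"
  shows "cosh (hyp_dist x y) = 1 + (dist x y)\<^sup>2 / (2 * x$3 * y$3)"
  using assms by (simp add: hyp_dist_def H3_iff cosh_arcosh_real)

lemma hyp_dist_nonneg: "x \<in> H3 \<Longrightarrow> y \<in> H3 \<Longrightarrow> hyp_dist x y \<ge> 0"
  by (simp add: hyp_dist_def H3_iff)

lemma hyp_dist_self [simp]: "x \<in> H3 \<Longrightarrow> hyp_dist x x = 0"
  by (simp add: hyp_dist_def H3_iff)

lemma hyp_dist_eq_0: "x \<in> H3 \<Longrightarrow> y \<in> H3 \<Longrightarrow> hyp_dist x y = 0 \<longleftrightarrow> x = y"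
  using cosh_hyp_dist[of x y] by (auto simp: H3_iff)

lemma hyp_dist_commute: "hyp_dist x y = hyp_dist y x"
  by (simp add: hyp_dist_def dist_commute mult.commute mult.left_commute)

text \<open>The half-distance formula sinh (d/2) = |x - y| / (2 sqrt (x_3 y_3)) together with s <=
  sinh s. It controls local isometries by Euclidean distance wherever the height is bounded
  below.\<close>

lemma hyp_dist_le:
  assumes "c > 0" "x$3 \<ge> c" "y$3 \<ge> c"
  shows "hyp_dist x y \<le> dist x y / c"
proof -
  let ?d = "hyp_dist x y"
  have H: "x \<in> H3" "y \<in> H3" using assms by (auto simp: H3_iff)
  have "1 + 2 * (sinh (?d/2))\<^sup>2 = cosh ?d"
    using cosh_double[of "?d/2"] cosh_square_eq[of "?d/2"] by simp
  then have "(sinh (?d/2))\<^sup>2 = (dist x y)\<^sup>2 / (4 * (x$3 * y$3))"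
    by (simp add: cosh_hyp_dist H)
  also have "\<dots> \<le> (dist x y)\<^sup>2 / (4 * (c * c))"
    using assms H by (intro divide_left_mono mult_left_mono mult_mono) (auto simp: H3_iff)
  also have "\<dots> = (dist x y / (2 * c))\<^sup>2"
    by (simp add: power2_eq_square)
  finally have "sinh (?d/2) \<le> dist x y / (2 * c)"
    using assms by (auto intro: power2_le_imp_le)
  moreover have "?d/2 \<le> sinh (?d/2)"
    using hyp_dist_nonneg[OF H] real_le_x_sinh[of "?d/2"] unfolding sinh_field_def exp_minus by linarith
  ultimately have "?d/2 \<le> dist x y / (2 * c)" by linarith
  then show ?thesis by simp
qed

lemma hyp_dist_small:
  assumes "y \<in> H3" "e > 0"
  obtains \<eta> where "\<eta> > 0" "\<And>x. x \<in> H3 \<Longrightarrow> hyp_dist x y < \<eta> \<Longrightarrow> dist x y < e"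
proof -
  define k where "k = min e 1"
  have y: "y$3 > 0" using assms by (simp add: H3_iff)
  \<comment> \<open>The value of \<open>cosh (hyp_dist x y) - 1\<close> at the point
    \<open>x\<close> straight above \<open>y\<close> at Euclidean distance \<open>k\<close>; among
    all points at that distance the highest one is hyperbolically closest.\<close>
  define D where "D = k\<^sup>2 / (2 * (y$3 + k) * y$3)"
  have k: "k > 0" "k \<le> e" using assms by (auto simp: k_def)
  have D: "D > 0" using k y by (simp add: D_def)
  show thesis
  proof
    show "arcosh (1 + D) > 0" using D by simp
    fix x assume x: "x \<in> H3" and "hyp_dist x y < arcosh (1+D)"
    then have "cosh (hyp_dist x y) < 1 + D"
      using D hyp_dist_nonneg[OF x assms(1)] by (metis add.commute arcosh_real_def cosh_arcosh_real cosh_real_strict_mono hyp_dist_def less_add_same_cancel2 order_less_imp_le)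
    then have 1: "(dist x y)\<^sup>2 / (2 * x$3 * y$3) < D"
      using x assms by (simp add: cosh_hyp_dist)
    show "dist x y < e"
    proof (rule ccontr)
      assume "\<not> dist x y < e"
      then have d: "dist x y \<ge> k" using k by linarith
      have "x$3 - y$3 \<le> dist x y"
        using component_le_norm_cart[of "x - y" 3] by (simp add: dist_norm)
      then have x3: "x$3 \<le> y$3 + dist x y" "x$3 > 0" using x by (auto simp: H3_iff)
      have "(dist x y)\<^sup>2 < D * (2 * x$3 * y$3)"
        using 1 x3 y by (simp add: field_simps)
      also have "\<dots> \<le> D * (2 * (y$3 + dist x y) * y$3)"
        using x3 y D by (intro mult_left_mono mult_right_mono) auto
      also have "\<dots> = k\<^sup>2 * ((y$3 + dist x y) / (y$3 + k))"
      proof -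
        have "y$3 + k \<noteq> 0" using y k by auto
        then show ?thesis using y by (simp add: D_def divide_simps) (simp add: algebra_simps)
      qed
      also have "\<dots> \<le> k\<^sup>2 * (dist x y / k)"
        using y k d by (intro mult_left_mono) (auto simp: field_simps)
      also have "\<dots> = k * dist x y" using k by (simp add: power2_eq_square)
      also have "\<dots> \<le> dist x y * dist x y" using d by (intro mult_right_mono) auto
      finally show False by (simp add: power2_eq_square)
    qed
  qed
qed

lemma open_H3: "open H3" and convex_H3: "convex H3"
proof -
  show "open H3" unfolding H3_def by (intro open_Collect_less continuous_intros)
  have "H3 = {x. axis 3 1 \<bullet> x > 0}" by (simp add: H3_def inner_axis')
  then show "convex H3" by (metis convex_halfspace_gt)
qed

lemma continuous_on_lor: "continuous_on H3 lor"
  unfolding lor_def Complex_eq by (intro continuous_intros) (auto simp: H3_iff)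

lemma continuous_on_unlor: "continuous_on hyperboloid unlor"
proof -
  have "continuous_on hyperboloid (\<lambda>v. unlor v $ i)" for i :: 3
    using exhaust_3[of i] unfolding unlor_def hyperboloid_def
    by (elim disjE) (simp_all, (intro continuous_intros; simp)+)
  then have "continuous_on hyperboloid (\<lambda>v. \<chi> i. unlor v $ i)"
    by (intro continuous_on_vec_lambda)
  then show ?thesis by simp
qed


section \<open>Lorentz maps and their action on the half-space\<close>

lemma lorentz_linear: "lorentz A \<Longrightarrow> linear A"
  and lorentz_lf: "lorentz A \<Longrightarrow> lf (A v) (A w) = lf v w"
  and lorentz_hyperboloid: "lorentz A \<Longrightarrow> v \<in> hyperboloid \<Longrightarrow> A v \<in> hyperboloid"
  unfolding lorentz_def by blast+

lemma lorentzI_all: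
  assumes "linear A" "\<And>v w. lf (A v) (A w) = lf v w" "\<And>v. v \<in> hyperboloid \<Longrightarrow> A v \<in> hyperboloid"
  shows "lorentz A"
  unfolding lorentz_def using assms by (intro conjI allI image_subsetI)

lemma lf_nondegenerate:
  assumes "\<And>w. lf v w = 0"
  shows "v = 0"
proof -
  obtain a b c where v: "v = (a, b, c)" by (cases v) auto
  \<comment> \<open>Exchanging the null coordinates and negating the last one turns the form into a
    positive definite one.\<close>
  have "lf v (b, a, -c) = 0" by (rule assms)
  then have "(a * a + b * b) / 2 + c \<bullet> c = 0"
    by (simp add: v lf_def)
  then have "a * a = 0 \<and> b * b = 0 \<and> c \<bullet> c = 0"
    by (simp add: add_nonneg_eq_0_iff)
  then show ?thesis by (simp add: v zero_prod_def)
qed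

lemma isometry_bij:
  assumes "linear A" "\<And>v w. lf (A v) (A w) = lf v w"
  shows "bij A"
proof -
  have "inj A"
  proof (subst linear_injective_0[OF assms(1)], intro allI impI)
    fix v assume "A v = 0"
    then have "lf v w = 0" for w
      using assms(2)[of v w] by (simp add: lf_simps)
    then show "v = 0" by (rule lf_nondegenerate)
  qed
  then show ?thesis
    using linear_injective_imp_surjective[OF assms(1)] by (simp add: bij_def)
qed

lemma lorentz_bij: "lorentz A \<Longrightarrow> bij A"
  using isometry_bij lorentz_def by blast

text \<open>Two points of the sheet pair to at least 1, and \<open>v\<close> and \<open>-v\<close>
  lie on opposite sheets, so one pairing decides the sheet. Consequently a linear map that preserves
  the form has to be tested on a single vector only.\<close>

lemma in_hyperboloid_iff_lf_pos:
  assumes "u \<in> hyperboloid" "lf v v = 1"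
  shows "v \<in> hyperboloid \<longleftrightarrow> lf u v > 0"
proof -
  have pos: "lf u v > 0" if "v \<in> hyperboloid" for v
  proof -
    have "unlor u \<in> H3" "unlor v \<in> H3" using assms(1) that unlor_in_H3 by auto
    then have "lf (lor (unlor u)) (lor (unlor v)) > 0"
      unfolding H3_iff by (subst lf_lor) (auto simp: H3_iff intro: add_pos_nonneg)
    then show ?thesis using assms(1) that by simp
  qed
  have nz: "fst (snd v) \<noteq> 0"
  proof
    assume "fst (snd v) = 0"
    then have "snd (snd v) \<bullet> snd (snd v) = -1" using assms(2) by (simp add: lf_def)
    then show False using inner_ge_zero[of "snd (snd v)"] by linarith
  qed
  have "- v \<in> hyperboloid" if "v \<notin> hyperboloid"
    using that nz assms(2) by (simp add: hyperboloid_def bilinear_rneg[OF bilinear_lf] bilinear_lneg[OF bilinear_lf])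
  then show ?thesis
    using pos[of v] pos[of "-v"] bilinear_rneg[OF bilinear_lf, of u v] by (metis neg_0_less_iff_less not_less_iff_gr_or_eq)
qed

lemma lf_hyperboloid_pos: "u \<in> hyperboloid \<Longrightarrow> v \<in> hyperboloid \<Longrightarrow> lf u v > 0"
  using in_hyperboloid_iff_lf_pos[of u v] by (simp add: hyperboloid_def)

lemma lorentzI:
  assumes "linear A" "\<And>v w. lf (A v) (A w) = lf v w" "u \<in> hyperboloid" "A u \<in> hyperboloid"
  shows "lorentz A"
  unfolding lorentz_def
proof (intro conjI allI subsetI)
  fix v assume "v \<in> A ` hyperboloid"
  then obtain w where w: "w \<in> hyperboloid" "v = A w" by auto
  then have "lf (A u) v > 0" "lf v v = 1"
    using assms lf_hyperboloid_pos[of u w] by (auto simp: hyperboloid_def)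
  then show "v \<in> hyperboloid"
    using in_hyperboloid_iff_lf_pos assms(4) by blast
qed (use assms in auto)

lemma lorentz_id: "lorentz id"
  by (simp add: lorentz_def linear_id)

lemma lorentz_comp: "lorentz A \<Longrightarrow> lorentz B \<Longrightarrow> lorentz (A \<circ> B)"
  by (intro lorentzI_all linear_compose) (simp_all add: lorentz_linear lorentz_lf lorentz_hyperboloid)

abbreviation linv :: "(lvec \<Rightarrow> lvec) \<Rightarrow> lvec \<Rightarrow> lvec"
  where "linv \<equiv> inv_into UNIV"

lemma linv_comp: "lorentz A \<Longrightarrow> linv A \<circ> A = id"
  and comp_linv: "lorentz A \<Longrightarrow> A \<circ> linv A = id"
  using lorentz_bij[of A] by (auto simp: bij_is_inj fun_eq_iff bij_is_surj surj_f_inv_f)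

lemma lorentz_inv:
  assumes "lorentz A"
  shows "lorentz (linv A)"
proof -
  have b: "bij A" using assms by (rule lorentz_bij)
  have lin: "linear (linv A)"
    using inj_linear_imp_inv_linear[OF lorentz_linear[OF assms] bij_is_inj[OF b]] .
  have lf: "lf (linv A v) (linv A w) = lf v w" for v w
    using lorentz_lf[OF assms, of "linv A v" "linv A w"] b by (simp add: bij_is_surj surj_f_inv_f)
  define u where "u = lor (vector [0,0,1])"
  have u: "u \<in> hyperboloid" unfolding u_def by (rule lor_in_hyperboloid) (simp add: H3_iff)
  have "linv A (A u) \<in> hyperboloid" using u b by (simp add: bij_is_inj)
  then show ?thesis
    by (rule lorentzI[OF lin lf lorentz_hyperboloid[OF assms u]])
qed

lemma act_in_H3: "lorentz A \<Longrightarrow> x \<in> H3 \<Longrightarrow> act A x \<in> H3"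
  unfolding act_def by (rule unlor_in_H3, rule lorentz_hyperboloid, assumption, rule lor_in_hyperboloid)

lemma lor_act: "lorentz A \<Longrightarrow> x \<in> H3 \<Longrightarrow> lor (act A x) = A (lor x)"
  unfolding act_def by (rule lor_unlor, rule lorentz_hyperboloid, assumption, rule lor_in_hyperboloid)

lemma act_comp: "lorentz B \<Longrightarrow> x \<in> H3 \<Longrightarrow> act (A \<circ> B) x = act A (act B x)"
  using lor_act[of B x] by (simp add: act_def[of A] act_def[of "A \<circ> B"])

lemma act_id: "x \<in> H3 \<Longrightarrow> act id x = x"
  by (simp add: act_def)

lemma act_inv_act: "lorentz A \<Longrightarrow> x \<in> H3 \<Longrightarrow> act (linv A) (act A x) = x"
  and act_act_inv: "lorentz A \<Longrightarrow> x \<in> H3 \<Longrightarrow> act A (act (linv A) x) = x"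
  using act_comp[of A x "linv A"] act_comp[of "linv A" x A] lorentz_inv[of A]
  by (auto simp: act_id linv_comp comp_linv)

lemma hyp_dist_act:
  assumes "lorentz A" "x \<in> H3" "y \<in> H3"
  shows "hyp_dist (act A x) (act A y) = hyp_dist x y"
  using assms by (subst hyp_dist_eq_iff) (auto simp: act_in_H3 lor_act lorentz_lf)

lemma continuous_on_act:
  assumes "lorentz A"
  shows "continuous_on H3 (act A)"
proof -
  have "continuous_on (lor ` H3) A"
    using lorentz_linear[OF assms] by (rule linear_continuous_on[OF linear_conv_bounded_linear[THEN iffD1]])
  then have "continuous_on H3 (A \<circ> lor)"
    by (rule continuous_on_compose[OF continuous_on_lor])
  moreover have "continuous_on ((A \<circ> lor) ` H3) unlor"
    by (rule continuous_on_subset[OF continuous_on_unlor], rule image_subsetI)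
      (simp add: lorentz_hyperboloid[OF assms] lor_in_hyperboloid)
  ultimately have "continuous_on H3 (unlor \<circ> (A \<circ> lor))"
    by (rule continuous_on_compose)
  then show ?thesis by (simp add: act_def[abs_def] comp_def)
qed

section \<open>Rigidity of isometries between open sets\<close>

lemma span_lor_open:
  assumes "open W" "W \<subseteq> H3" "W \<noteq> {}"
  shows "span (lor ` W) = UNIV"
proof (rule ccontr)
  assume "span (lor ` W) \<noteq> UNIV"
  then obtain a where a: "a \<noteq> 0" "\<And>v. v \<in> span (lor ` W) \<Longrightarrow> a \<bullet> v = 0"
    using span_not_univ_subset_hyperplane by (metis (mono_tags, lifting) mem_Collect_eq subset_eq)
  obtain \<alpha> \<beta> \<gamma> where abc: "a = (\<alpha>, \<beta>, \<gamma>)" by (cases a) auto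
  obtain c e where e: "e > 0" "ball c e \<subseteq> W"
    using assms by (metis ex_in_conv openE)
  \<comment> \<open>Multiplied by the height, orthogonality to \<open>lor x\<close> becomes the
    equation of a Euclidean sphere or plane, here satisfied on an entire ball.\<close>
  have z: "\<alpha> * ((x$1)\<^sup>2 + (x$2)\<^sup>2 + (x$3)\<^sup>2) + \<beta> + Re \<gamma> * x$1 + Im \<gamma> * x$2 = 0" if "x \<in> ball c e" for x
  proof -
    have "x \<in> W" "x$3 > 0" using that e assms(2) H3_iff by blast+
    then have "a \<bullet> lor x = 0" using a span_base by blast
    moreover have "\<alpha> * ((x$1)\<^sup>2 + (x$2)\<^sup>2 + (x$3)\<^sup>2) + \<beta> + Re \<gamma> * x$1 + Im \<gamma> * x$2 = (a \<bullet> lor x) * x$3"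
      using \<open>x$3 > 0\<close> by (simp add: abc lor_def norm_vec3 inner_complex_def distrib_right)
    ultimately show ?thesis by simp
  qed
  \<comment> \<open>The second vertical difference isolates \<alpha>, the first differences along
    the horizontal axes isolate the two parts of \<gamma>, and then \<beta> is all that is
    left.\<close>
  define h where "h = e / 2"
  have h: "h > 0" "h < e" using e by (auto simp: h_def)
  have in_ball: "c \<in> ball c e" "c + h *\<^sub>R axis i 1 \<in> ball c e" "c - h *\<^sub>R axis i 1 \<in> ball c e" for i
    using h e by (auto simp: dist_norm)
  define F where "F x = \<alpha> * ((x$1)\<^sup>2 + (x$2)\<^sup>2 + (x$3)\<^sup>2) + \<beta> + Re \<gamma> * x$1 + Im \<gamma> * x$2" for x :: "real^3"
  have F: "F c = 0" "F (c + h *\<^sub>R axis i 1) = 0" "F (c - h *\<^sub>R axis i 1) = 0" for i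
    using z in_ball unfolding F_def by blast+
  have "2 * (\<alpha> * h * h) = F (c + h *\<^sub>R axis 3 1) + F (c - h *\<^sub>R axis 3 1) - 2 * F c"
    unfolding F_def by (simp add: axis_def power2_eq_square algebra_simps)
  then have al: "\<alpha> = 0" using h F by simp
  have "Re \<gamma> * h = F (c + h *\<^sub>R axis 1 1) - F c" "Im \<gamma> * h = F (c + h *\<^sub>R axis 2 1) - F c"
    unfolding F_def al by (simp_all add: axis_def algebra_simps)
  then have "Re \<gamma> = 0" "Im \<gamma> = 0"
    using h F by simp_all
  then have "\<gamma> = 0" by (simp add: complex_eq_iff)
  moreover have "\<beta> = 0" using z[OF in_ball(1)] al \<open>\<gamma> = 0\<close> by simp
  ultimately show False using a al abc by (simp add: zero_prod_def)
qed

lemma lorentz_eqI: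
  assumes "lorentz A" "lorentz B" "open W" "W \<subseteq> H3" "W \<noteq> {}" "\<And>x. x \<in> W \<Longrightarrow> act A x = act B x"
  shows "A = B"
proof
  fix v
  show "A v = B v"
  proof (rule linear_eq_on_span[OF assms(1,2)[THEN lorentz_linear], of "lor ` W"])
    fix u assume "u \<in> lor ` W"
    then obtain x where x: "x \<in> W" "u = lor x" by (rule imageE)
    have "lor (act A x) = lor (act B x)" by (simp only: assms(6)[OF x(1)])
    then show "A u = B u"
      using lor_act[of A x] lor_act[of B x] assms(1,2,4) x by (simp add: subset_iff)
  next
    show "v \<in> span (lor ` W)" by (simp only: span_lor_open[OF assms(3,4,5)] UNIV_I)
  qed
qed

text \<open>The Gram matrix of a basis taken from the image of the open set determines the extension.\<close>

lemma distance_preserving_imp_act: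
  assumes W: "open W" "W \<subseteq> H3" "W \<noteq> {}" and f: "f ` W \<subseteq> H3"
    and iso: "\<And>x y. x \<in> W \<Longrightarrow> y \<in> W \<Longrightarrow> hyp_dist (f x) (f y) = hyp_dist x y"
  obtains A where "lorentz A" "\<And>x. x \<in> W \<Longrightarrow> f x = act A x"
proof -
  obtain B where B: "B \<subseteq> lor ` W" "independent B" "lor ` W \<subseteq> span B"
    by (metis maximal_independent_subset)
  then have spB: "span B = UNIV"
    by (metis span_lor_open[OF W] span_mono span_span top.extremum_uniqueI)
  obtain A where A: "linear A" "\<And>b. b \<in> B \<Longrightarrow> A b = lor (f (unlor b))"
    using linear_independent_extend[OF B(2), of "\<lambda>b. lor (f (unlor b))"] by blast
  have pres: "lf (lor (f x)) (lor (f y)) = lf (lor x) (lor y)" if "x \<in> W" "y \<in> W" for x y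
    using iso[OF that] that W f by (subst (asm) hyp_dist_eq_iff) auto
  have AB: "lf (A b) (A c) = lf b c" if bc: "b \<in> B" "c \<in> B" for b c
  proof -
    obtain x y where xy: "x \<in> W" "y \<in> W" "b = lor x" "c = lor y"
      using bc B(1) by blast
    then have "unlor b = x" "unlor c = y" using W by auto
    then show ?thesis using pres[OF xy(1,2)] A(2) bc xy by simp
  qed
  have Alf: "lf (A v) (A w) = lf v w" for v w
  proof -
    have "bilinear (\<lambda>v w. lf (A v) (A w))"
      unfolding bilinear_def
      by (intro conjI allI linearI) (simp_all only: lf_simps linear_add[OF A(1)] linear_scale[OF A(1)] split_paired_all)
    then show ?thesis
      by (rule bilinear_eq[OF _ bilinear_lf, of _ UNIV B UNIV B v w]) (simp_all only: AB spB subset_refl UNIV_I)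
  qed
  have surj: "surj A" using isometry_bij[OF A(1) Alf] by (rule bij_is_surj)
  \<comment> \<open>For a point outside the basis: the difference of both sides pairs to zero with
    every \<open>A b\<close>, hence with the image of \<open>A\<close>, which is the whole
    space.\<close>
  have *: "A (lor x) = lor (f x)" if x: "x \<in> W" for x
  proof -
    have 0: "lf (A (lor x) - lor (f x)) (A b) = 0" if b: "b \<in> B" for b
    proof -
      obtain y where y: "y \<in> W" "b = lor y" using subsetD[OF B(1) b] by blast
      moreover have "unlor b = y" using y W by auto
      ultimately show ?thesis
        using A(2)[OF b] pres[OF x y(1)] Alf[of "lor x" b] by (simp add: lf_simps)
    qed
    have "lf (A (lor x) - lor (f x)) (A w) = 0" for w
    proof -
      have "linear (\<lambda>w. lf (A (lor x) - lor (f x)) (A w))"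
        by (intro linearI) (simp_all only: lf_simps linear_add[OF A(1)] linear_scale[OF A(1)])
      then show ?thesis
        by (rule linear_eq_on_span[OF _ linear_zero, of _ B]) (simp_all only: 0 spB UNIV_I)
    qed
    then have "lf (A (lor x) - lor (f x)) w = 0" for w
      using surj by (metis surjD)
    then show ?thesis using lf_nondegenerate by (metis right_minus_eq)
  qed
  obtain x where "x \<in> W" using W by auto
  then have "lorentz A"
    using lorentzI[OF A(1) Alf, of "lor x"] * lor_in_hyperboloid W f by (metis image_subset_iff subset_iff)
  moreover have "f x = act A x" if "x \<in> W" for x
    using * that f by (auto simp: act_def image_subset_iff)
  ultimately show ?thesis using that by blast
qed

section \<open>Local isometries\<close>

definition hball :: "real^3 \<Rightarrow> real \<Rightarrow> (real^3) set"
  where "hball q \<epsilon> = {x \<in> H3. hyp_dist q x < \<epsilon>}"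

text \<open>The cosine formula turns the ball into |q - x|^2 < k x_3, and completing the square in
  the height shows a Euclidean ball with raised centre. Openness and connectedness of hyperbolic
  balls follow from this.\<close>

lemma hball_eq_ball:
  assumes q: "q \<in> H3" and e: "\<epsilon> > 0"
  obtains c r where "hball q \<epsilon> = ball c r" "r > 0"
proof -
  define k where "k = 2 * q$3 * (cosh \<epsilon> - 1)"
  define c where "c = q + (k / 2) *\<^sub>R axis 3 1"
  define r where "r = sqrt (k * q$3 + k\<^sup>2 / 4)"
  have q3: "q$3 > 0" using q by (simp add: H3_iff)
  have ce: "cosh \<epsilon> > 1" using cosh_real_nonneg_less_iff[of 0 \<epsilon>] e by simp
  have k: "k > 0" using q3 ce by (simp add: k_def)
  have kq: "k * q$3 + k\<^sup>2 / 4 > 0" using k q3 by (intro add_pos_pos) auto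
  then have r: "r > 0" by (simp add: r_def)
  have c: "c$1 = q$1" "c$2 = q$2" "c$3 = q$3 + k / 2"
    by (auto simp: c_def axis_def)
  have ball: "x \<in> ball c r \<longleftrightarrow> (dist q x)\<^sup>2 < k * x$3" for x
  proof -
    have "x \<in> ball c r \<longleftrightarrow> (dist c x)\<^sup>2 < r\<^sup>2"
      using r power2_less_imp_less[of "dist c x" r] power_strict_mono[of "dist c x" r 2] by auto
    also have "r\<^sup>2 = k * q$3 + k\<^sup>2 / 4"
      using kq by (simp add: r_def)
    also have "(dist c x)\<^sup>2 = (dist q x)\<^sup>2 - k * x$3 + k * q$3 + k\<^sup>2 / 4"
      unfolding dist_norm norm_vec3 by (simp add: c power2_eq_square field_simps)
    finally show ?thesis by simp
  qed
  have "x \<in> hball q \<epsilon> \<longleftrightarrow> x \<in> ball c r" for x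
  proof (cases "x \<in> H3")
    case True
    have "hyp_dist q x < \<epsilon> \<longleftrightarrow> cosh (hyp_dist q x) < cosh \<epsilon>"
      using cosh_real_nonneg_less_iff[of "hyp_dist q x" \<epsilon>] hyp_dist_nonneg[OF q True] e by simp
    also have "\<dots> \<longleftrightarrow> (dist q x)\<^sup>2 / (2 * q$3 * x$3) < cosh \<epsilon> - 1"
      unfolding cosh_hyp_dist[OF q True] by linarith
    also have "\<dots> \<longleftrightarrow> (dist q x)\<^sup>2 < (cosh \<epsilon> - 1) * (2 * q$3 * x$3)"
      using q3 True by (intro pos_divide_less_eq) (simp add: H3_iff)
    also have "\<dots> \<longleftrightarrow> x \<in> ball c r" unfolding ball k_def by (simp add: mult_ac)
    finally show ?thesis using True by (simp add: hball_def)
  next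
    case False
    have "x$3 > 0" if "(dist q x)\<^sup>2 < k * x$3"
    proof -
      have "0 < k * x$3" using that by (rule le_less_trans[OF zero_le_power2])
      then show ?thesis using k by (simp add: zero_less_mult_iff)
    qed
    then show ?thesis using False ball by (auto simp: hball_def H3_iff)
  qed
  then show ?thesis using that r by blast
qed

lemma centre_in_hball: "q \<in> H3 \<Longrightarrow> \<epsilon> > 0 \<Longrightarrow> q \<in> hball q \<epsilon>"
  by (simp add: hball_def)

lemma hball_subset_H3: "hball q \<epsilon> \<subseteq> H3"
  by (auto simp: hball_def)

lemma open_hball: "q \<in> H3 \<Longrightarrow> \<epsilon> > 0 \<Longrightarrow> open (hball q \<epsilon>)"
  and connected_hball: "q \<in> H3 \<Longrightarrow> \<epsilon> > 0 \<Longrightarrow> connected (hball q \<epsilon>)"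
  by (metis hball_eq_ball open_ball, metis hball_eq_ball connected_ball)

lemma small_ball:
  assumes "q \<in> H3" "\<epsilon> > 0"
  obtains e where "e > 0" "ball q e \<subseteq> H3" "\<And>x y. x \<in> ball q e \<Longrightarrow> y \<in> ball q e \<Longrightarrow> hyp_dist x y < \<epsilon>"
proof
  define c where "c = q$3 / 2"
  define e where "e = min c (\<epsilon> * c / 2)"
  have c: "c > 0" using assms by (simp add: c_def H3_iff)
  show "e > 0" using c assms by (simp add: e_def)
  have x3: "x$3 \<ge> c" if "x \<in> ball q e" for x
  proof -
    have "\<bar>q$3 - x$3\<bar> \<le> dist q x"
      using component_le_norm_cart[of "q - x" 3] by (simp add: dist_norm)
    moreover have "dist q x < c" using that by (simp add: e_def)
    moreover have "q$3 = 2 * c" by (simp add: c_def)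
    ultimately show ?thesis by linarith
  qed
  then show "ball q e \<subseteq> H3" using c unfolding H3_iff subset_iff by (meson less_le_trans)
  fix x y assume xy: "x \<in> ball q e" "y \<in> ball q e"
  have "hyp_dist x y \<le> dist x y / c" using hyp_dist_le[OF c] x3 xy by auto
  also have "\<dots> < 2 * e / c"
  proof -
    have "dist x y < 2 * e" using xy dist_triangle_less_add[of x q e y e] by (simp add: dist_commute)
    then show ?thesis using c by (simp add: divide_strict_right_mono)
  qed
  also have "\<dots> \<le> \<epsilon>" using c by (simp add: e_def divide_le_eq)
  finally show "hyp_dist x y < \<epsilon>" .
qed

text \<open>Analytic continuation in abstract form. The interior of the agreement set is also
  relatively closed: near a limit point \<open>loc\<close> enlarges agreement on a nonempty open
  piece to agreement on a full neighbourhood.\<close>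

lemma identity_principle:
  assumes W: "open W" "connected W" and V: "open V" "V \<subseteq> W" "V \<noteq> {}" "\<And>x. x \<in> V \<Longrightarrow> f x = g x"
    and loc: "\<And>q. q \<in> W \<Longrightarrow> \<exists>e>0. \<forall>V. open V \<and> V \<subseteq> ball q e \<inter> W \<and> V \<noteq> {} \<and> (\<forall>x\<in>V. f x = g x) \<longrightarrow>
               (\<forall>x\<in>ball q e \<inter> W. f x = g x)"
    and "x \<in> W"
  shows "f x = g x"
proof -
  define S where "S = interior {x \<in> W. f x = g x}"
  have S: "open S" "S \<subseteq> W" "V \<subseteq> S" and SE: "x \<in> S \<Longrightarrow> f x = g x" for x
  proof -
    show "S \<subseteq> W" "x \<in> S \<Longrightarrow> f x = g x" unfolding S_def using interior_subset by blast+
    show "V \<subseteq> S" unfolding S_def using V by (intro interior_maximal) auto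
  qed (simp add: S_def)
  have "closedin (top_of_set W) S"
  proof (rule closedin_limpt[THEN iffD2], intro conjI allI impI)
    fix q assume q: "q islimpt S \<and> q \<in> W"
    then obtain e where e: "e > 0" and ex: "\<And>V. open V \<Longrightarrow> V \<subseteq> ball q e \<inter> W \<Longrightarrow> V \<noteq> {} \<Longrightarrow> (\<forall>x\<in>V. f x = g x) \<Longrightarrow>
               (\<forall>x\<in>ball q e \<inter> W. f x = g x)"
      using loc[of q] by metis
    have "\<exists>y\<in>S. y \<in> ball q e"
      using q e by (auto simp: islimpt_approachable dist_commute)
    then have "\<forall>x\<in>ball q e \<inter> W. f x = g x"
      by (intro ex[of "ball q e \<inter> S"]) (use S SE in auto)
    then have "ball q e \<inter> W \<subseteq> S"
      unfolding S_def using W by (intro interior_maximal) auto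
    then show "q \<in> S" using q e by auto
  qed (use S in auto)
  moreover have "openin (top_of_set W) S"
    using S by (simp add: openin_open_eq W)
  ultimately have "S = W"
    using W(2) V S unfolding connected_clopen by blast
  then show ?thesis using SE assms(8) by auto
qed

text \<open>The Lorentz maps found on small balls form a locally constant family by rigidity, so
  connectedness leaves only one. The local form is needed for a local isometry into M read in a
  chart, where distances of far points are not known beforehand.\<close>

lemma locally_distance_preserving_imp_act:
  assumes W: "connected W" "W \<noteq> {}" "W \<subseteq> H3"
    and loc: "\<And>q. q \<in> W \<Longrightarrow> \<exists>e>0. ball q e \<subseteq> W \<and> f ` ball q e \<subseteq> H3 \<and>
               (\<forall>x\<in>ball q e. \<forall>y\<in>ball q e. hyp_dist (f x) (f y) = hyp_dist x y)"
  obtains A where "lorentz A" "\<And>x. x \<in> W \<Longrightarrow> f x = act A x"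
proof -
  have oW: "open W" using loc by (meson openI)
  have ex: "\<exists>e>0. ball q e \<subseteq> W \<and> (\<exists>A. lorentz A \<and> (\<forall>x\<in>ball q e. f x = act A x))" if q: "q \<in> W" for q
  proof -
    obtain e where e: "e > 0" "ball q e \<subseteq> W" "f ` ball q e \<subseteq> H3"
       "\<And>x y. x \<in> ball q e \<Longrightarrow> y \<in> ball q e \<Longrightarrow> hyp_dist (f x) (f y) = hyp_dist x y"
      using loc[OF q] by metis
    obtain A where "lorentz A" "\<And>x. x \<in> ball q e \<Longrightarrow> f x = act A x"
      by (rule distance_preserving_imp_act[of "ball q e" f]) (use e W in auto)
    then show ?thesis using e by blast
  qed
  obtain q0 where q0: "q0 \<in> W" using W by auto
  obtain e0 A where A: "e0 > 0" "ball q0 e0 \<subseteq> W" "lorentz A" "\<And>x. x \<in> ball q0 e0 \<Longrightarrow> f x = act A x"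
    using ex[OF q0] by blast
  have "f x = act A x" if "x \<in> W" for x
  proof (rule identity_principle[OF oW W(1), of "ball q0 e0" f "act A"])
    fix q assume "q \<in> W"
    then obtain e B where B: "e > 0" "ball q e \<subseteq> W" "lorentz B" "\<And>x. x \<in> ball q e \<Longrightarrow> f x = act B x"
      using ex by blast
    have "\<forall>x\<in>ball q e \<inter> W. f x = act A x"
      if V: "open V" "V \<subseteq> ball q e \<inter> W" "V \<noteq> {}" "\<forall>x\<in>V. f x = act A x" for V
    proof -
      have "A = B"
      proof (rule lorentz_eqI[OF A(3) B(3) V(1) _ V(3)])
        show "V \<subseteq> H3" using V(2) W(3) by blast
        fix x assume "x \<in> V"
        then show "act A x = act B x" using V(2,4) B(4)[of x] by auto
      qed
      then show ?thesis using B by auto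
    qed
    then show "\<exists>e>0. \<forall>V. open V \<and> V \<subseteq> ball q e \<inter> W \<and> V \<noteq> {} \<and> (\<forall>x\<in>V. f x = act A x) \<longrightarrow>
               (\<forall>x\<in>ball q e \<inter> W. f x = act A x)"
      using B(1) by blast
  qed (use A that in auto)
  then show ?thesis using that A by blast
qed

text \<open>Distances are compared only on small balls because on larger sets the map may wrap
  around M and shorten them. Requiring the balls to lie in \<open>W\<close> makes \<open>W\<close>
  open.\<close>

definition loc_isom :: "'a set \<Rightarrow> ('a \<Rightarrow> 'a \<Rightarrow> real) \<Rightarrow> (real^3) set \<Rightarrow> (real^3 \<Rightarrow> 'a) \<Rightarrow> bool"
  where "loc_isom M d W p \<longleftrightarrow> W \<subseteq> H3 \<and> (\<forall>q\<in>W. \<exists>e>0. ball q e \<subseteq> W \<and> p ` ball q e \<subseteq> M \<and>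
           (\<forall>x\<in>ball q e. \<forall>y\<in>ball q e. d (p x) (p y) = hyp_dist x y))"

lemma loc_isom_open: "loc_isom M d W p \<Longrightarrow> open W"
  unfolding loc_isom_def by (meson openI)

lemma loc_isom_subset_H3: "loc_isom M d W p \<Longrightarrow> W \<subseteq> H3"
  by (simp add: loc_isom_def)

lemma loc_isomE:
  assumes "loc_isom M d W p" "q \<in> W" "\<epsilon> > 0"
  obtains e where "e > 0" "e \<le> \<epsilon>" "ball q e \<subseteq> W" "\<And>x. x \<in> ball q e \<Longrightarrow> p x \<in> M"
    "\<And>x y. x \<in> ball q e \<Longrightarrow> y \<in> ball q e \<Longrightarrow> d (p x) (p y) = hyp_dist x y"
proof -
  obtain e where e: "e > 0" "ball q e \<subseteq> W" "p ` ball q e \<subseteq> M"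
    "\<forall>x\<in>ball q e. \<forall>y\<in>ball q e. d (p x) (p y) = hyp_dist x y"
    using assms(1,2) unfolding loc_isom_def by blast
  have sub: "ball q (min e \<epsilon>) \<subseteq> ball q e" by auto
  show ?thesis
  proof (rule that[of "min e \<epsilon>"])
    show "ball q (min e \<epsilon>) \<subseteq> W" using sub e(2) by (rule order_trans)
  qed (use e assms(3) sub in auto)
qed

lemma loc_isom_in: "loc_isom M d W p \<Longrightarrow> q \<in> W \<Longrightarrow> p q \<in> M"
  by (rule loc_isomE[of M d W p q 1]) auto

lemma loc_isomI:
  assumes "W \<subseteq> H3"
    "\<And>q. q \<in> W \<Longrightarrow> \<exists>U p'. open U \<and> q \<in> U \<and> U \<subseteq> W \<and> loc_isom M d U p' \<and> (\<forall>x\<in>U. p x = p' x)"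
  shows "loc_isom M d W p"
  unfolding loc_isom_def
proof (intro conjI ballI assms(1))
  fix q assume "q \<in> W"
  then obtain U p' where U: "open U" "q \<in> U" "U \<subseteq> W" "loc_isom M d U p'" "\<And>x. x \<in> U \<Longrightarrow> p x = p' x"
    using assms(2) by metis
  obtain e where "e > 0" "e \<le> 1" "ball q e \<subseteq> U" "\<And>x. x \<in> ball q e \<Longrightarrow> p' x \<in> M"
    "\<And>x y. x \<in> ball q e \<Longrightarrow> y \<in> ball q e \<Longrightarrow> d (p' x) (p' y) = hyp_dist x y"
    by (fact loc_isomE[OF U(4,2) zero_less_one])
  then show "\<exists>e>0. ball q e \<subseteq> W \<and> p ` ball q e \<subseteq> M \<and>
           (\<forall>x\<in>ball q e. \<forall>y\<in>ball q e. d (p x) (p y) = hyp_dist x y)"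
    using U(3,5) by (intro exI[of _ e]) (auto simp: subset_iff)
qed

lemma loc_isom_subset:
  assumes "loc_isom M d W p" "open U" "U \<subseteq> W"
  shows "loc_isom M d U p"
  unfolding loc_isom_def
proof (intro conjI ballI)
  show "U \<subseteq> H3" using assms loc_isom_subset_H3 by blast
  fix q assume q: "q \<in> U"
  obtain \<epsilon> where eps: "\<epsilon> > 0" "ball q \<epsilon> \<subseteq> U" using assms(2) q by (auto simp: open_contains_ball)
  obtain e where e: "e > 0" "e \<le> \<epsilon>" "ball q e \<subseteq> W" "\<And>x. x \<in> ball q e \<Longrightarrow> p x \<in> M"
    "\<And>x y. x \<in> ball q e \<Longrightarrow> y \<in> ball q e \<Longrightarrow> d (p x) (p y) = hyp_dist x y"
    by (fact loc_isomE[OF assms(1) subsetD[OF assms(3) q] eps(1)])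
  moreover have "ball q e \<subseteq> U" using e(2) eps(2) subset_ball by blast
  ultimately show "\<exists>e>0. ball q e \<subseteq> U \<and> p ` ball q e \<subseteq> M \<and>
           (\<forall>x\<in>ball q e. \<forall>y\<in>ball q e. d (p x) (p y) = hyp_dist x y)"
    by (intro exI[of _ e]) auto
qed

lemma isometric_imp_loc_isom:
  assumes "open W" "W \<subseteq> H3" "\<And>x. x \<in> W \<Longrightarrow> p x \<in> M"
    "\<And>x y. x \<in> W \<Longrightarrow> y \<in> W \<Longrightarrow> d (p x) (p y) = hyp_dist x y"
  shows "loc_isom M d W p"
  unfolding loc_isom_def
proof (intro conjI ballI assms(2))
  fix q assume "q \<in> W"
  then obtain e where "e > 0" "ball q e \<subseteq> W" using assms(1) by (auto simp: open_contains_ball)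
  then show "\<exists>e>0. ball q e \<subseteq> W \<and> p ` ball q e \<subseteq> M \<and>
           (\<forall>x\<in>ball q e. \<forall>y\<in>ball q e. d (p x) (p y) = hyp_dist x y)"
    using assms(3,4) by (intro exI[of _ e]) (auto simp: subset_iff)
qed

lemma loc_isom_comp_act:
  assumes p: "loc_isom M d W p" and A: "lorentz A" and U: "open U" "U \<subseteq> H3" "act A ` U \<subseteq> W"
  shows "loc_isom M d U (p \<circ> act A)"
proof (rule loc_isomI[OF U(2)])
  fix q assume q: "q \<in> U"
  then have Aq: "act A q \<in> W" using U by blast
  obtain e where e: "e > 0" "e \<le> 1" "ball (act A q) e \<subseteq> W" "\<And>x. x \<in> ball (act A q) e \<Longrightarrow> p x \<in> M"
    "\<And>x y. x \<in> ball (act A q) e \<Longrightarrow> y \<in> ball (act A q) e \<Longrightarrow> d (p x) (p y) = hyp_dist x y"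
    by (fact loc_isomE[OF p Aq zero_less_one])
  define V where "V = U \<inter> act A -` ball (act A q) e"
  have "continuous_on U (act A)" using continuous_on_act[OF A] U continuous_on_subset by blast
  then have V: "open V" "q \<in> V" "V \<subseteq> U"
    using continuous_open_preimage[OF _ U(1) open_ball] q e(1) by (auto simp: V_def)
  have "loc_isom M d V (p \<circ> act A)"
  proof (rule isometric_imp_loc_isom[OF V(1)])
    show "V \<subseteq> H3" using V U by blast
    then show "d ((p \<circ> act A) x) ((p \<circ> act A) y) = hyp_dist x y" if "x \<in> V" "y \<in> V" for x y
      using that e(5) by (auto simp: V_def hyp_dist_act[OF A] subset_iff)
  qed (auto simp: V_def e(4))
  then show "\<exists>V p'. open V \<and> q \<in> V \<and> V \<subseteq> U \<and> loc_isom M d V p' \<and> (\<forall>x\<in>V. (p \<circ> act A) x = p' x)"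
    using V by blast
qed

locale hyperbolic_space = Metric_space M d for M :: "'a set" and d +
  assumes charts: "\<And>x. x \<in> M \<Longrightarrow> \<exists>U f. x \<in> U \<and> hyperbolic_chart M d U f"
begin

text \<open>The radius is small enough for the metric ball to lie in the chart domain and for the
  hyperbolic ball of the same radius to lie in the open image. The isometry then matches the two
  balls, and the equal radii later make every sheet over the ball a hyperbolic ball.\<close>

lemma chart_ball:
  assumes "m \<in> M"
  obtains \<epsilon> f g where "\<epsilon> > 0" "f m \<in> H3"
    "\<And>y. y \<in> mball m \<epsilon> \<Longrightarrow> f y \<in> hball (f m) \<epsilon> \<and> g (f y) = y"
    "\<And>x. x \<in> hball (f m) \<epsilon> \<Longrightarrow> g x \<in> mball m \<epsilon> \<and> f (g x) = x"
    "\<And>y z. y \<in> mball m \<epsilon> \<Longrightarrow> z \<in> mball m \<epsilon> \<Longrightarrow> hyp_dist (f y) (f z) = d y z"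
proof -
  obtain U f where mU: "m \<in> U" and "hyperbolic_chart M d U f"
    using charts[OF assms] by blast
  then have U: "openin mtopology U" "open (f ` U)" "f ` U \<subseteq> H3"
    and iso: "\<And>y z. y \<in> U \<Longrightarrow> z \<in> U \<Longrightarrow> hyp_dist (f y) (f z) = d y z"
    by (auto simp: hyperbolic_chart_def)
  have UM: "U \<subseteq> M" using U(1) openin_mtopology by blast
  have fm: "f m \<in> H3" using U mU by blast
  obtain \<delta> where \<delta>: "\<delta> > 0" "mball m \<delta> \<subseteq> U"
    using U(1) mU by (auto simp: openin_mtopology)
  obtain e where e: "e > 0" "ball (f m) e \<subseteq> f ` U"
    using U(2) mU by (auto simp: open_contains_ball)
  obtain \<eta> where \<eta>: "\<eta> > 0" "\<And>x. x \<in> H3 \<Longrightarrow> hyp_dist x (f m) < \<eta> \<Longrightarrow> dist x (f m) < e"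
    using hyp_dist_small[OF fm e(1)] by blast
  define \<epsilon> where "\<epsilon> = min \<delta> \<eta>"
  have sub: "mball m \<epsilon> \<subseteq> U" using \<delta>(2) by (auto simp: \<epsilon>_def)
  have inj: "inj_on f U"
  proof (rule inj_onI)
    fix y z assume yz: "y \<in> U" "z \<in> U" "f y = f z"
    then have "d y z = 0" using iso[OF yz(1,2)] U(3) by auto
    then show "y = z" using yz UM zero[of y z] by (simp add: subset_iff)
  qed
  show thesis
  proof (rule that[of \<epsilon> f "inv_into U f"])
    show "\<epsilon> > 0" using \<delta> \<eta> by (simp add: \<epsilon>_def)
    show "f m \<in> H3" by (rule fm)
    show "f y \<in> hball (f m) \<epsilon> \<and> inv_into U f (f y) = y" if "y \<in> mball m \<epsilon>" for y
      using that sub iso[OF mU, of y] U(3) inj by (auto simp: hball_def subset_iff)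
    show "inv_into U f x \<in> mball m \<epsilon> \<and> f (inv_into U f x) = x" if x: "x \<in> hball (f m) \<epsilon>" for x
    proof -
      have "x \<in> f ` U"
        using x \<eta>(2)[of x] e(2) by (auto simp: hball_def \<epsilon>_def hyp_dist_commute dist_commute subset_iff)
      then obtain u where u: "u \<in> U" "x = f u" by blast
      then show ?thesis
        using x inj iso[OF mU u(1)] UM assms by (auto simp: hball_def)
    qed
    show "hyp_dist (f y) (f z) = d y z" if "y \<in> mball m \<epsilon>" "z \<in> mball m \<epsilon>" for y z
      using iso that sub by blast
  qed
qed

text \<open>Uniqueness of continuation. Read in a chart around \<open>p q\<close>, both maps become
  Lorentz maps on a small ball, and these coincide as soon as they agree on an open set.\<close>

lemma loc_isom_eq:
  assumes p: "loc_isom M d W p" and p': "loc_isom M d W p'" and W: "connected W"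
    and V: "open V" "V \<subseteq> W" "V \<noteq> {}" "\<And>x. x \<in> V \<Longrightarrow> p x = p' x" and x: "x \<in> W"
  shows "p x = p' x"
proof (rule identity_principle[OF loc_isom_open[OF p] W V _ x])
  fix q assume q: "q \<in> W"
  have WH: "W \<subseteq> H3" using loc_isom_subset_H3[OF p] .
  have pq: "p q \<in> M" by (rule loc_isom_in[OF p q])
  obtain \<epsilon> f g where eps: "\<epsilon> > 0" "f (p q) \<in> H3"
    and f: "\<And>y. y \<in> mball (p q) \<epsilon> \<Longrightarrow> f y \<in> hball (f (p q)) \<epsilon> \<and> g (f y) = y"
    and "\<And>x. x \<in> hball (f (p q)) \<epsilon> \<Longrightarrow> g x \<in> mball (p q) \<epsilon> \<and> f (g x) = x"
    and iso: "\<And>y z. y \<in> mball (p q) \<epsilon> \<Longrightarrow> z \<in> mball (p q) \<epsilon> \<Longrightarrow> hyp_dist (f y) (f z) = d y z"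
    by (fact chart_ball[OF pq])
  obtain e0 where e0: "e0 > 0" "ball q e0 \<subseteq> H3"
      "\<And>x y. x \<in> ball q e0 \<Longrightarrow> y \<in> ball q e0 \<Longrightarrow> hyp_dist x y < \<epsilon> / 2"
    by (fact small_ball[OF subsetD[OF WH q] half_gt_zero[OF eps(1)]])
  obtain e1 where e1: "e1 > 0" "e1 \<le> e0" "ball q e1 \<subseteq> W" "\<And>x. x \<in> ball q e1 \<Longrightarrow> p x \<in> M"
    "\<And>x y. x \<in> ball q e1 \<Longrightarrow> y \<in> ball q e1 \<Longrightarrow> d (p x) (p y) = hyp_dist x y"
    by (fact loc_isomE[OF p q e0(1)])
  obtain e where e: "e > 0" "e \<le> e1" "ball q e \<subseteq> W" "\<And>x. x \<in> ball q e \<Longrightarrow> p' x \<in> M"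
    "\<And>x y. x \<in> ball q e \<Longrightarrow> y \<in> ball q e \<Longrightarrow> d (p' x) (p' y) = hyp_dist x y"
    by (fact loc_isomE[OF p' q e1(1)])
  have sub: "ball q e \<subseteq> ball q e1" "ball q e \<subseteq> ball q e0" using e e1 by auto
  note in0 = subsetD[OF sub(2)] and in1 = subsetD[OF sub(1)]
  have "\<forall>x\<in>ball q e \<inter> W. p x = p' x"
    if V: "open V" "V \<subseteq> ball q e \<inter> W" "V \<noteq> {}" "\<forall>x\<in>V. p x = p' x" for V
  proof
    fix x assume "x \<in> ball q e \<inter> W"
    then have x: "x \<in> ball q e" by simp
    obtain v where v: "v \<in> V" "v \<in> ball q e" using V by blast
    have qe: "q \<in> ball q e" using e by simp
    have 1: "p y \<in> mball (p q) \<epsilon>" if "y \<in> ball q e" for y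
    proof -
      have "d (p q) (p y) < \<epsilon> / 2" using e1(5)[OF in1[OF qe] in1[OF that]] e0(3)[OF in0[OF qe] in0[OF that]] by simp
      then show ?thesis using eps pq e1(4)[OF in1[OF that]] by simp
    qed
    \<comment> \<open>Nothing is known about \<open>p' q\<close> yet; the common value at
      \<open>v\<close> shows that \<open>p'\<close> lands in the same chart ball, at the cost of two
      distances below \<open>\<epsilon> / 2\<close>.\<close>
    have 2: "p' y \<in> mball (p q) \<epsilon>" if "y \<in> ball q e" for y
    proof -
      have "d (p q) (p v) < \<epsilon> / 2" using e1(5)[OF in1[OF qe] in1[OF v(2)]] e0(3)[OF in0[OF qe] in0[OF v(2)]] by simp
      moreover have "d (p' v) (p' y) < \<epsilon> / 2" using e(5)[OF v(2) that] e0(3)[OF in0[OF v(2)] in0[OF that]] by simp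
      moreover have "p v = p' v" using V(4) v by blast
      ultimately have "d (p q) (p' y) < \<epsilon>"
        using triangle[OF pq e(4)[OF v(2)] e(4)[OF that]] by simp
      then show ?thesis using pq e(4) that by simp
    qed
    have be: "open (ball q e)" "ball q e \<subseteq> H3" "ball q e \<noteq> {}" using e e0 sub by auto
    have h1: "(f \<circ> p) ` ball q e \<subseteq> H3" using 1 f hball_subset_H3 by (fastforce simp: image_subset_iff)
    have k1: "hyp_dist ((f \<circ> p) y) ((f \<circ> p) z) = hyp_dist y z" if "y \<in> ball q e" "z \<in> ball q e" for y z
        using iso[OF 1 1, OF that] e1(5) that sub by (auto simp: subset_iff)
    have "\<exists>A. lorentz A \<and> (\<forall>x\<in>ball q e. (f \<circ> p) x = act A x)"
      by (rule distance_preserving_imp_act[OF be h1]) (use k1 in blast)+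
    then obtain A where A: "lorentz A" "\<And>x. x \<in> ball q e \<Longrightarrow> (f \<circ> p) x = act A x"
      by blast
    have h2: "(f \<circ> p') ` ball q e \<subseteq> H3" using 2 f hball_subset_H3 by (fastforce simp: image_subset_iff)
    have k2: "hyp_dist ((f \<circ> p') y) ((f \<circ> p') z) = hyp_dist y z" if "y \<in> ball q e" "z \<in> ball q e" for y z
        using iso[OF 2 2, OF that] e(5) that sub by (auto simp: subset_iff)
    have "\<exists>A. lorentz A \<and> (\<forall>x\<in>ball q e. (f \<circ> p') x = act A x)"
      by (rule distance_preserving_imp_act[OF be h2]) (use k2 in blast)+
    then obtain B where B: "lorentz B" "\<And>x. x \<in> ball q e \<Longrightarrow> (f \<circ> p') x = act B x"
      by blast
    have "A = B"
    proof (rule lorentz_eqI[OF A(1) B(1) V(1) _ V(3)])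
      show "V \<subseteq> H3" using V(2) WH by blast
      fix z assume z: "z \<in> V"
      then have "z \<in> ball q e" "p z = p' z" using V(2,4) by blast+
      then show "act A z = act B z" using A(2)[of z] B(2)[of z] by simp
    qed
    then have "f (p x) = f (p' x)" using A(2)[OF x] B(2)[OF x] by simp
    then show "p x = p' x" using f[OF 1[OF x]] f[OF 2[OF x]] by metis
  qed
  then show "\<exists>e>0. \<forall>V. open V \<and> V \<subseteq> ball q e \<inter> W \<and> V \<noteq> {} \<and> (\<forall>x\<in>V. p x = p' x) \<longrightarrow>
               (\<forall>x\<in>ball q e \<inter> W. p x = p' x)"
    using e(1) by blast
qed

end

section \<open>The developing map\<close>

locale complete_hyperbolic_space = hyperbolic_space +
  assumes complete: mcomplete
begin

text \<open>The factor \<open>1 / k\<close> bounds the map near every point of the segment from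
  \<open>x\<close> to \<open>y\<close>, and these local bounds add up along the segment. Only an
  inequality can be expected, since distances in M may be shorter than those of the lifts.\<close>

lemma loc_isom_lipschitz:
  assumes p: "loc_isom M d (ball c r) p" and k: "k > 0" "\<And>x. x \<in> ball c r \<Longrightarrow> x$3 \<ge> k"
    and xy: "x \<in> ball c r" "y \<in> ball c r"
  shows "d (p x) (p y) \<le> dist x y / k"
proof -
  define L where "L = dist x y / k"
  define \<gamma> where "\<gamma> s = x + s *\<^sub>R (y - x)" for s
  define \<phi> where "\<phi> s = d (p x) (p (\<gamma> s))" for s
  have L: "L \<ge> 0" using k by (simp add: L_def)
  have \<gamma>: "\<gamma> s \<in> ball c r" if "s \<in> {0..1}" for s
  proof -
    have "\<gamma> s = (1 - s) *\<^sub>R x + s *\<^sub>R y" by (simp add: \<gamma>_def algebra_simps)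
    then show ?thesis using convexD_alt[OF convex_ball xy, of s] that by simp
  qed
  have d\<gamma>: "dist (\<gamma> s) (\<gamma> t) = \<bar>t - s\<bar> * dist x y" for s t
  proof -
    have "\<gamma> s - \<gamma> t = (s - t) *\<^sub>R (y - x)" by (simp add: \<gamma>_def algebra_simps)
    then show ?thesis by (simp add: dist_norm norm_minus_commute abs_minus_commute)
  qed
  have pM: "p (\<gamma> s) \<in> M" if "s \<in> {0..1}" for s
    by (rule loc_isom_in[OF p \<gamma>[OF that]])
  have px: "p x \<in> M" by (rule loc_isom_in[OF p xy(1)])
  have loc: "\<exists>\<delta>>0. \<forall>t\<in>{0..1}. \<bar>t - s\<bar> < \<delta> \<longrightarrow> dist (\<phi> t) (\<phi> s) \<le> L * \<bar>t - s\<bar>" if s: "s \<in> {0..1}" for s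
  proof -
    obtain e where e: "e > 0" "e \<le> 1" "ball (\<gamma> s) e \<subseteq> ball c r" "\<And>x. x \<in> ball (\<gamma> s) e \<Longrightarrow> p x \<in> M"
      "\<And>x y. x \<in> ball (\<gamma> s) e \<Longrightarrow> y \<in> ball (\<gamma> s) e \<Longrightarrow> d (p x) (p y) = hyp_dist x y"
      by (fact loc_isomE[OF p \<gamma>[OF s] zero_less_one])
    define \<delta> where "\<delta> = e / (dist x y + 1)"
    have dp: "dist x y + 1 > 0" by (simp add: add_nonneg_pos)
    have "dist (\<phi> t) (\<phi> s) \<le> L * \<bar>t - s\<bar>" if t: "t \<in> {0..1}" "\<bar>t - s\<bar> < \<delta>" for t
    proof -
      have "\<bar>t - s\<bar> * dist x y \<le> \<bar>t - s\<bar> * (dist x y + 1)" by (intro mult_left_mono) auto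
      also have "\<dots> < e" using t(2) dp by (simp add: \<delta>_def pos_less_divide_eq)
      finally have "\<gamma> t \<in> ball (\<gamma> s) e" by (simp add: d\<gamma>)
      then have "d (p (\<gamma> s)) (p (\<gamma> t)) = hyp_dist (\<gamma> s) (\<gamma> t)" using e by simp
      also have "\<dots> \<le> dist (\<gamma> s) (\<gamma> t) / k" using hyp_dist_le k \<gamma> s t by blast
      also have "\<dots> = L * \<bar>t - s\<bar>" by (simp add: d\<gamma> L_def)
      finally have "d (p (\<gamma> s)) (p (\<gamma> t)) \<le> L * \<bar>t - s\<bar>" .
      moreover have "\<bar>\<phi> t - \<phi> s\<bar> \<le> d (p (\<gamma> s)) (p (\<gamma> t))"
        using mdist_reverse_triangle[OF pM[OF t(1)] px pM[OF s]] by (simp add: \<phi>_def commute)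
      ultimately show ?thesis by (simp add: dist_real_def)
    qed
    moreover have "\<delta> > 0" using e(1) dp by (simp add: \<delta>_def)
    ultimately show ?thesis by blast
  qed
  have "dist (\<phi> 1) (\<phi> 0) \<le> L * (1 - 0)"
  proof (rule locally_lipschitz_imp_lipschitz_aux)
    show "continuous_on {0..1} \<phi>"
      unfolding continuous_on_iff
    proof (intro ballI allI impI)
      fix s \<epsilon> :: real assume s: "s \<in> {0..1}" and eps: "\<epsilon> > 0"
      obtain \<delta> where \<delta>: "\<delta> > 0" "\<And>t. t \<in> {0..1} \<Longrightarrow> \<bar>t - s\<bar> < \<delta> \<Longrightarrow> dist (\<phi> t) (\<phi> s) \<le> L * \<bar>t - s\<bar>"
        using loc[OF s] by blast
      show "\<exists>\<delta>>0. \<forall>t\<in>{0..1}. dist t s < \<delta> \<longrightarrow> dist (\<phi> t) (\<phi> s) < \<epsilon>"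
      proof (intro exI[of _ "min \<delta> (\<epsilon> / (L + 1))"] conjI ballI impI)
        fix t assume t: "t \<in> {0..1}" "dist t s < min \<delta> (\<epsilon> / (L + 1))"
        then have "dist (\<phi> t) (\<phi> s) \<le> L * \<bar>t - s\<bar>" using \<delta>(2) by (simp add: dist_real_def)
        also have "\<dots> \<le> L * (\<epsilon> / (L + 1))" using t L by (intro mult_left_mono) (auto simp: dist_real_def)
        also have "\<dots> < \<epsilon>" using L eps by (simp add: field_simps)
        finally show "dist (\<phi> t) (\<phi> s) < \<epsilon>" .
      qed (use \<delta>(1) eps L in auto)
    qed
    fix s :: real assume s: "s \<in> {0..<1}"
    then obtain \<delta> where \<delta>: "\<delta> > 0" "\<And>t. t \<in> {0..1} \<Longrightarrow> \<bar>t - s\<bar> < \<delta> \<Longrightarrow> dist (\<phi> t) (\<phi> s) \<le> L * \<bar>t - s\<bar>"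
      using loc[of s] by auto
    define t where "t = min 1 (s + \<delta> / 2)"
    have "t \<in> {s<..1}" "\<bar>t - s\<bar> < \<delta>" "t \<in> {0..1}" "\<bar>t - s\<bar> = t - s"
      using s \<delta>(1) by (auto simp: t_def min_def field_simps)
    then show "\<exists>t\<in>{s<..1}. dist (\<phi> t) (\<phi> s) \<le> L * (t - s)"
      using \<delta>(2)[of t] by auto
  qed simp
  then show ?thesis
    using px loc_isom_in[OF p xy(2)] by (simp add: \<phi>_def \<gamma>_def L_def dist_real_def)
qed

text \<open>This is where completeness enters: by the Lipschitz bound a sequence tending to
  \<open>q\<close> has a Cauchy image, even when \<open>q\<close> is on the boundary of the
  ball.\<close>

lemma loc_isom_limit:
  assumes p: "loc_isom M d (ball c r) p" and r: "r > 0" and k: "k > 0" "\<And>x. x \<in> ball c r \<Longrightarrow> x$3 \<ge> k"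
    and q: "q \<in> cball c r"
  obtains m where "m \<in> M" "\<And>x. x \<in> ball c r \<Longrightarrow> d m (p x) \<le> dist q x / k"
proof -
  note lip = loc_isom_lipschitz[OF p k]
  have "q \<in> closure (ball c r)" using q r by simp
  then obtain xs where xs: "\<And>n. xs n \<in> ball c r" "xs \<longlonglongrightarrow> q"
    unfolding closure_sequential by blast
  have "MCauchy (p \<circ> xs)"
    unfolding MCauchy_def
  proof (intro conjI allI impI)
    show "range (p \<circ> xs) \<subseteq> M" using loc_isom_in[OF p xs(1)] by auto
    fix \<epsilon> :: real assume eps: "\<epsilon> > 0"
    have "Cauchy xs" using xs(2) by (intro convergent_Cauchy convergentI)
    then obtain N where N: "\<And>n n'. n \<ge> N \<Longrightarrow> n' \<ge> N \<Longrightarrow> dist (xs n) (xs n') < \<epsilon> * k"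
      using eps k(1) unfolding Cauchy_def by (meson mult_pos_pos)
    have "d ((p \<circ> xs) n) ((p \<circ> xs) n') < \<epsilon>" if "N \<le> n" "N \<le> n'" for n n'
    proof -
      have "d (p (xs n)) (p (xs n')) \<le> dist (xs n) (xs n') / k" by (intro lip xs)
      also have "\<dots> < \<epsilon>" using N[OF that] k(1) by (simp add: pos_divide_less_eq)
      finally show ?thesis by simp
    qed
    then show "\<exists>N. \<forall>n n'. N \<le> n \<longrightarrow> N \<le> n' \<longrightarrow> d ((p \<circ> xs) n) ((p \<circ> xs) n') < \<epsilon>" by blast
  qed
  then obtain m where "limitin mtopology (p \<circ> xs) m sequentially"
    using complete unfolding mcomplete_def by blast
  then have m: "m \<in> M" and lim: "\<And>\<epsilon>. \<epsilon> > 0 \<Longrightarrow> \<exists>N. \<forall>n\<ge>N. d (p (xs n)) m < \<epsilon>"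
    unfolding limit_metric_sequentially comp_def by blast+
  have "d m (p x) \<le> dist q x / k" if x: "x \<in> ball c r" for x
  proof (rule field_le_epsilon)
    fix \<epsilon> :: real assume eps: "\<epsilon> > 0"
    obtain N1 where N1: "\<And>n. n \<ge> N1 \<Longrightarrow> d (p (xs n)) m < \<epsilon> / 2" using lim[of "\<epsilon>/2"] eps by auto
    obtain N2 where N2: "\<And>n. n \<ge> N2 \<Longrightarrow> dist (xs n) q < k * (\<epsilon> / 2)"
      using xs(2) eps k(1) unfolding lim_sequentially by (meson half_gt_zero mult_pos_pos)
    define n where "n = max N1 N2"
    have "d m (p x) \<le> d m (p (xs n)) + d (p (xs n)) (p x)"
      by (intro triangle m loc_isom_in[OF p] xs x)
    also have "d m (p (xs n)) < \<epsilon> / 2" using N1[of n] by (simp add: commute n_def)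
    also have "d (p (xs n)) (p x) \<le> dist (xs n) x / k" by (intro lip xs x)
    also have "dist (xs n) x / k \<le> (dist (xs n) q + dist q x) / k"
      using k(1) by (intro divide_right_mono dist_triangle) auto
    also have "\<dots> = dist (xs n) q / k + dist q x / k" by (simp add: add_divide_distrib)
    also have "dist (xs n) q / k < \<epsilon> / 2" using N2[of n] k(1) by (simp add: n_def pos_divide_less_eq mult.commute)
    finally show "d m (p x) \<le> dist q x / k + \<epsilon>" by simp
  qed
  then show ?thesis using that m by blast
qed

text \<open>Near \<open>q\<close> the map takes values in a chart around its limit \<open>m\<close>.
  There it is a Lorentz map, which is defined beyond the ball, and the inverse chart carries this
  extension back to M.\<close>

lemma extend_locally:
  assumes p: "loc_isom M d (ball c r) p" and r: "r > 0" and k: "k > 0" "\<And>x. x \<in> ball c r \<Longrightarrow> x$3 \<ge> k"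
    and q: "q \<in> cball c r" "q \<in> H3"
  shows "\<exists>e>0. ball q e \<subseteq> H3 \<and> (\<exists>\<psi>. loc_isom M d (ball q e) \<psi> \<and> (\<forall>x\<in>ball c r \<inter> ball q e. \<psi> x = p x))"
proof -
  obtain m where m: "m \<in> M" and mp: "\<And>x. x \<in> ball c r \<Longrightarrow> d m (p x) \<le> dist q x / k"
    using loc_isom_limit[OF p r k q(1)] by blast
  obtain \<epsilon> f g where eps: "\<epsilon> > 0" "f m \<in> H3"
    and f: "\<And>y. y \<in> mball m \<epsilon> \<Longrightarrow> f y \<in> hball (f m) \<epsilon> \<and> g (f y) = y"
    and g: "\<And>x. x \<in> hball (f m) \<epsilon> \<Longrightarrow> g x \<in> mball m \<epsilon> \<and> f (g x) = x"
    and iso: "\<And>y z. y \<in> mball m \<epsilon> \<Longrightarrow> z \<in> mball m \<epsilon> \<Longrightarrow> hyp_dist (f y) (f z) = d y z"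
    by (fact chart_ball[OF m])
  define e0 where "e0 = \<epsilon> * k"
  have e0: "e0 > 0" using eps k by (simp add: e0_def)
  define W where "W = ball c r \<inter> ball q e0"
  have pW: "p x \<in> mball m \<epsilon>" if "x \<in> W" for x
  proof -
    have "dist q x / k < \<epsilon>" using that k(1) by (simp add: W_def e0_def pos_divide_less_eq)
    then show ?thesis using mp[of x] that loc_isom_in[OF p, of x] m by (auto simp: W_def)
  qed
  have brH: "ball c r \<subseteq> H3" by (rule loc_isom_subset_H3[OF p])
  have Wne: "W \<noteq> {}"
  proof -
    have "q \<in> closure (ball c r)" using q r by simp
    then obtain y where "y \<in> ball c r" "dist y q < e0" using e0 unfolding closure_approachable by blast
    then have "y \<in> W" by (simp add: W_def dist_commute)
    then show ?thesis by blast
  qed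
  have Wc: "connected W" unfolding W_def by (intro convex_connected convex_Int convex_ball)
  have pl: "loc_isom M d W p" by (rule loc_isom_subset[OF p]) (auto simp: W_def)
  have "\<exists>A. lorentz A \<and> (\<forall>x\<in>W. (f \<circ> p) x = act A x)"
  proof (rule locally_distance_preserving_imp_act[OF Wc Wne, of "f \<circ> p"])
    show "W \<subseteq> H3" using brH by (auto simp: W_def)
    fix x assume x: "x \<in> W"
    obtain e where e: "e > 0" "e \<le> 1" "ball x e \<subseteq> W" "\<And>y. y \<in> ball x e \<Longrightarrow> p y \<in> M"
      "\<And>y z. y \<in> ball x e \<Longrightarrow> z \<in> ball x e \<Longrightarrow> d (p y) (p z) = hyp_dist y z"
      by (fact loc_isomE[OF pl x zero_less_one])
    have 1: "p y \<in> mball m \<epsilon>" if "y \<in> ball x e" for y using pW e(3) that by blast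
    show "\<exists>e>0. ball x e \<subseteq> W \<and> (f \<circ> p) ` ball x e \<subseteq> H3 \<and>
        (\<forall>y\<in>ball x e. \<forall>z\<in>ball x e. hyp_dist ((f \<circ> p) y) ((f \<circ> p) z) = hyp_dist y z)"
    proof (intro exI[of _ e] conjI ballI)
      show "(f \<circ> p) ` ball x e \<subseteq> H3"
        using f[OF 1] hball_subset_H3 by (force simp del: mem_ball)
      show "hyp_dist ((f \<circ> p) y) ((f \<circ> p) z) = hyp_dist y z" if "y \<in> ball x e" "z \<in> ball x e" for y z
        using iso[OF 1[OF that(1)] 1[OF that(2)]] e(5)[OF that] by simp
    qed (use e in auto)
  qed blast
  then obtain A where A: "lorentz A" "\<And>x. x \<in> W \<Longrightarrow> f (p x) = act A x" by auto
  have m0: "m \<in> mball m \<epsilon>" using m eps by simp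
  have Aq: "act A q \<in> H3" by (rule act_in_H3[OF A(1) q(2)])
  \<comment> \<open>The inverse chart can be applied near \<open>q\<close> only if
    \<open>act A q\<close> lies in the chart ball. Points \<open>x\<close> of the ball tending to
    \<open>q\<close> have \<open>act A x\<close> tending both to \<open>f m\<close> and to
    \<open>act A q\<close>, so these cannot differ.\<close>
  have "act A q \<in> hball (f m) \<epsilon>"
  proof (rule ccontr)
    assume "act A q \<notin> hball (f m) \<epsilon>"
    then have ne: "f m \<noteq> act A q" using centre_in_hball[OF eps(2,1)] by auto
    then obtain \<eta> where \<eta>: "\<eta> > 0" "\<And>x. x \<in> H3 \<Longrightarrow> hyp_dist x (f m) < \<eta> \<Longrightarrow> dist x (f m) < dist (act A q) (f m) / 2"
      using hyp_dist_small[OF eps(2), of "dist (act A q) (f m) / 2"] by (metis dist_commute half_gt_zero zero_less_dist_iff)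
    have "continuous_on H3 (act A)" by (rule continuous_on_act[OF A(1)])
    then obtain \<delta> where \<delta>: "\<delta> > 0" "\<And>x. x \<in> H3 \<Longrightarrow> dist x q < \<delta> \<Longrightarrow> dist (act A x) (act A q) < dist (act A q) (f m) / 2"
      using q(2) ne unfolding continuous_on_iff by (metis dist_commute half_gt_zero zero_less_dist_iff)
    define s where "s = min e0 (min \<delta> (\<eta> * k))"
    have s: "s > 0" using e0 \<delta>(1) \<eta>(1) k(1) by (simp add: s_def)
    have "q \<in> closure (ball c r)" using q r by simp
    then obtain x where x: "x \<in> ball c r" "dist x q < s"
      using s unfolding closure_approachable by blast
    have xW: "x \<in> W" using x by (simp add: W_def s_def dist_commute)
    have "hyp_dist (f m) (f (p x)) = d m (p x)" by (rule iso[OF m0 pW[OF xW]])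
    also have "\<dots> \<le> dist q x / k" by (rule mp[OF x(1)])
    also have "\<dots> < \<eta>" using x(2) k(1) by (simp add: pos_divide_less_eq s_def dist_commute)
    finally have "hyp_dist (act A x) (f m) < \<eta>" by (simp add: A(2)[OF xW] hyp_dist_commute)
    moreover have "x \<in> H3" using x(1) brH by blast
    ultimately have "dist (act A x) (f m) < dist (act A q) (f m) / 2"
      using \<eta>(2) act_in_H3[OF A(1)] by blast
    moreover have "dist (act A x) (act A q) < dist (act A q) (f m) / 2"
      using \<delta>(2)[OF \<open>x \<in> H3\<close>] x(2) by (simp add: s_def)
    moreover have "dist (act A q) (f m) \<le> dist (act A x) (act A q) + dist (act A x) (f m)"
      by (rule dist_triangle3)
    ultimately show False by linarith
  qed
  moreover have "open (H3 \<inter> act A -` hball (f m) \<epsilon>)"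
    by (intro continuous_open_preimage continuous_on_act A open_H3 open_hball eps)
  ultimately obtain e1 where e1: "e1 > 0" "ball q e1 \<subseteq> H3 \<inter> act A -` hball (f m) \<epsilon>"
    using q(2) by (meson IntI open_contains_ball vimageI)
  define e where "e = min e0 e1"
  have e: "e > 0" "ball q e \<subseteq> H3" "\<And>x. x \<in> ball q e \<Longrightarrow> act A x \<in> hball (f m) \<epsilon>" "ball q e \<subseteq> ball q e0"
    using e0 e1 by (auto simp: e_def)
  have "loc_isom M d (ball q e) (g \<circ> act A)"
  proof (rule isometric_imp_loc_isom)
    show "(g \<circ> act A) x \<in> M" if "x \<in> ball q e" for x
      using g[OF e(3)[OF that]] by simp
    show "d ((g \<circ> act A) x) ((g \<circ> act A) y) = hyp_dist x y" if "x \<in> ball q e" "y \<in> ball q e" for x y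
      using iso[of "g (act A x)" "g (act A y)"] g[OF e(3)[OF that(1)]] g[OF e(3)[OF that(2)]]
        hyp_dist_act[OF A(1) subsetD[OF e(2) that(1)] subsetD[OF e(2) that(2)]] by (simp del: in_mball)
  qed (use e in auto)
  moreover have "(g \<circ> act A) x = p x" if "x \<in> ball c r \<inter> ball q e" for x
  proof -
    have "x \<in> W" using that e(4) by (auto simp: W_def)
    then show ?thesis using A(2)[of x] f[OF pW, of x] by simp
  qed
  ultimately show ?thesis using e by blast
qed

text \<open>Compactness of the closed ball provides one radius \<open>\<delta>\<close> for all local
  extensions. They are glued by letting each outer point use the extension around its nearest point
  in the closed ball.\<close>

lemma extend_ball:
  assumes p: "loc_isom M d (ball c r) p" and r: "r > 0" and H: "cball c r \<subseteq> H3"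
  obtains \<delta> P where "\<delta> > 0" "loc_isom M d (ball c (r + \<delta>)) P" "\<And>x. x \<in> ball c r \<Longrightarrow> P x = p x"
proof -
  obtain k where k: "k > 0" "\<And>x. x \<in> ball c r \<Longrightarrow> x$3 \<ge> k"
  proof -
    have "continuous_on (cball c r) (\<lambda>x. x$3)" by (intro continuous_intros)
    then obtain z where z: "z \<in> cball c r" "\<And>x. x \<in> cball c r \<Longrightarrow> z$3 \<le> x$3"
      using continuous_attains_inf[of "cball c r" "\<lambda>x. x$3"] r by (metis cball_eq_empty compact_cball not_less_iff_gr_or_eq)
    then have "z$3 > 0" using H by (auto simp: H3_iff)
    then show ?thesis using that[of "z$3"] z(2) by auto
  qed
  define G where "G = {ball q e | q e. q \<in> cball c r \<and> e > 0 \<and> ball q e \<subseteq> H3 \<and>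
     (\<exists>\<psi>. loc_isom M d (ball q e) \<psi> \<and> (\<forall>x\<in>ball c r \<inter> ball q e. \<psi> x = p x))}"
  have "\<exists>\<delta>>0. \<forall>x\<in>cball c r. \<exists>U\<in>G. ball x \<delta> \<subseteq> U"
  proof (rule Heine_Borel_lemma[OF compact_cball, of c r G])
    show "cball c r \<subseteq> \<Union> G"
    proof
      fix q assume q: "q \<in> cball c r"
      then have "q \<in> H3" using H by blast
      with extend_locally[OF p r k q] obtain e where "e > 0" "ball q e \<in> G"
        using q unfolding G_def by blast
      then show "q \<in> \<Union> G" using centre_in_ball by blast
    qed
  qed (auto simp: G_def)
  then obtain \<delta> where \<delta>: "\<delta> > 0" and G: "\<And>x. x \<in> cball c r \<Longrightarrow> \<exists>U\<in>G. ball x \<delta> \<subseteq> U" by blast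
  have "\<exists>\<psi>. ball q \<delta> \<subseteq> H3 \<and> loc_isom M d (ball q \<delta>) \<psi> \<and> (\<forall>x\<in>ball c r \<inter> ball q \<delta>. \<psi> x = p x)"
    if q: "q \<in> cball c r" for q
  proof -
    obtain U where U: "U \<in> G" "ball q \<delta> \<subseteq> U" using G[OF q] by blast
    then obtain \<psi> where "U \<subseteq> H3" "loc_isom M d U \<psi>" "\<forall>x\<in>ball c r \<inter> U. \<psi> x = p x"
      unfolding G_def by blast
    then show ?thesis
      using U(2) loc_isom_subset[OF _ open_ball U(2), where p = \<psi>] by (intro exI[of _ \<psi>]) blast
  qed
  then obtain \<psi> where \<psi>: "\<And>q. q \<in> cball c r \<Longrightarrow> ball q \<delta> \<subseteq> H3"
    "\<And>q. q \<in> cball c r \<Longrightarrow> loc_isom M d (ball q \<delta>) (\<psi> q)"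
    "\<And>q x. q \<in> cball c r \<Longrightarrow> x \<in> ball c r \<inter> ball q \<delta> \<Longrightarrow> \<psi> q x = p x"
    by metis
  define \<pi> where "\<pi> = closest_point (cball c r)"
  define P where "P y = \<psi> (\<pi> y) y" for y
  have cne: "cball c r \<noteq> {}" using r by auto
  have \<pi>in: "\<pi> y \<in> cball c r" for y unfolding \<pi>_def by (rule closest_point_in_set[OF closed_cball cne])
  have \<pi>lip: "dist (\<pi> x) (\<pi> y) \<le> dist x y" for x y
    unfolding \<pi>_def by (rule closest_point_lipschitz[OF convex_cball closed_cball cne])
  have \<pi>dist: "dist (\<pi> y) y < \<delta>" if y: "y \<in> ball c (r + \<delta>)" for y
  proof (cases "y \<in> cball c r")
    case True
    then have "\<pi> y = y" by (simp add: \<pi>_def closest_point_self)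
    then show ?thesis using \<delta> by simp
  next
    case False
    define D where "D = dist c y"
    have D: "r < D" "D < r + \<delta>" using False y by (auto simp: D_def)
    define q where "q = c + (r / D) *\<^sub>R (y - c)"
    have nD: "norm (y - c) = D" by (simp add: D_def dist_norm norm_minus_commute)
    have "dist c q = r" using D r by (simp add: q_def dist_norm nD)
    have "y - q = (1 - r / D) *\<^sub>R (y - c)" by (simp add: q_def algebra_simps)
    then have "dist y q = \<bar>1 - r / D\<bar> * D" by (simp only: dist_norm norm_scaleR nD)
    moreover have "r / D \<le> 1" "r / D * D = r" using D r by simp_all
    ultimately have "dist y q = D - r" by (simp add: left_diff_distrib)
    with \<open>dist c q = r\<close> have "dist y (\<pi> y) \<le> D - r"
      using closest_point_le[OF closed_cball, of q c r y] by (simp add: \<pi>_def)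
    then show ?thesis using D by (simp add: dist_commute)
  qed
  have "loc_isom M d (ball c (r + \<delta>)) P"
  proof (rule loc_isomI)
    show "ball c (r + \<delta>) \<subseteq> H3"
      using \<pi>dist \<psi>(1)[OF \<pi>in] by (meson mem_ball subset_eq)
    fix y assume y: "y \<in> ball c (r + \<delta>)"
    define q where "q = \<pi> y"
    have q: "q \<in> cball c r" unfolding q_def by (rule \<pi>in)
    define U where "U = ball c (r + \<delta>) \<inter> ball q \<delta> \<inter> ball y \<delta>"
    have U: "open U" "y \<in> U" "U \<subseteq> ball c (r + \<delta>)" "U \<subseteq> ball q \<delta>"
      using y \<pi>dist[OF y] \<delta> by (auto simp: U_def q_def)
    have "P z = \<psi> q z" if z: "z \<in> U" for z
    proof -
      define q' where "q' = \<pi> z"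
      have q': "q' \<in> cball c r" unfolding q'_def by (rule \<pi>in)
      define I where "I = ball q \<delta> \<inter> ball q' \<delta>"
      have zI: "z \<in> I" using z \<pi>dist[of z] by (simp add: U_def I_def q'_def)
      \<comment> \<open>The nearest-point map does not increase distances, so the centre
        \<open>q\<close> lies in both balls. Their convex intersection therefore meets the original
        ball, where both extensions equal \<open>p\<close>.\<close>
      have "dist q' q < \<delta>" using \<pi>lip[of z y] z by (simp add: q_def q'_def U_def dist_commute)
      then have qI: "q \<in> I" using \<delta> by (simp add: I_def)
      have oI: "open I" by (simp add: I_def open_Int)
      have "q \<in> closure (ball c r)" using q r by simp
      then have ne: "ball c r \<inter> I \<noteq> {}"
        using oI qI by (metis Int_commute disjoint_iff open_Int_closure_eq_empty)
      have "\<psi> q' z = \<psi> q z"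
      proof (rule loc_isom_eq[of I "\<psi> q'" "\<psi> q" "ball c r \<inter> I"])
        show "loc_isom M d I (\<psi> q')" by (rule loc_isom_subset[OF \<psi>(2)[OF q'] oI]) (simp add: I_def)
        show "loc_isom M d I (\<psi> q)" by (rule loc_isom_subset[OF \<psi>(2)[OF q] oI]) (simp add: I_def)
        show "connected I" unfolding I_def by (intro convex_connected convex_Int convex_ball)
        show "\<psi> q' x = \<psi> q x" if "x \<in> ball c r \<inter> I" for x
          using \<psi>(3)[OF q, of x] \<psi>(3)[OF q', of x] that by (simp add: I_def)
      qed (use oI ne zI in auto)
      then show ?thesis by (simp add: P_def q'_def)
    qed
    moreover have "loc_isom M d U (\<psi> q)" by (rule loc_isom_subset[OF \<psi>(2)[OF q] U(1,4)])
    ultimately show "\<exists>U p'. open U \<and> y \<in> U \<and> U \<subseteq> ball c (r + \<delta>) \<and> loc_isom M d U p' \<and> (\<forall>x\<in>U. P x = p' x)"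
      using U by blast
  qed
  moreover have "P x = p x" if "x \<in> ball c r" for x
  proof -
    have "\<pi> x = x" using that by (simp add: \<pi>_def closest_point_self)
    then show ?thesis using \<psi>(3)[of x x] that \<delta> by (simp add: P_def)
  qed
  ultimately show ?thesis using that \<delta> by blast
qed

end

section \<open>Exhaustion of the half-space by Euclidean balls\<close>

abbreviation e3 :: "real^3"
  where "e3 \<equiv> axis 3 1"

text \<open>Increasing Euclidean balls with compact closure in the upper half-space.\<close>

definition exhaust :: "real \<Rightarrow> (real^3) set"
  where "exhaust R = ball (R *\<^sub>R e3) (R - 1 / R)"

text \<open>The radius grows at least as fast as the centre moves, which makes the family
  increasing, and at most twice as fast, which makes it continuous in the parameter.\<close>

lemma exhaust_radius:
  fixes R S :: real
  assumes "1 < R" "R \<le> S"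
  shows "S - R \<le> (S - 1 / S) - (R - 1 / R)" "(S - 1 / S) - (R - 1 / R) \<le> 2 * (S - R)"
proof -
  have "1 / R - 1 / S = (S - R) / (R * S)"
  proof -
    have "R \<noteq> 0" "S \<noteq> 0" using assms by auto
    then show ?thesis by (simp add: diff_frac_eq)
  qed
  moreover have "(S - R) / (R * S) \<ge> 0" using assms by simp
  moreover have "(S - R) / (R * S) \<le> (S - R) / 1"
  proof -
    have "1 * 1 \<le> R * S" using assms by (intro mult_mono) auto
    then show ?thesis using assms by (intro divide_left_mono) auto
  qed
  ultimately show "S - R \<le> (S - 1 / S) - (R - 1 / R)" "(S - 1 / S) - (R - 1 / R) \<le> 2 * (S - R)"
    by argo+
qed

lemma dist_exhaust_centres: "dist (R *\<^sub>R e3) (S *\<^sub>R e3) = \<bar>R - S\<bar>"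
  unfolding dist_norm by (simp flip: scaleR_diff_left)

lemma exhaust_mono:
  assumes "1 < R" "R \<le> S"
  shows "exhaust R \<subseteq> exhaust S"
  unfolding exhaust_def ball_subset_ball_iff dist_exhaust_centres
  using exhaust_radius[OF assms] assms by auto

lemma exhaust_cball_H3:
  assumes "1 < R"
  shows "cball (R *\<^sub>R e3) (R - 1 / R) \<subseteq> H3"
proof
  fix x :: "real^3" assume x: "x \<in> cball (R *\<^sub>R e3) (R - 1 / R)"
  have "\<bar>R - x$3\<bar> \<le> dist (R *\<^sub>R e3) x"
    using component_le_norm_cart[of "R *\<^sub>R e3 - x" 3] by (simp add: dist_norm axis_def)
  then have "x$3 \<ge> 1 / R" using x by auto
  moreover have "1 / R > 0" using assms by simp
  ultimately have "x$3 > 0" by linarith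
  then show "x \<in> H3" by (simp add: H3_iff)
qed

lemma exhaust_H3:
  assumes "x \<in> H3"
  obtains R where "R > R0" "R > 1" "x \<in> exhaust R"
proof
  have x3: "x$3 > 0" using assms by (simp add: H3_iff)
  \<comment> \<open>Expanding the squares, membership in \<open>exhaust R\<close> means |x|^2 + 2 <
    2 R x_3 + 1/R^2, so this lower bound on \<open>R\<close> suffices.\<close>
  define R where "R = max (max (R0 + 1) 2) (((norm x)\<^sup>2 + 2) / (2 * x$3))"
  show R: "R > R0" "R > 1" by (auto simp: R_def)
  have "R \<ge> ((norm x)\<^sup>2 + 2) / (2 * x$3)" by (simp add: R_def)
  then have "(norm x)\<^sup>2 + 2 \<le> 2 * R * x$3" using x3 by (simp add: pos_divide_le_eq mult_ac)
  moreover have "(dist (R *\<^sub>R e3) x)\<^sup>2 = (norm x)\<^sup>2 - 2 * R * x$3 + R\<^sup>2"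
    unfolding dist_norm norm_vec3 by (simp add: axis_def power2_eq_square algebra_simps)
  moreover have "(R - 1 / R)\<^sup>2 = R\<^sup>2 - 2 + (1 / R)\<^sup>2"
    using R by (simp add: power2_eq_square field_simps)
  moreover have "(1 / R)\<^sup>2 > 0" using R by simp
  ultimately have "(dist (R *\<^sub>R e3) x)\<^sup>2 < (R - 1 / R)\<^sup>2" by argo
  moreover have "R - 1 / R \<ge> 0"
  proof -
    have "1 / R < 1" using R(2) by simp
    then show ?thesis using R(2) by argo
  qed
  ultimately show "x \<in> exhaust R"
    unfolding exhaust_def by (simp add: power2_less_imp_less)
qed

lemma exhaust_left_open:
  assumes S: "S > 1" and x: "x \<in> exhaust S"
  obtains s where "s < S" "\<And>R. s < R \<Longrightarrow> R \<le> S \<Longrightarrow> 1 < R \<Longrightarrow> x \<in> exhaust R"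
proof -
  define \<eta> where "\<eta> = S - 1 / S - dist (S *\<^sub>R e3) x"
  have \<eta>: "\<eta> > 0" using x by (simp add: \<eta>_def exhaust_def)
  \<comment> \<open>Passing from \<open>S\<close> to \<open>R\<close> moves the centre by
    \<open>S - R\<close> and shrinks the radius by at most twice that, so a third of the slack is
    enough.\<close>
  have "x \<in> exhaust R" if R: "S - \<eta> / 3 < R" "R \<le> S" "1 < R" for R
  proof -
    have "dist (R *\<^sub>R e3) x \<le> dist (R *\<^sub>R e3) (S *\<^sub>R e3) + dist (S *\<^sub>R e3) x"
      by (rule dist_triangle)
    also have "dist (R *\<^sub>R e3) (S *\<^sub>R e3) = S - R"
      unfolding dist_exhaust_centres using R by simp
    finally have "dist (R *\<^sub>R e3) x < R - 1 / R"
      using exhaust_radius(2)[OF R(3,2)] R(1) unfolding \<eta>_def by argo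
    then show ?thesis by (simp add: exhaust_def)
  qed
  then show ?thesis using that[of "S - \<eta> / 3"] \<eta> by auto
qed

lemma loc_isom_Union:
  assumes P: "\<And>R. R \<in> T \<Longrightarrow> loc_isom M d (W R) (P R)"
    and eq: "\<And>R S x. R \<in> T \<Longrightarrow> S \<in> T \<Longrightarrow> x \<in> W R \<Longrightarrow> x \<in> W S \<Longrightarrow> P R x = P S x"
  obtains Q where "loc_isom M d (\<Union>R\<in>T. W R) Q" "\<And>R x. R \<in> T \<Longrightarrow> x \<in> W R \<Longrightarrow> Q x = P R x"
proof -
  define Q where "Q x = P (SOME R. R \<in> T \<and> x \<in> W R) x" for x
  have Q: "Q x = P R x" if "R \<in> T" "x \<in> W R" for R x
  proof -
    have "(SOME R. R \<in> T \<and> x \<in> W R) \<in> T \<and> x \<in> W (SOME R. R \<in> T \<and> x \<in> W R)"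
      by (rule someI[of _ R]) (use that in simp)
    then show ?thesis unfolding Q_def using eq that by blast
  qed
  have "loc_isom M d (\<Union>R\<in>T. W R) Q"
  proof (rule loc_isomI)
    show "(\<Union>R\<in>T. W R) \<subseteq> H3" using loc_isom_subset_H3[OF P] by blast
    fix q assume "q \<in> (\<Union>R\<in>T. W R)"
    then obtain R where R: "R \<in> T" "q \<in> W R" by blast
    then show "\<exists>U p'. open U \<and> q \<in> U \<and> U \<subseteq> (\<Union>R\<in>T. W R) \<and> loc_isom M d U p' \<and> (\<forall>x\<in>U. Q x = p' x)"
      using P[OF R(1)] loc_isom_open[OF P[OF R(1)]] Q[OF R(1)]
      by (intro exI[of _ "W R"] exI[of _ "P R"]) blast
  qed
  then show ?thesis using that Q by blast
qed

context complete_hyperbolic_space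
begin

lemma initial_development:
  assumes "M \<noteq> {}"
  obtains R p where "R > 1" "loc_isom M d (exhaust R) p"
proof -
  obtain m where m: "m \<in> M" using assms by blast
  obtain \<epsilon> f g where eps: "\<epsilon> > 0" "f m \<in> H3"
    and f: "\<And>y. y \<in> mball m \<epsilon> \<Longrightarrow> f y \<in> hball (f m) \<epsilon> \<and> g (f y) = y"
    and g: "\<And>x. x \<in> hball (f m) \<epsilon> \<Longrightarrow> g x \<in> mball m \<epsilon> \<and> f (g x) = x"
    and iso: "\<And>y z. y \<in> mball m \<epsilon> \<Longrightarrow> z \<in> mball m \<epsilon> \<Longrightarrow> hyp_dist (f y) (f z) = d y z"
    by (fact chart_ball[OF m])
  define o' where "o' = f m"
  define t where "t = o'$3"
  \<comment> \<open>A dilation followed by a horizontal translation, hence a hyperbolic isometry; it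
    carries \<open>e3\<close>, to which the exhaustion shrinks as \<open>R\<close> tends to 1, to
    the image of \<open>m\<close>.\<close>
  define \<sigma> where "\<sigma> x = t *\<^sub>R x + vector [o'$1, o'$2, 0]" for x :: "real^3"
  have t: "t > 0" using eps(2) by (simp add: t_def o'_def H3_iff)
  have \<sigma>3: "\<sigma> x $ 3 = t * x$3" for x by (simp add: \<sigma>_def)
  have \<sigma>H: "\<sigma> x \<in> H3" if "x \<in> H3" for x using that t by (simp add: H3_iff \<sigma>3)
  have \<sigma>d: "hyp_dist (\<sigma> x) (\<sigma> y) = hyp_dist x y" for x y
  proof -
    have "dist (\<sigma> x) (\<sigma> y) = t * dist x y"
      using t unfolding \<sigma>_def dist_norm by (simp flip: scaleR_diff_right)
    then have "(dist (\<sigma> x) (\<sigma> y))\<^sup>2 / (2 * \<sigma> x $ 3 * \<sigma> y $ 3) = (dist x y)\<^sup>2 / (2 * x$3 * y$3)"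
      using t unfolding \<sigma>3 by (simp add: power2_eq_square)
    then show ?thesis by (simp add: hyp_dist_def)
  qed
  have \<sigma>e: "\<sigma> (e3) = o'" by (simp add: \<sigma>_def vec_eq_iff forall_3 axis_def t_def)
  have eH: "e3 \<in> H3" by (simp add: H3_iff)
  have B: "g (\<sigma> x) \<in> mball m \<epsilon> \<and> f (g (\<sigma> x)) = \<sigma> x" if "x \<in> hball (e3) \<epsilon>" for x
  proof (rule g)
    show "\<sigma> x \<in> hball (f m) \<epsilon>"
      using that \<sigma>d[of "e3" x] \<sigma>H[of x] unfolding hball_def \<sigma>e o'_def by simp
  qed
  have p: "loc_isom M d (hball (e3) \<epsilon>) (g \<circ> \<sigma>)"
  proof (rule isometric_imp_loc_isom)
    show "(g \<circ> \<sigma>) x \<in> M" if "x \<in> hball (e3) \<epsilon>" for x using B[OF that] by simp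
    show "d ((g \<circ> \<sigma>) x) ((g \<circ> \<sigma>) y) = hyp_dist x y"
      if "x \<in> hball (e3) \<epsilon>" "y \<in> hball (e3) \<epsilon>" for x y
      using iso[of "g (\<sigma> x)" "g (\<sigma> y)"] B[OF that(1)] B[OF that(2)] \<sigma>d[of x y] by (simp del: in_mball)
  qed (use eH eps open_hball hball_subset_H3 in auto)
  obtain e where e: "e > 0" "ball (e3) e \<subseteq> hball (e3) \<epsilon>"
    using open_hball[OF eH eps(1)] centre_in_hball[OF eH eps(1)] by (meson open_contains_ball)
  \<comment> \<open>The centre moves by \<open>R - 1\<close> and the radius is at most twice that,
    so the ball fits into radius \<open>e\<close>.\<close>
  define R where "R = 1 + e / 3"
  have R: "R > 1" using e by (simp add: R_def)
  have "R - 1 / R \<le> 2 * (R - 1)"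
  proof -
    have "R + 1 / R \<ge> 2"
    proof -
      have "(R - 1)\<^sup>2 / R \<ge> 0" using R by simp
      moreover have "(R - 1)\<^sup>2 / R = R + 1 / R - 2" using R by (simp add: power2_eq_square field_simps)
      ultimately show ?thesis by argo
    qed
    then show ?thesis by argo
  qed
  moreover have "dist (R *\<^sub>R e3) (e3) = R - 1"
    using dist_exhaust_centres[of R 1] R by simp
  ultimately have "exhaust R \<subseteq> ball (e3) e"
    unfolding exhaust_def ball_subset_ball_iff by (simp add: R_def)
  then have "loc_isom M d (exhaust R) (g \<circ> \<sigma>)"
    using loc_isom_subset[OF p] e(2) by (simp add: exhaust_def)
  then show ?thesis using that R by blast
qed

text \<open>The parameters reached by extensions of \<open>p0\<close> are unbounded: at a finite
  supremum the extensions glue to the supremal ball, whose closure is still inside the half-space,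
  and can then be pushed further. Agreement with \<open>p0\<close> on the initial ball makes all
  extensions compatible.\<close>

lemma developing_map:
  assumes "M \<noteq> {}"
  obtains p where "loc_isom M d H3 p"
proof -
  obtain R0 p0 where R0: "R0 > 1" and p0: "loc_isom M d (exhaust R0) p0"
    by (fact initial_development[OF assms])
  define T where "T = {R. R \<ge> R0 \<and> (\<exists>P. loc_isom M d (exhaust R) P \<and> (\<forall>x\<in>exhaust R0. P x = p0 x))}"
  have T0: "R0 \<in> T" using p0 by (auto simp: T_def)
  have ne: "exhaust R0 \<noteq> {}"
  proof -
    have "1 / R0 < 1" using R0 by simp
    then have "R0 - 1 / R0 > 0" using R0 by argo
    then show ?thesis by (simp add: exhaust_def)
  qed
  have "\<forall>R\<in>T. \<exists>P. loc_isom M d (exhaust R) P \<and> (\<forall>x\<in>exhaust R0. P x = p0 x)" by (auto simp: T_def)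
  then obtain P where P: "\<And>R. R \<in> T \<Longrightarrow> loc_isom M d (exhaust R) (P R)"
    "\<And>R x. R \<in> T \<Longrightarrow> x \<in> exhaust R0 \<Longrightarrow> P R x = p0 x" by metis
  have TR: "R \<ge> R0" "R > 1" if "R \<in> T" for R using that R0 by (auto simp: T_def)
  have le: "P R x = P S x" if RS: "R \<in> T" "S \<in> T" "R \<le> S" "x \<in> exhaust R" for R S x
  proof (rule loc_isom_eq[of "exhaust R" "P R" "P S" "exhaust R0"])
    show "loc_isom M d (exhaust R) (P S)"
      using loc_isom_subset[OF P(1)[OF RS(2)]] exhaust_mono[OF TR(2)[OF RS(1)] RS(3)]
      by (simp add: exhaust_def)
    show "exhaust R0 \<subseteq> exhaust R" using exhaust_mono[OF R0 TR(1)[OF RS(1)]] .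
  qed (use P RS ne in \<open>auto simp: exhaust_def\<close>)
  have eq: "P R x = P S x" if "R \<in> T" "S \<in> T" "x \<in> exhaust R" "x \<in> exhaust S" for R S x
  proof (cases "R \<le> S")
    case True
    then show ?thesis using le[of R S x] that by blast
  next
    case False
    then show ?thesis using le[of S R x] that by simp
  qed
  have "\<exists>Q. loc_isom M d (\<Union>R\<in>T. exhaust R) Q \<and> (\<forall>R\<in>T. \<forall>x\<in>exhaust R. Q x = P R x)"
    by (rule loc_isom_Union[of T M d exhaust P]) (use P(1) eq in blast)+
  then obtain Q where Q: "loc_isom M d (\<Union>R\<in>T. exhaust R) Q" "\<And>R x. R \<in> T \<Longrightarrow> x \<in> exhaust R \<Longrightarrow> Q x = P R x"
    by blast
  have Q0: "Q x = p0 x" if "x \<in> exhaust R0" for x using Q(2)[OF T0 that] P(2)[OF T0 that] by simp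
  have "\<not> bdd_above T"
  proof
    assume bdd: "bdd_above T"
    define S where "S = Sup T"
    have S: "R \<le> S" if "R \<in> T" for R unfolding S_def using bdd that by (simp add: cSup_upper)
    have S0: "S \<ge> R0" "S > 1" using S[OF T0] R0 by auto
    \<comment> \<open>The family is continuous from the left, so the ball at the supremum is already
      covered, whether or not the supremum is attained.\<close>
    have "exhaust S \<subseteq> (\<Union>R\<in>T. exhaust R)"
    proof
      fix x assume x: "x \<in> exhaust S"
      obtain s where s: "s < S" "\<And>R. s < R \<Longrightarrow> R \<le> S \<Longrightarrow> 1 < R \<Longrightarrow> x \<in> exhaust R"
        using exhaust_left_open[OF S0(2) x] by metis
      obtain R where R: "R \<in> T" "s < R" using s(1) less_cSup_iff[OF _ bdd] T0 unfolding S_def by blast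
      then show "x \<in> (\<Union>R\<in>T. exhaust R)" using s(2)[OF R(2) S[OF R(1)] TR(2)[OF R(1)]] by blast
    qed
    then have QS: "loc_isom M d (ball (S *\<^sub>R e3) (S - 1 / S)) Q"
      using loc_isom_subset[OF Q(1)] by (simp add: exhaust_def)
    have "1 / S < 1" using S0 by simp
    then have "S - 1 / S > 0" using S0 by argo
    then obtain \<delta> P' where \<delta>: "\<delta> > 0" "loc_isom M d (ball (S *\<^sub>R e3) (S - 1 / S + \<delta>)) P'"
      "\<And>x. x \<in> ball (S *\<^sub>R e3) (S - 1 / S) \<Longrightarrow> P' x = Q x"
      using extend_ball[OF QS _ exhaust_cball_H3[OF S0(2)]] by blast
    define S' where "S' = S + \<delta> / 3"
    have S': "S < S'" using \<delta>(1) by (simp add: S'_def)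
    have "exhaust S' \<subseteq> ball (S *\<^sub>R e3) (S - 1 / S + \<delta>)"
      unfolding exhaust_def ball_subset_ball_iff dist_exhaust_centres
      using exhaust_radius(2)[of S S'] S0 S' by (simp add: S'_def)
    then have "loc_isom M d (exhaust S') P'"
      using loc_isom_subset[OF \<delta>(2)] by (simp add: exhaust_def)
    moreover have "P' x = p0 x" if "x \<in> exhaust R0" for x
      using \<delta>(3)[of x] Q0[OF that] exhaust_mono[OF R0 S0(1)] that by (auto simp: exhaust_def)
    ultimately have "S' \<in> T" using S' S0 by (auto simp: T_def)
    then show False using S[of S'] S' by simp
  qed
  have "H3 \<subseteq> (\<Union>R\<in>T. exhaust R)"
  proof
    fix x assume "x \<in> H3"
    then obtain R where R: "R > R0" "R > 1" "x \<in> exhaust R" using exhaust_H3 by blast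
    obtain S where S: "S \<in> T" "R < S" using \<open>\<not> bdd_above T\<close> by (auto simp: bdd_above_def not_le)
    then show "x \<in> (\<Union>R\<in>T. exhaust R)" using exhaust_mono[of R S] R by auto
  qed
  then have "loc_isom M d H3 Q" by (rule loc_isom_subset[OF Q(1) open_H3])
  then show ?thesis using that by blast
qed

end

section \<open>The developing map as a covering\<close>

definition (in hyperbolic_space) chart_at :: "'a \<Rightarrow> real \<Rightarrow> ('a \<Rightarrow> real^3) \<Rightarrow> (real^3 \<Rightarrow> 'a) \<Rightarrow> bool"
  where "chart_at m \<epsilon> f g \<longleftrightarrow> \<epsilon> > 0 \<and> f m \<in> H3 \<and>
    (\<forall>y\<in>mball m \<epsilon>. f y \<in> hball (f m) \<epsilon> \<and> g (f y) = y) \<and>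
    (\<forall>x\<in>hball (f m) \<epsilon>. g x \<in> mball m \<epsilon> \<and> f (g x) = x) \<and>
    (\<forall>y\<in>mball m \<epsilon>. \<forall>z\<in>mball m \<epsilon>. hyp_dist (f y) (f z) = d y z)"

lemma act_image_hball:
  assumes A: "lorentz A" and q: "q \<in> H3" and x: "x \<in> H3"
  shows "act A x \<in> hball (act A q) \<epsilon> \<longleftrightarrow> x \<in> hball q \<epsilon>"
  using hyp_dist_act[OF A q x] act_in_H3[OF A x] x by (simp add: hball_def)

context hyperbolic_space
begin

lemma chart_at_exists:
  assumes "m \<in> M"
  shows "\<exists>\<epsilon> f g. chart_at m \<epsilon> f g"
proof -
  obtain \<epsilon> f g where "\<epsilon> > 0" "f m \<in> H3"
    "\<And>y. y \<in> mball m \<epsilon> \<Longrightarrow> f y \<in> hball (f m) \<epsilon> \<and> g (f y) = y"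
    "\<And>x. x \<in> hball (f m) \<epsilon> \<Longrightarrow> g x \<in> mball m \<epsilon> \<and> f (g x) = x"
    "\<And>y z. y \<in> mball m \<epsilon> \<Longrightarrow> z \<in> mball m \<epsilon> \<Longrightarrow> hyp_dist (f y) (f z) = d y z"
    by (fact chart_ball[OF assms])
  then show ?thesis unfolding chart_at_def by blast
qed

lemma chart_atD:
  assumes "chart_at m \<epsilon> f g"
  shows "\<epsilon> > 0" "f m \<in> H3"
    "\<And>y. y \<in> mball m \<epsilon> \<Longrightarrow> f y \<in> hball (f m) \<epsilon>" "\<And>y. y \<in> mball m \<epsilon> \<Longrightarrow> g (f y) = y"
    "\<And>x. x \<in> hball (f m) \<epsilon> \<Longrightarrow> g x \<in> mball m \<epsilon>" "\<And>x. x \<in> hball (f m) \<epsilon> \<Longrightarrow> f (g x) = x"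
    "\<And>y z. y \<in> mball m \<epsilon> \<Longrightarrow> z \<in> mball m \<epsilon> \<Longrightarrow> hyp_dist (f y) (f z) = d y z"
  using assms unfolding chart_at_def by blast+

text \<open>The evenly covered neighbourhoods come from here: a point over a chart ball belongs to a
  full hyperbolic ball of the same radius on which \<open>p\<close> is the inverse chart after a
  Lorentz map. Near \<open>y\<close> this is rigidity, and unique continuation spreads it over the
  ball.\<close>

lemma sheet_exists:
  assumes p: "loc_isom M d H3 p" and ch: "chart_at m \<epsilon> f g" and m: "m \<in> M"
    and y: "y \<in> H3" "p y \<in> mball m \<epsilon>"
  shows "\<exists>A q. lorentz A \<and> q \<in> H3 \<and> act A q = f m \<and> p q = m \<and> y \<in> hball q \<epsilon> \<and> (\<forall>x\<in>hball q \<epsilon>. p x = g (act A x))"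
proof -
  note ch = chart_atD[OF ch]
  have "d m (p y) < \<epsilon>" using y(2) by simp
  then have eps': "\<epsilon> - d m (p y) > 0" by simp
  obtain e0 where e0: "e0 > 0" "ball y e0 \<subseteq> H3"
      "\<And>x z. x \<in> ball y e0 \<Longrightarrow> z \<in> ball y e0 \<Longrightarrow> hyp_dist x z < \<epsilon> - d m (p y)"
    by (fact small_ball[OF y(1) eps'])
  obtain e where e: "e > 0" "e \<le> e0" "ball y e \<subseteq> H3" "\<And>x. x \<in> ball y e \<Longrightarrow> p x \<in> M"
    "\<And>x z. x \<in> ball y e \<Longrightarrow> z \<in> ball y e \<Longrightarrow> d (p x) (p z) = hyp_dist x z"
    by (fact loc_isomE[OF p y(1) e0(1)])
  have yb: "y \<in> ball y e" using e(1) by simp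
  have sub: "ball y e \<subseteq> ball y e0" using e(2) by auto
  have pb: "p x \<in> mball m \<epsilon>" if "x \<in> ball y e" for x
  proof -
    have "d (p y) (p x) < \<epsilon> - d m (p y)"
      using e(5)[OF yb that] e0(3)[OF subsetD[OF sub yb] subsetD[OF sub that]] by simp
    then have "d m (p x) < \<epsilon>" using triangle[OF m e(4)[OF yb] e(4)[OF that]] by simp
    then show ?thesis using m e(4)[OF that] by simp
  qed
  have be: "open (ball y e)" "ball y e \<subseteq> H3" "ball y e \<noteq> {}" using e by auto
  have h: "(f \<circ> p) ` ball y e \<subseteq> H3"
  proof (rule image_subsetI)
    fix x assume "x \<in> ball y e"
    then show "(f \<circ> p) x \<in> H3" using subsetD[OF hball_subset_H3 ch(3)[OF pb]] by simp
  qed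
  have "\<exists>A. lorentz A \<and> (\<forall>x\<in>ball y e. (f \<circ> p) x = act A x)"
  proof (rule distance_preserving_imp_act[OF be h])
    fix x z assume "x \<in> ball y e" "z \<in> ball y e"
    then show "hyp_dist ((f \<circ> p) x) ((f \<circ> p) z) = hyp_dist x z"
      using ch(7)[OF pb pb] e(5) by simp
  qed blast
  then obtain A where A: "lorentz A" "\<And>x. x \<in> ball y e \<Longrightarrow> f (p x) = act A x" by auto
  \<comment> \<open>The centre of the sheet is the lift of \<open>m\<close> determined by the germ
    of \<open>f \<circ> p\<close> at \<open>y\<close>.\<close>
  define q where "q = act (linv A) (f m)"
  have q: "q \<in> H3" "act A q = f m"
    using A(1) ch(2) by (simp_all add: q_def act_in_H3 lorentz_inv act_act_inv)
  have act_hball: "x \<in> hball q \<epsilon> \<longleftrightarrow> act A x \<in> hball (f m) \<epsilon>" if "x \<in> H3" for x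
    using act_image_hball[OF A(1) q(1) that] q(2) by simp
  have gA: "loc_isom M d (hball q \<epsilon>) (g \<circ> act A)"
  proof (rule isometric_imp_loc_isom)
    have *: "act A x \<in> hball (f m) \<epsilon>" if "x \<in> hball q \<epsilon>" for x
      using act_hball[of x] that hball_subset_H3 by (auto simp: subset_iff)
    show "(g \<circ> act A) x \<in> M" if "x \<in> hball q \<epsilon>" for x using ch(5)[OF *[OF that]] by simp
    show "d ((g \<circ> act A) x) ((g \<circ> act A) z) = hyp_dist x z" if xz: "x \<in> hball q \<epsilon>" "z \<in> hball q \<epsilon>" for x z
    proof -
      have "hyp_dist (f (g (act A x))) (f (g (act A z))) = d (g (act A x)) (g (act A z))"
        by (intro ch(7) ch(5) * xz)
      then show ?thesis
        using ch(6)[OF *[OF xz(1)]] ch(6)[OF *[OF xz(2)]] hyp_dist_act[OF A(1), of x z] xz hball_subset_H3[of q \<epsilon>]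
        by (simp add: subset_iff)
    qed
  qed (use q ch(1) open_hball hball_subset_H3 in auto)
  have Ay: "act A x \<in> hball (f m) \<epsilon>" if "x \<in> ball y e" for x
    using A(2)[OF that] ch(3)[OF pb[OF that]] by simp
  have bsub: "ball y e \<subseteq> hball q \<epsilon>"
  proof
    fix x assume x: "x \<in> ball y e"
    then show "x \<in> hball q \<epsilon>" using act_hball[of x] Ay[OF x] e(3) by blast
  qed
  have pg: "p x = (g \<circ> act A) x" if x: "x \<in> hball q \<epsilon>" for x
  proof (rule loc_isom_eq[OF _ gA _ be(1) bsub be(3) _ x])
    show "loc_isom M d (hball q \<epsilon>) p"
      by (rule loc_isom_subset[OF p]) (use q ch(1) open_hball hball_subset_H3 in auto)
    show "connected (hball q \<epsilon>)" by (rule connected_hball[OF q(1) ch(1)])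
    show "p z = (g \<circ> act A) z" if "z \<in> ball y e" for z
      using ch(4)[OF pb[OF that]] A(2)[OF that] by simp
  qed
  have "m \<in> mball m \<epsilon>" using m ch(1) by simp
  then have "p q = m" using pg[OF centre_in_hball[OF q(1) ch(1)]] q(2) ch(4) by simp
  then show ?thesis using A(1) q bsub yb pg by (intro exI[of _ A] exI[of _ q]) auto
qed

lemma sheet_at:
  assumes p: "loc_isom M d H3 p" and ch: "chart_at (p q) \<epsilon> f g" and q: "q \<in> H3"
  obtains A where "lorentz A" "act A q = f (p q)" "\<And>x. x \<in> hball q \<epsilon> \<Longrightarrow> p x = g (act A x)"
    "\<And>x. x \<in> H3 \<Longrightarrow> act A x \<in> hball (f (p q)) \<epsilon> \<longleftrightarrow> x \<in> hball q \<epsilon>"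
proof -
  note ch' = chart_atD[OF ch]
  have pq: "p q \<in> M" by (rule loc_isom_in[OF p q])
  have m: "p q \<in> mball (p q) \<epsilon>" using pq ch'(1) by simp
  obtain A q' where A: "lorentz A" "q' \<in> H3" "act A q' = f (p q)" "q \<in> hball q' \<epsilon>"
    "\<And>x. x \<in> hball q' \<epsilon> \<Longrightarrow> p x = g (act A x)"
    using sheet_exists[OF p ch pq q m] by blast
  have "act A q \<in> hball (f (p q)) \<epsilon>"
    using act_image_hball[OF A(1,2) q, of \<epsilon>] A(3,4) by simp
  then have "act A q = f (g (act A q))" using ch'(6) by simp
  also have "\<dots> = act A q'" using A(5)[OF A(4)] A(3) by simp
  finally have "act (linv A) (act A q) = act (linv A) (act A q')" by simp
  then have "q = q'" using act_inv_act[OF A(1)] q A(2) by simp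
  then have Aq: "act A q = f (p q)" and pA: "\<And>x. x \<in> hball q \<epsilon> \<Longrightarrow> p x = g (act A x)"
    using A(3,5) by simp_all
  show ?thesis
    by (rule that[OF A(1) Aq pA]) (use act_image_hball[OF A(1) q] in \<open>simp_all add: Aq\<close>)
qed

lemma loc_isom_continuous:
  assumes p: "loc_isom M d W p"
  shows "continuous_map (top_of_set W) mtopology p"
  unfolding continuous_map_to_metric
proof (intro ballI allI impI)
  fix q \<epsilon> assume q: "q \<in> topspace (top_of_set W)" and eps: "\<epsilon> > (0::real)"
  then have qW: "q \<in> W" by simp
  have WH: "W \<subseteq> H3" using loc_isom_subset_H3[OF p] .
  obtain e0 where e0: "e0 > 0" "ball q e0 \<subseteq> H3"
      "\<And>x z. x \<in> ball q e0 \<Longrightarrow> z \<in> ball q e0 \<Longrightarrow> hyp_dist x z < \<epsilon>"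
    by (fact small_ball[OF subsetD[OF WH qW] eps])
  obtain e where e: "e > 0" "e \<le> e0" "ball q e \<subseteq> W" "\<And>x. x \<in> ball q e \<Longrightarrow> p x \<in> M"
    "\<And>x z. x \<in> ball q e \<Longrightarrow> z \<in> ball q e \<Longrightarrow> d (p x) (p z) = hyp_dist x z"
    by (fact loc_isomE[OF p qW e0(1)])
  have qb: "q \<in> ball q e" using e(1) by simp
  have "p x \<in> mball (p q) \<epsilon>" if x: "x \<in> ball q e" for x
    using e(5)[OF qb x] e0(3)[of q x] e(2) x e(4)[OF qb] e(4)[OF x] e0(1) by simp
  moreover have "openin (top_of_set W) (ball q e)"
    using e(3) by (simp add: openin_open_eq loc_isom_open[OF p])
  ultimately show "\<exists>U. openin (top_of_set W) U \<and> q \<in> U \<and> (\<forall>x\<in>U. p x \<in> mball (p q) \<epsilon>)"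
    using qb by blast
qed

text \<open>A sheet covers the entire chart ball, so a chart ball that meets the image lies in it.
  Hence both the image and its complement are open.\<close>

lemma loc_isom_surj:
  assumes p: "loc_isom M d H3 p" and con: "connected_space mtopology"
  shows "p ` H3 = M"
proof -
  have sheet: "mball m \<epsilon> \<subseteq> p ` H3" if m: "m \<in> M" and ch: "chart_at m \<epsilon> f g" and ne: "mball m \<epsilon> \<inter> p ` H3 \<noteq> {}" for m \<epsilon> f g
  proof -
    note ch' = chart_atD[OF ch]
    obtain y where y: "y \<in> H3" "p y \<in> mball m \<epsilon>" using ne by blast
    obtain A q where A: "lorentz A" "q \<in> H3" "act A q = f m" "\<And>x. x \<in> hball q \<epsilon> \<Longrightarrow> p x = g (act A x)"
      using sheet_exists[OF p ch m y] by blast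
    show ?thesis
    proof
      fix z assume z: "z \<in> mball m \<epsilon>"
      define x where "x = act (linv A) (f z)"
      have fz: "f z \<in> hball (f m) \<epsilon>" "f z \<in> H3" using ch'(3)[OF z] hball_subset_H3 by auto
      have x: "x \<in> H3" "act A x = f z"
        using A(1) fz by (simp_all add: x_def act_in_H3 lorentz_inv act_act_inv)
      then have "x \<in> hball q \<epsilon>" using act_image_hball[OF A(1,2) x(1), of \<epsilon>] fz A(3) by simp
      then have "p x = z" using A(4) x(2) ch'(4)[OF z] by simp
      then show "z \<in> p ` H3" using x by blast
    qed
  qed
  have sub: "p ` H3 \<subseteq> M" using loc_isom_in[OF p] by blast
  have 1: "openin mtopology (p ` H3)"
    unfolding openin_mtopology
  proof (intro conjI allI impI sub)
    fix m assume m: "m \<in> p ` H3"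
    then have mM: "m \<in> M" using sub by blast
    obtain \<epsilon> f g where ch: "chart_at m \<epsilon> f g" using chart_at_exists[OF mM] by blast
    then show "\<exists>r>0. mball m r \<subseteq> p ` H3"
      using sheet[OF mM ch] m mM chart_atD(1)[OF ch] by (intro exI[of _ \<epsilon>]) auto
  qed
  have 2: "openin mtopology (M - p ` H3)"
    unfolding openin_mtopology
  proof (intro conjI allI impI)
    fix m assume m: "m \<in> M - p ` H3"
    then have mM: "m \<in> M" by blast
    obtain \<epsilon> f g where ch: "chart_at m \<epsilon> f g" using chart_at_exists[OF mM] by blast
    have e: "\<epsilon> > 0" using chart_atD(1)[OF ch] .
    have "mball m \<epsilon> \<inter> p ` H3 = {}"
    proof (rule ccontr)
      assume "mball m \<epsilon> \<inter> p ` H3 \<noteq> {}"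
      then have "m \<in> p ` H3" using sheet[OF mM ch] mM e by auto
      then show False using m by simp
    qed
    then show "\<exists>r>0. mball m r \<subseteq> M - p ` H3"
      using e mball_subset_mspace by blast
  qed auto
  have "e3 \<in> H3" by (simp add: H3_iff)
  then have "p ` H3 \<noteq> {}" by blast
  then show ?thesis
    using con 1 2 sub unfolding connected_space_clopen_in closedin_def by auto
qed

end

section \<open>Deck transformations and the covering property\<close>

lemma (in hyperbolic_space) deck_exists:
  assumes p: "loc_isom M d H3 p" and y: "y \<in> H3" "y' \<in> H3" "p y = p y'"
  obtains A where "lorentz A" "act A y = y'" "\<And>x. x \<in> H3 \<Longrightarrow> p (act A x) = p x"
proof -
  obtain \<epsilon> f g where ch: "chart_at (p y) \<epsilon> f g" using chart_at_exists[OF loc_isom_in[OF p y(1)]] by blast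
  have ch2: "chart_at (p y') \<epsilon> f g" using ch y(3) by simp
  note ch' = chart_atD[OF ch]
  obtain A1 where A1: "lorentz A1" "act A1 y = f (p y)" "\<And>x. x \<in> hball y \<epsilon> \<Longrightarrow> p x = g (act A1 x)"
    "\<And>x. x \<in> H3 \<Longrightarrow> act A1 x \<in> hball (f (p y)) \<epsilon> \<longleftrightarrow> x \<in> hball y \<epsilon>"
    by (fact sheet_at[OF p ch y(1)])
  obtain A2 where A2: "lorentz A2" "act A2 y' = f (p y')" "\<And>x. x \<in> hball y' \<epsilon> \<Longrightarrow> p x = g (act A2 x)"
    "\<And>x. x \<in> H3 \<Longrightarrow> act A2 x \<in> hball (f (p y')) \<epsilon> \<longleftrightarrow> x \<in> hball y' \<epsilon>"
    by (fact sheet_at[OF p ch2 y(2)])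
  \<comment> \<open>The sheets around \<open>y\<close> and \<open>y'\<close> are identified with one
    and the same chart ball. Comparing the identifications gives the candidate, and unique
    continuation extends the invariance of \<open>p\<close> from one sheet to all of H^3.\<close>
  define A where "A = linv A2 \<circ> A1"
  have A: "lorentz A" unfolding A_def by (intro lorentz_comp lorentz_inv A1 A2)
  have actA: "act A x = act (linv A2) (act A1 x)" if "x \<in> H3" for x
    unfolding A_def by (rule act_comp[OF A1(1) that])
  have A2A: "act A2 (act A x) = act A1 x" if "x \<in> H3" for x
    using actA[OF that] act_act_inv[OF A2(1)] act_in_H3[OF A1(1) that] by simp
  have "act A y = y'" using actA[OF y(1)] A1(2) A2(2) y act_inv_act[OF A2(1) y(2)] by simp
  moreover have "(p \<circ> act A) x = p x" if "x \<in> H3" for x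
  proof (rule loc_isom_eq[OF _ p _ open_hball[OF y(1) ch'(1)] hball_subset_H3 _ _ that])
    show "loc_isom M d H3 (p \<circ> act A)"
      by (rule loc_isom_comp_act[OF p A open_H3]) (use act_in_H3[OF A] in auto)
    show "connected H3" by (rule convex_connected[OF convex_H3])
    show "hball y \<epsilon> \<noteq> {}" using centre_in_hball[OF y(1) ch'(1)] by blast
    fix z assume z: "z \<in> hball y \<epsilon>"
    then have zH: "z \<in> H3" using hball_subset_H3 by blast
    have "act A z \<in> hball y' \<epsilon>"
      using A2(4)[OF act_in_H3[OF A zH]] A2A[OF zH] A1(4)[OF zH] z y(3) by simp
    then show "(p \<circ> act A) z = p z" using A2(3) A2A[OF zH] A1(3)[OF z] by simp
  qed
  ultimately show ?thesis using that A by simp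
qed

text \<open>A deck transformation with a fixed point preserves the sheet around it. Since
  \<open>p\<close> is injective there, it is the identity on an open ball.\<close>

lemma (in hyperbolic_space) deck_free:
  assumes p: "loc_isom M d H3 p" and A: "lorentz A" "\<And>x. x \<in> H3 \<Longrightarrow> p (act A x) = p x"
    and q: "q \<in> H3" "act A q = q"
  shows "A = id"
proof -
  obtain \<epsilon> f g where ch: "chart_at (p q) \<epsilon> f g" using chart_at_exists[OF loc_isom_in[OF p q(1)]] by blast
  note ch' = chart_atD[OF ch]
  obtain A1 where A1: "lorentz A1" "act A1 q = f (p q)" "\<And>x. x \<in> hball q \<epsilon> \<Longrightarrow> p x = g (act A1 x)"
    "\<And>x. x \<in> H3 \<Longrightarrow> act A1 x \<in> hball (f (p q)) \<epsilon> \<longleftrightarrow> x \<in> hball q \<epsilon>"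
    by (fact sheet_at[OF p ch q(1)])
  show ?thesis
  proof (rule lorentz_eqI[OF A(1) lorentz_id open_hball[OF q(1) ch'(1)] hball_subset_H3])
    show "hball q \<epsilon> \<noteq> {}" using centre_in_hball[OF q(1) ch'(1)] by blast
    fix x assume x: "x \<in> hball q \<epsilon>"
    then have xH: "x \<in> H3" using hball_subset_H3 by blast
    have Ax: "act A x \<in> hball q \<epsilon>" using act_image_hball[OF A(1) q(1) xH, of \<epsilon>] x q(2) by simp
    then have AxH: "act A x \<in> H3" using hball_subset_H3 by blast
    have "f (g (act A1 (act A x))) = f (g (act A1 x))" using A1(3)[OF x] A1(3)[OF Ax] A(2)[OF xH] by simp
    then have "act A1 (act A x) = act A1 x"
      using ch'(6) A1(4)[OF xH] A1(4)[OF AxH] x Ax by simp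
    then have "act A x = x" using act_inv_act[OF A1(1) xH] act_inv_act[OF A1(1) AxH] by simp
    then show "act A x = act id x" using act_id[OF xH] by simp
  qed
qed

text \<open>The sheets over a chart ball are the hyperbolic balls of the same radius around the
  preimages of its centre.\<close>

lemma covering_space_developing_map:
  fixes M :: "'a::topological_space set"
  assumes "hyperbolic_space M d" and top: "Metric_space.mtopology M d = top_of_set M"
    and p: "loc_isom M d H3 p" and surj: "p ` H3 = M"
  shows "covering_space H3 p M"
proof -
  interpret hyperbolic_space M d by fact
  show ?thesis
  proof (rule covering_spaceI)
    show "continuous_on H3 p"
      using loc_isom_continuous[OF p] by (simp add: top continuous_map_in_subtopology)
    show "p ` H3 = M" by (rule surj)
    fix m assume m: "m \<in> M"
    obtain \<epsilon> f g where ch: "chart_at m \<epsilon> f g" using chart_at_exists[OF m] by blast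
    note ch' = chart_atD[OF ch]
    define T where "T = mball m \<epsilon>"
    define v where "v = {hball q \<epsilon> | q. q \<in> H3 \<and> p q = m}"
    have sheet: "\<exists>A. lorentz A \<and> act A q = f m \<and> (\<forall>x\<in>hball q \<epsilon>. p x = g (act A x)) \<and>
        (\<forall>x\<in>H3. act A x \<in> hball (f m) \<epsilon> \<longleftrightarrow> x \<in> hball q \<epsilon>)" if q: "q \<in> H3" "p q = m" for q
    proof -
      have ch2: "chart_at (p q) \<epsilon> f g" using ch q(2) by simp
      obtain A where "lorentz A" "act A q = f (p q)" "\<And>x. x \<in> hball q \<epsilon> \<Longrightarrow> p x = g (act A x)"
        "\<And>x. x \<in> H3 \<Longrightarrow> act A x \<in> hball (f (p q)) \<epsilon> \<longleftrightarrow> x \<in> hball q \<epsilon>"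
        by (fact sheet_at[OF p ch2 q(1)])
      then show ?thesis using q(2) by blast
    qed
    have "\<Union>v = H3 \<inter> p -` T"
    proof (intro equalityI subsetI)
      fix x assume "x \<in> \<Union>v"
      then obtain q where q: "q \<in> H3" "p q = m" "x \<in> hball q \<epsilon>" by (auto simp: v_def)
      then have xH: "x \<in> H3" using hball_subset_H3 by blast
      obtain A where "p x = g (act A x)" "act A x \<in> hball (f m) \<epsilon>" using sheet[OF q(1,2)] q(3) xH by blast
      then have "p x \<in> T" using ch'(5) by (simp add: T_def)
      then show "x \<in> H3 \<inter> p -` T" using xH by simp
    next
      fix x assume "x \<in> H3 \<inter> p -` T"
      then have "x \<in> H3" "p x \<in> mball m \<epsilon>" by (simp_all add: T_def)
      then obtain q where "q \<in> H3" "p q = m" "x \<in> hball q \<epsilon>" using sheet_exists[OF p ch m] by metis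
      then show "x \<in> \<Union>v" unfolding v_def by blast
    qed
    moreover have "\<forall>u\<in>v. openin (top_of_set H3) u"
    proof
      fix u assume "u \<in> v"
      then obtain q where "q \<in> H3" "u = hball q \<epsilon>" unfolding v_def by blast
      then show "openin (top_of_set H3) u"
        using open_hball[OF _ ch'(1), of q] hball_subset_H3[of q \<epsilon>] by (simp add: openin_open_eq[OF open_H3])
    qed
    moreover have "pairwise disjnt v"
    proof (rule pairwiseI)
      fix u w assume "u \<in> v" "w \<in> v" and ne: "u \<noteq> w"
      then obtain q r where q: "q \<in> H3" "p q = m" "u = hball q \<epsilon>" and r: "r \<in> H3" "p r = m" "w = hball r \<epsilon>"
        unfolding v_def by blast
      obtain A where A: "lorentz A" "act A q = f m" "\<And>x. x \<in> hball q \<epsilon> \<Longrightarrow> p x = g (act A x)"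
        "\<And>x. x \<in> H3 \<Longrightarrow> act A x \<in> hball (f m) \<epsilon> \<longleftrightarrow> x \<in> hball q \<epsilon>" using sheet[OF q(1,2)] by blast
      obtain B where B: "lorentz B" "act B r = f m" "\<And>x. x \<in> hball r \<epsilon> \<Longrightarrow> p x = g (act B x)"
        "\<And>x. x \<in> H3 \<Longrightarrow> act B x \<in> hball (f m) \<epsilon> \<longleftrightarrow> x \<in> hball r \<epsilon>" using sheet[OF r(1,2)] by blast
      \<comment> \<open>Overlapping sheets carry the same Lorentz map by rigidity, and this map
        takes both centres to \<open>f m\<close>.\<close>
      have "u \<inter> w = {}"
      proof (rule ccontr)
        assume ne': "u \<inter> w \<noteq> {}"
        have "A = B"
        proof (rule lorentz_eqI[OF A(1) B(1) _ _ ne'])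
          show "open (u \<inter> w)" using q r ch'(1) by (simp add: open_Int open_hball)
          show "u \<inter> w \<subseteq> H3" using q hball_subset_H3 by blast
          fix x assume x: "x \<in> u \<inter> w"
          then have xH: "x \<in> H3" using q hball_subset_H3 by blast
          have "f (g (act A x)) = f (g (act B x))" using A(3)[of x] B(3)[of x] x q(3) r(3) by simp
          then show "act A x = act B x" using ch'(6) A(4)[OF xH] B(4)[OF xH] x q(3) r(3) by simp
        qed
        then have "act (linv A) (act A q) = act (linv A) (act A r)" using A(2) B(2) by simp
        then have "q = r" using act_inv_act[OF A(1)] q(1) r(1) by simp
        then show False using ne q(3) r(3) by simp
      qed
      then show "disjnt u w" by (simp add: disjnt_def)
    qed
    moreover have "\<forall>u\<in>v. \<exists>s. homeomorphism u T p s"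
    proof
      fix u assume "u \<in> v"
      then obtain q where q: "q \<in> H3" "p q = m" "u = hball q \<epsilon>" unfolding v_def by blast
      obtain A where A: "lorentz A" "act A q = f m" "\<And>x. x \<in> hball q \<epsilon> \<Longrightarrow> p x = g (act A x)"
        "\<And>x. x \<in> H3 \<Longrightarrow> act A x \<in> hball (f m) \<epsilon> \<longleftrightarrow> x \<in> hball q \<epsilon>" using sheet[OF q(1,2)] by blast
      define s where "s = act (linv A) \<circ> f"
      have sH: "s z \<in> H3" "act A (s z) = f z" if "z \<in> T" for z
        using ch'(3)[of z] that hball_subset_H3[of "f m" \<epsilon>] A(1)
        by (auto simp: T_def s_def subset_iff act_act_inv act_in_H3 lorentz_inv simp del: in_mball)
      have sT: "s z \<in> u" "p (s z) = z" if z: "z \<in> T" for z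
      proof -
        show 1: "s z \<in> u" using A(4)[OF sH(1)[OF z]] sH(2)[OF z] ch'(3)[of z] z q(3) by (simp add: T_def del: in_mball)
        show "p (s z) = z" using A(3)[of "s z"] 1 q(3) sH(2)[OF z] ch'(4)[of z] z by (simp add: T_def del: in_mball)
      qed
      have uH: "u \<subseteq> H3" using q(3) hball_subset_H3 by simp
      have pu: "p x \<in> T" "s (p x) = x" if x: "x \<in> u" for x
      proof -
        have xH: "x \<in> H3" using x uH by blast
        have Ax: "act A x \<in> hball (f m) \<epsilon>" using A(4)[OF xH] x q(3) by simp
        have px: "p x = g (act A x)" using A(3) x q(3) by simp
        then show "p x \<in> T" using ch'(5)[OF Ax] by (simp add: T_def)
        show "s (p x) = x" using px ch'(6)[OF Ax] act_inv_act[OF A(1) xH] by (simp add: s_def)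
      qed
      have "continuous_on T s"
        unfolding continuous_on_topological
      proof (intro ballI allI impI)
        fix z B assume z: "z \<in> T" and B: "open B" "s z \<in> B"
        obtain e where e: "e > 0" "ball (s z) e \<subseteq> B" using B by (meson open_contains_ball)
        obtain \<eta> where \<eta>: "\<eta> > 0" "\<And>x. x \<in> H3 \<Longrightarrow> hyp_dist x (s z) < \<eta> \<Longrightarrow> dist x (s z) < e"
          using hyp_dist_small[OF sH(1)[OF z] e(1)] by blast
        have zM: "z \<in> M" using z by (simp add: T_def)
        have "openin (top_of_set M) (mball z \<eta>)" using openin_mball by (simp add: top)
        then obtain V where V: "open V" "mball z \<eta> = M \<inter> V" unfolding openin_open by blast
        have "z \<in> mball z \<eta>" using zM \<eta> by simp
        then have "z \<in> V" using V by blast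
        moreover have "s w \<in> B" if w: "w \<in> T" "w \<in> V" for w
        proof -
          have "w \<in> mball z \<eta>" using w V(2) by (simp add: T_def)
          then have "d w z < \<eta>" by (simp add: commute)
          moreover have "hyp_dist (s w) (s z) = hyp_dist (act A (s w)) (act A (s z))"
            by (rule hyp_dist_act[OF A(1) sH(1)[OF w(1)] sH(1)[OF z], symmetric])
          moreover have "hyp_dist (f w) (f z) = d w z" by (rule ch'(7)) (use w z in \<open>simp_all only: T_def\<close>)
          ultimately have "hyp_dist (s w) (s z) < \<eta>" by (simp add: sH(2) w z)
          then have "dist (s w) (s z) < e" by (rule \<eta>(2)[OF sH(1)[OF w(1)]])
          then have "s w \<in> ball (s z) e" by (simp add: dist_commute)
          then show ?thesis using e(2) by blast
        qed
        ultimately show "\<exists>V. open V \<and> z \<in> V \<and> (\<forall>w\<in>T. w \<in> V \<longrightarrow> s w \<in> B)" using V(1) by blast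
      qed
      moreover have "continuous_on u p"
        using loc_isom_continuous[OF p] uH continuous_on_subset by (auto simp: top continuous_map_in_subtopology)
      ultimately have "homeomorphism u T p s"
        unfolding homeomorphism_def using sT pu by (auto simp: image_iff) (metis)+
      then show "\<exists>s. homeomorphism u T p s" by blast
    qed
    moreover have "m \<in> T" using m ch'(1) by (simp add: T_def)
    moreover have "openin (top_of_set M) T" unfolding T_def top[symmetric] by (rule openin_mball)
    ultimately show "\<exists>T. m \<in> T \<and> openin (top_of_set M) T \<and> (\<exists>v. \<Union>v = H3 \<inter> p -` T \<and>
          (\<forall>u\<in>v. openin (top_of_set H3) u) \<and> pairwise disjnt v \<and> (\<forall>u\<in>v. \<exists>q. homeomorphism u T p q))"
      by blast
  qed
qed

lemma length_metric_connected:
  assumes "Metric_space M d" "length_metric M d"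
  shows "connected_space (Metric_space.mtopology M d)"
proof -
  interpret Metric_space M d by fact
  have "\<exists>g. pathin mtopology g \<and> g 0 = x \<and> g 1 = y" if "x \<in> M" "y \<in> M" for x y
    using assms(2) that unfolding length_metric_def by (meson zero_less_one)
  then have "path_connected_space mtopology" by (simp add: path_connected_space_def)
  then show ?thesis by (rule path_connected_imp_connected_space)
qed

section \<open>Inverting isometries\<close>

text \<open>Twice the pairing with \<open>lor e3\<close>, which is (1, 1, 0): a time function whose
  sign separates future from past among nonzero causal vectors.\<close>

definition tau :: "lvec \<Rightarrow> real"
  where "tau v = fst v + fst (snd v)"

lemma linear_tau: "linear tau"
  by (rule linearI) (simp_all add: tau_def algebra_simps)

lemma tau_add: "tau (v + w) = tau v + tau w" and tau_scale: "tau (c *\<^sub>R v) = c * tau v"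
  by (simp_all add: tau_def algebra_simps)

lemma causal_components:
  assumes "lf (a, b, w) (a, b, w) \<ge> 0"
  shows "(norm w)\<^sup>2 \<le> a * b" "tau (a, b, w) > 0 \<Longrightarrow> a \<ge> 0 \<and> b \<ge> 0"
proof -
  show 1: "(norm w)\<^sup>2 \<le> a * b"
    using assms by (simp add: lf_def power2_norm_eq_inner)
  assume t: "tau (a, b, w) > 0"
  have "a * b \<ge> 0" using 1 zero_le_power2[of "norm w"] by linarith
  then show "a \<ge> 0 \<and> b \<ge> 0" using t by (auto simp: tau_def zero_le_mult_iff)
qed

text \<open>The form is negative definite on the hyperplane \<open>tau u = 0\<close>.\<close>

lemma causal_zero:
  assumes "lf u u \<ge> 0" "tau u = 0"
  shows "u = 0"
proof -
  obtain a b w where u: "u = (a, b, w)" by (cases u) auto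
  have b: "b = - a" using assms(2) by (simp add: u tau_def)
  have "(norm w)\<^sup>2 \<le> - (a * a)" using causal_components(1)[of a b w] assms(1) by (simp add: u b)
  then have "(norm w)\<^sup>2 + a * a \<le> 0" by linarith
  then have "norm w = 0" "a = 0" by (simp_all add: power2_eq_square sum_squares_le_zero_iff)
  then show ?thesis by (simp add: u b zero_prod_def)
qed

text \<open>The reversed Cauchy-Schwarz inequality: the ordinary one for the complex parts, and the
  inequality of arithmetic and geometric means for the null coordinates.\<close>

lemma causal_nonneg:
  assumes "lf u u \<ge> 0" "tau u > 0" "lf v v \<ge> 0" "tau v > 0"
  shows "lf u v \<ge> 0"
proof -
  obtain a b w where u: "u = (a, b, w)" by (cases u) auto
  obtain a' b' w' where v: "v = (a', b', w')" by (cases v) auto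
  have 1: "(norm w)\<^sup>2 \<le> a * b" "a \<ge> 0" "b \<ge> 0" using causal_components[of a b w] assms by (auto simp: u)
  have 2: "(norm w')\<^sup>2 \<le> a' * b'" "a' \<ge> 0" "b' \<ge> 0" using causal_components[of a' b' w'] assms by (auto simp: v)
  have "(norm w * norm w')\<^sup>2 \<le> (a * b) * (a' * b')"
    unfolding power_mult_distrib using 1 2 by (intro mult_mono) auto
  also have "\<dots> \<le> ((a * b' + b * a') / 2)\<^sup>2"
  proof -
    have "0 \<le> ((a * b' - b * a') / 2)\<^sup>2" by simp
    also have "\<dots> = ((a * b' + b * a') / 2)\<^sup>2 - (a * b) * (a' * b')" by (simp add: power2_eq_square field_simps)
    finally show ?thesis by simp
  qed
  finally have "norm w * norm w' \<le> (a * b' + b * a') / 2"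
    by (rule power2_le_imp_le) (use 1 2 in auto)
  moreover have "w \<bullet> w' \<le> norm w * norm w'" by (rule norm_cauchy_schwarz)
  ultimately show ?thesis by (simp add: u v lf_def)
qed

text \<open>Orthogonality makes every combination null, in particular the one in which the values of
  \<open>tau\<close> cancel.\<close>

lemma null_proportional:
  assumes u: "lf u u = 0" "tau u > 0" and v: "lf v v = 0" "tau v > 0" and "lf u v = 0"
  shows "v = (tau v / tau u) *\<^sub>R u"
proof -
  define \<kappa> where "\<kappa> = tau v / tau u"
  have "lf (v - \<kappa> *\<^sub>R u) (v - \<kappa> *\<^sub>R u) = 0" using assms by (simp add: lf_simps lf_commute[of v u])
  moreover have "tau (v - \<kappa> *\<^sub>R u) = 0"
    using u(2) linear_diff[OF linear_tau] by (simp add: tau_scale \<kappa>_def)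
  ultimately have "v - \<kappa> *\<^sub>R u = 0" by (intro causal_zero) simp_all
  then show ?thesis by (simp add: \<kappa>_def)
qed

lemma tau_hyperboloid: "v \<in> hyperboloid \<Longrightarrow> tau v > 0"
proof -
  assume v: "v \<in> hyperboloid"
  obtain a b w where vv: "v = (a, b, w)" by (cases v) auto
  have "b > 0" "a * b - w \<bullet> w = 1" using v by (auto simp: vv hyperboloid_def lf_def)
  moreover have "w \<bullet> w \<ge> 0" by simp
  ultimately have "b > 0" "a * b > 0" by linarith+
  then show ?thesis by (simp add: vv tau_def zero_less_mult_iff add_pos_pos)
qed

lemma timelike_scale:
  assumes "lf P P > 0" "tau P > 0"
  shows "(1 / sqrt (lf P P)) *\<^sub>R P \<in> hyperboloid"
proof -
  obtain a b w where P: "P = (a, b, w)" by (cases P) auto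
  have "(norm w)\<^sup>2 < a * b" using assms(1) by (simp add: P lf_def power2_norm_eq_inner)
  moreover have "(norm w)\<^sup>2 \<ge> 0" by simp
  ultimately have "b \<noteq> 0" by auto
  moreover have "b \<ge> 0" using causal_components[of a b w] assms by (simp add: P)
  ultimately have "fst (snd P) > 0" by (simp add: P)
  then show ?thesis using assms(1) by (simp add: hyperboloid_def lf_simps)
qed

text \<open>Normalising the vector puts it on the hyperboloid. This converts linear algebra into
  fixed points, and so into contradictions with freeness.\<close>

lemma timelike_fixed:
  assumes "lorentz A" "A P = P" "lf P P > 0" "tau P > 0"
  obtains x where "x \<in> H3" "act A x = x"
proof -
  define v where "v = (1 / sqrt (lf P P)) *\<^sub>R P"
  have v: "v \<in> hyperboloid" unfolding v_def by (rule timelike_scale[OF assms(3,4)])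
  have "A v = v" unfolding v_def linear_scale[OF lorentz_linear[OF assms(1)]] assms(2) ..
  then have "act A (unlor v) = unlor v" using v by (simp add: act_def)
  then show ?thesis using that unlor_in_H3[OF v] by blast
qed

text \<open>If \<open>A u\<close> pointed to the past, then \<open>- A u\<close> would pair
  nonnegatively with \<open>A e\<close>; but that pairing is \<open>- tau u / 2\<close>.\<close>

lemma lorentz_tau:
  assumes A: "lorentz A" and u: "lf u u \<ge> 0" "tau u > 0"
  shows "tau (A u) > 0"
proof -
  define e where "e = lor e3"
  have e: "e \<in> hyperboloid" unfolding e_def by (rule lor_in_hyperboloid) (simp add: H3_iff)
  have Ae: "A e \<in> hyperboloid" by (rule lorentz_hyperboloid[OF A e])
  have ne: "u \<noteq> 0" using u(2) linear_0[OF linear_tau] by auto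
  have uu: "lf (A u) (A u) \<ge> 0" using lorentz_lf[OF A] u(1) by simp
  have Au0: "A u \<noteq> 0"
    using ne bij_is_inj[OF lorentz_bij[OF A]] linear_0[OF lorentz_linear[OF A]] by (metis injD)
  then have "tau (A u) \<noteq> 0" using causal_zero[OF uu] by blast
  moreover have "\<not> tau (A u) < 0"
  proof
    assume neg: "tau (A u) < 0"
    have t: "tau (- A u) > 0" using neg linear_neg[OF linear_tau] by simp
    have "lf (- A u) (- A u) \<ge> 0" using uu bilinear_lneg[OF bilinear_lf] bilinear_rneg[OF bilinear_lf] by simp
    then have "lf (- A u) (A e) \<ge> 0"
      using causal_nonneg[of "- A u" "A e"] t Ae tau_hyperboloid[OF Ae] by (simp add: hyperboloid_def)
    then have "lf u e \<le> 0" using bilinear_lneg[OF bilinear_lf] lorentz_lf[OF A] by simp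
    moreover have "lf u e = tau u / 2"
      by (simp add: lf_def tau_def e_def lor_def norm_vec3 axis_def complex_eq_iff inner_complex_def)
    ultimately show False using u(2) by simp
  qed
  ultimately show ?thesis by linarith
qed

text \<open>Brouwer's theorem on the projectivised future cone.\<close>

lemma causal_eigenvector:
  assumes A: "lorentz A"
  obtains u \<nu> where "\<nu> > 0" "tau u > 0" "lf u u \<ge> 0" "A u = \<nu> *\<^sub>R u"
proof -
  \<comment> \<open>\<open>U\<close> parametrises the slice \<open>tau = 1\<close> of the closed
    future cone by the ball of radius 1/2, because the form on it is 1/4 - |x|^2; \<open>F\<close>
    projects a future vector radially back to this slice.\<close>
  define U where "U x = (1/2 + fst x, 1/2 - fst x, snd x)" for x :: "real \<times> complex"
  define F where "F v = ((fst v - fst (snd v)) / (2 * tau v), (1 / tau v) *\<^sub>R snd (snd v))" for v :: lvec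
  have U: "lf (U x) (U x) \<ge> 0" "tau (U x) = 1" if "x \<in> cball 0 (1/2)" for x
  proof -
    have "(norm x)\<^sup>2 \<le> (1/2)\<^sup>2" using that by (intro power_mono) auto
    then have "(fst x)\<^sup>2 + (norm (snd x))\<^sup>2 \<le> 1/4" by (simp add: norm_prod_def power2_eq_square)
    then show "lf (U x) (U x) \<ge> 0" "tau (U x) = 1"
      by (simp_all add: U_def tau_def lf_def power2_norm_eq_inner[symmetric] algebra_simps power2_eq_square)
  qed
  have F: "F v \<in> cball 0 (1/2)" if v: "lf v v \<ge> 0" "tau v > 0" for v
  proof -
    obtain a b w where vv: "v = (a, b, w)" by (cases v) auto
    have ab: "(norm w)\<^sup>2 \<le> a * b" "a + b > 0" using causal_components(1)[of a b w] v by (auto simp: vv tau_def)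
    have "(norm (F v))\<^sup>2 = ((a - b) / (2 * (a + b)))\<^sup>2 + (norm w / (a + b))\<^sup>2"
      using ab(2) by (simp add: F_def vv tau_def norm_prod_def power_divide)
    also have "\<dots> = ((a - b)\<^sup>2 + 4 * (norm w)\<^sup>2) / (4 * (a + b)\<^sup>2)"
      unfolding power_divide power_mult_distrib add_divide_distrib by simp
    also have "\<dots> \<le> (a + b)\<^sup>2 / (4 * (a + b)\<^sup>2)"
    proof (rule divide_right_mono)
      have "(a - b)\<^sup>2 + 4 * (a * b) = (a + b)\<^sup>2" by (simp add: power2_eq_square algebra_simps)
      then show "(a - b)\<^sup>2 + 4 * (norm w)\<^sup>2 \<le> (a + b)\<^sup>2" using ab(1) by linarith
    qed simp
    also have "\<dots> = (1/2)\<^sup>2" using ab(2) by (simp add: power2_eq_square)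
    finally have "norm (F v) \<le> 1/2" by (rule power2_le_imp_le) simp
    then show ?thesis by simp
  qed
  have AU: "lf (A (U x)) (A (U x)) \<ge> 0" "tau (A (U x)) > 0" if "x \<in> cball 0 (1/2)" for x
    using U[OF that] lorentz_tau[OF A, of "U x"] by (simp_all add: lorentz_lf[OF A])
  have contU: "continuous_on (cball 0 (1/2)) (\<lambda>x. A (U x))"
  proof -
    have "continuous_on (U ` cball 0 (1/2)) A"
      using lorentz_linear[OF A] by (rule linear_continuous_on[OF linear_conv_bounded_linear[THEN iffD1]])
    moreover have "continuous_on (cball 0 (1/2)) U" unfolding U_def by (intro continuous_intros)
    ultimately show ?thesis by (rule continuous_on_compose2) simp
  qed
  have cont: "continuous_on (cball 0 (1/2)) (\<lambda>x. F (A (U x)))"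
    unfolding F_def tau_def
    by (intro continuous_intros contU continuous_on_fst continuous_on_snd) (use AU(2) in \<open>force simp: tau_def\<close>)+
  have "(\<lambda>x. F (A (U x))) \<in> cball 0 (1/2) \<rightarrow> cball 0 (1/2)" using F AU by blast
  then obtain x where x: "x \<in> cball 0 (1/2)" "F (A (U x)) = x"
    using brouwer_ball[OF _ cont] by (metis half_gt_zero zero_less_one)
  define v where "v = A (U x)"
  have tv: "tau v > 0" using AU(2)[OF x(1)] by (simp add: v_def)
  have fx: "F v = x" using x(2) by (simp add: v_def)
  have "v = tau v *\<^sub>R U x"
  proof -
    obtain a b w where vv: "v = (a, b, w)" by (cases v) auto
    have "fst x = (a - b) / (2 * (a + b))" "snd x = (1 / (a + b)) *\<^sub>R w" "a + b > 0"
      using tv fx[symmetric] by (simp_all add: F_def vv tau_def)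
    then show ?thesis by (simp add: vv U_def tau_def field_simps)
  qed
  then have "A (U x) = tau v *\<^sub>R U x" by (simp only: v_def)
  moreover have "tau (U x) > 0" using U(2)[OF x(1)] by simp
  ultimately show ?thesis using that tv U(1)[OF x(1)] by blast
qed

text \<open>A timelike eigenvector with positive eigenvalue has eigenvalue 1 because the form is
  preserved, and would yield a fixed point.\<close>

lemma null_eigenvector:
  assumes A: "lorentz A" and free: "\<And>x. x \<in> H3 \<Longrightarrow> act A x \<noteq> x"
  obtains n \<nu> where "\<nu> > 0" "tau n > 0" "lf n n = 0" "A n = \<nu> *\<^sub>R n"
proof -
  obtain n \<nu> where n: "\<nu> > 0" "tau n > 0" "lf n n \<ge> 0" "A n = \<nu> *\<^sub>R n"
    using causal_eigenvector[OF A] by blast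
  have "lf n n = 0"
  proof (rule ccontr)
    assume "lf n n \<noteq> 0"
    then have pos: "lf n n > 0" using n(3) by simp
    have "lf n n = \<nu> * (\<nu> * lf n n)" using lorentz_lf[OF A, of n n] by (simp add: n(4) lf_simps)
    then have "\<nu> * \<nu> = 1" using pos by simp
    then have "\<nu> = 1" using n(1) by (metis abs_of_pos abs_square_eq_1 power2_eq_square)
    then obtain x where "x \<in> H3" "act A x = x" using timelike_fixed[OF A _ pos n(2)] n(4) by auto
    then show False using free by blast
  qed
  then show ?thesis using that n by blast
qed

text \<open>The involution exchanges \<open>v\<close> and \<open>A v\<close> and fixes their sum,
  which is timelike and represents the midpoint.\<close>

lemma involution_fixed:
  assumes A: "lorentz A" "A \<circ> A = id"
  obtains x where "x \<in> H3" "act A x = x"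
proof -
  define v where "v = lor e3"
  have v: "v \<in> hyperboloid" unfolding v_def by (rule lor_in_hyperboloid) (simp add: H3_iff)
  have Av: "A v \<in> hyperboloid" by (rule lorentz_hyperboloid[OF A(1) v])
  have AA: "A (A v) = v" using A(2) by (metis comp_apply id_apply)
  have "A (v + A v) = v + A v" using linear_add[OF lorentz_linear[OF A(1)]] AA by (simp add: add.commute)
  moreover have "lf (v + A v) (v + A v) > 0"
    using v Av lf_hyperboloid_pos[OF v Av] by (simp add: lf_simps lf_commute[of "A v" v] hyperboloid_def)
  moreover have "tau (v + A v) > 0" using tau_hyperboloid[OF v] tau_hyperboloid[OF Av] by (simp add: tau_add)
  ultimately show ?thesis using timelike_fixed[OF A(1)] that by metis
qed

text \<open>The relation makes \<open>C\<close> carry the \<nu>-eigenspace of \<open>G\<close> to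
  that for 1/\<nu>. For \<nu> = 1 the vector \<open>n + C n\<close> is fixed by \<open>G\<close>,
  and would be timelike unless the two are proportional. For any other \<nu> the lines of
  \<open>n\<close> and \<open>C n\<close> are the ends of an axis, and this case collapses.\<close>

lemma common_null_eigenvector:
  assumes G: "lorentz G" and C: "lorentz C" and rel: "\<And>v. G (C (G v)) = C v"
    and freeG: "\<And>x. x \<in> H3 \<Longrightarrow> act G x \<noteq> x"
    and freeC: "\<And>x. x \<in> H3 \<Longrightarrow> act C x = x \<Longrightarrow> C = id"
  obtains n \<mu> where "\<mu> > 0" "tau n > 0" "lf n n = 0" "G n = n" "C n = \<mu> *\<^sub>R n"
proof -
  note scG = linear_scale[OF lorentz_linear[OF G]] and scC = linear_scale[OF lorentz_linear[OF C]]
  note adG = linear_add[OF lorentz_linear[OF G]] and adC = linear_add[OF lorentz_linear[OF C]]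
  obtain n \<nu> where n: "\<nu> > 0" "tau n > 0" "lf n n = 0" "G n = \<nu> *\<^sub>R n"
    using null_eigenvector[OF G freeG] by blast
  define m where "m = C n"
  have m: "tau m > 0" "lf m m = 0"
    unfolding m_def using lorentz_tau[OF C] n by (simp_all add: lorentz_lf[OF C])
  have Gm: "\<nu> *\<^sub>R G m = m" using rel[of n] by (simp add: n(4) scC scG m_def)
  have nm: "lf n m \<ge> 0" using causal_nonneg[of n m] n m by simp
  show ?thesis
  proof (cases "\<nu> = 1")
    case True
    have "lf n m = 0"
    proof (rule ccontr)
      assume "lf n m \<noteq> 0"
      then have "lf (n + m) (n + m) > 0" using nm n m by (simp add: lf_simps lf_commute[of m n])
      moreover have "G (n + m) = n + m" using n(4) Gm True by (simp add: adG)
      moreover have "tau (n + m) > 0" using n m by (simp add: tau_add)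
      ultimately obtain x where "x \<in> H3" "act G x = x" using timelike_fixed[OF G] by metis
      then show False using freeG by blast
    qed
    then have "m = (tau m / tau n) *\<^sub>R n" using null_proportional[of n m] n m by blast
    then have Cn: "C n = (tau m / tau n) *\<^sub>R n" by (simp only: m_def)
    have "tau m / tau n > 0" using n m by simp
    then show ?thesis by (rule that[OF _ n(2,3) _ Cn]) (simp add: n(4) True)
  next
    case False
    have l2: "\<nu> * \<nu> \<noteq> 1" using False n(1) by (metis abs_of_pos abs_square_eq_1 power2_eq_square)
    \<comment> \<open>Applying \<open>C\<close> twice returns to the eigenvalue \<nu>. Since \<nu>^2
      is not 1, the null vectors \<open>n\<close> and \<open>k\<close> are orthogonal and hence
      proportional.\<close>
    define k where "k = C m"
    have k: "tau k > 0" "lf k k = 0"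
      unfolding k_def using lorentz_tau[OF C] m by (simp_all add: lorentz_lf[OF C])
    have "C m = \<nu> *\<^sub>R C (G m)" by (metis Gm scC)
    then have "G (C m) = \<nu> *\<^sub>R G (C (G m))" by (simp add: scG)
    then have Gk: "G k = \<nu> *\<^sub>R k" by (simp add: rel k_def)
    have "lf n k = \<nu> * (\<nu> * lf n k)" using lorentz_lf[OF G, of n k] by (simp add: n(4) Gk lf_simps)
    then have "lf n k = 0" using l2 by (metis mult.assoc mult_cancel_right1)
    then have kn: "k = (tau k / tau n) *\<^sub>R n" using null_proportional[of n k] n k by blast
    define \<mu> where "\<mu> = tau k / tau n"
    have \<mu>: "\<mu> > 0" "k = \<mu> *\<^sub>R n" using n k kn by (simp_all add: \<mu>_def)
    have "lf n m \<noteq> 0"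
    proof
      assume "lf n m = 0"
      then have mn: "m = (tau m / tau n) *\<^sub>R n" using null_proportional[of n m] n m by blast
      then have "G m = \<nu> *\<^sub>R m" using n(4) scG by (metis scaleR_left_commute)
      then have "m = (\<nu> * \<nu>) *\<^sub>R m" using Gm by simp
      then have "tau m = \<nu> * \<nu> * tau m" by (metis tau_scale)
      then show False using m(1) l2 by simp
    qed
    then have nm: "lf n m > 0" using nm by simp
    \<comment> \<open>\<open>C\<close> sends \<open>n\<close> to \<open>m\<close> and
      \<open>m\<close> to \<open>\<mu> *\<^sub>R n\<close>, so this combination is an eigenvector
      for the square root of \<mu>. It is timelike, which forces \<mu> = 1, so it represents a fixed
      point on the axis.\<close>
    define P where "P = sqrt \<mu> *\<^sub>R n + m"
    have "C P = sqrt \<mu> *\<^sub>R m + \<mu> *\<^sub>R n" by (simp add: P_def adC scC m_def[symmetric] k_def[symmetric] \<mu>(2)) 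
    also have "\<dots> = sqrt \<mu> *\<^sub>R P" using \<mu>(1) by (simp add: P_def algebra_simps)
    finally have CP: "C P = sqrt \<mu> *\<^sub>R P" .
    have PP: "lf P P > 0" using n m nm \<mu>(1) by (simp add: P_def lf_simps lf_commute[of m n])
    have tP: "tau P > 0" using n m \<mu>(1) by (simp add: P_def tau_add tau_scale add_pos_pos)
    have "lf P P = \<mu> * lf P P" using lorentz_lf[OF C, of P P] \<mu>(1) by (simp add: CP lf_simps mult.assoc[symmetric])
    then have "\<mu> = 1" using PP by simp
    then have "C P = P" using CP by simp
    then obtain x where "x \<in> H3" "act C x = x" using timelike_fixed[OF C _ PP tP] by blast
    then have "C = id" by (rule freeC)
    then have "G (G v) = v" for v using rel[of v] by simp
    then have "G \<circ> G = id" by (intro ext) (simp only: comp_apply id_apply)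
    then obtain x where "x \<in> H3" "act G x = x" using involution_fixed[OF G] by blast
    then show ?thesis using freeG by blast
  qed
qed

section \<open>Isometries fixing the point at infinity\<close>

definition null_infinity :: lvec
  where "null_infinity = (1, 0, 0)"

lemma lf_null_infinity: "lf v null_infinity = fst (snd v) / 2"
  by (simp add: lf_def null_infinity_def)

text \<open>A translation moves the null direction over 0, and the inversion swaps 0 and infinity.\<close>

lemma move_to_infinity:
  assumes n: "lf n n = 0" "tau n > 0"
  obtains Q c where "lorentz Q" "c > 0" "Q n = c *\<^sub>R null_infinity"
proof -
  obtain a b w where nn: "n = (a, b, w)" by (cases n) auto
  have ab: "(norm w)\<^sup>2 = a * b" "a + b > 0" using n by (simp_all add: nn lf_def tau_def power2_norm_eq_inner)
  have nonneg: "a \<ge> 0" "b \<ge> 0" using causal_components(2)[of a b w] n by (simp_all add: nn)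
  show ?thesis
  proof (cases "b = 0")
    case True
    then have "n = a *\<^sub>R null_infinity" "a > 0" using ab by (simp_all add: nn null_infinity_def)
    then show ?thesis using that[of id a] lorentz_id by simp
  next
    case False
    then have b: "b > 0" using nonneg by simp
    define z where "z = (1 / b) *\<^sub>R w"
    have z: "b * (norm z)\<^sup>2 = a" "w = b *\<^sub>R z"
      using b ab(1) by (simp_all add: z_def power_divide power2_eq_square field_simps)
    \<comment> \<open>The horizontal translation by \<open>-z\<close>, where \<open>z\<close> is the
      boundary point represented by \<open>n\<close>, followed by the exchange of the two null
      coordinates, which is an inversion.\<close>
    define Q where "Q v = (fst (snd v), fst v - 2 * (snd (snd v) \<bullet> z) + fst (snd v) * (norm z)\<^sup>2,
        snd (snd v) - fst (snd v) *\<^sub>R z)" for v :: lvec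
    have lin: "linear Q"
      by (rule linearI) (simp_all add: Q_def algebra_simps inner_add_left)
    have iso: "lf (Q v) (Q v') = lf v v'" for v v'
    proof -
      obtain a b w where v: "v = (a, b, w)" by (cases v) auto
      obtain a' b' w' where v': "v' = (a', b', w')" by (cases v') auto
      have "(w - b *\<^sub>R z) \<bullet> (w' - b' *\<^sub>R z) = w \<bullet> w' - b' * (w \<bullet> z) - b * (w' \<bullet> z) + b * b' * (z \<bullet> z)"
        by (simp add: inner_diff_left inner_diff_right inner_commute[of z w'] algebra_simps)
      then show ?thesis
        by (simp add: v v' lf_def Q_def power2_norm_eq_inner add_divide_distrib diff_divide_distrib
            right_diff_distrib distrib_left left_diff_distrib distrib_right)
    qed
    define e where "e = lor e3"
    have e: "e \<in> hyperboloid" unfolding e_def by (rule lor_in_hyperboloid) (simp add: H3_iff)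
    have ee: "e = (1, 1, 0)" by (simp add: e_def lor_def norm_vec3 axis_def complex_eq_iff)
    have "Q e \<in> hyperboloid"
      using e iso[of e e] by (simp add: hyperboloid_def) (simp add: ee Q_def add_pos_nonneg)
    then have "lorentz Q" by (rule lorentzI[OF lin iso e])
    moreover have "Q n = b *\<^sub>R null_infinity"
      using z b by (simp add: nn Q_def null_infinity_def power2_norm_eq_inner inner_commute zero_prod_def)
    ultimately show ?thesis using that b by blast
  qed
qed

definition zpart :: "real^3 \<Rightarrow> complex"
  where "zpart x = Complex (x$1) (x$2)"

definition upt_pt :: "complex \<Rightarrow> real \<Rightarrow> real^3"
  where "upt_pt z t = vector [Re z, Im z, t]"

lemma zpart_upt [simp]: "zpart (upt_pt z t) = z" "upt_pt z t $ 3 = t"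
  by (simp_all add: zpart_def upt_pt_def)

lemma upt_zpart [simp]: "upt_pt (zpart x) (x$3) = x"
  by (simp add: zpart_def upt_pt_def vec_eq_iff forall_3)

lemma upt_eq_iff: "upt_pt z t = upt_pt z' t' \<longleftrightarrow> z = z' \<and> t = t'"
  by (metis zpart_upt)

text \<open>The quotient \<kappa> of the images of \<i> and 1 has modulus 1, and comparing the norms
  at 1 + \<i> gives |1 + \<kappa>|^2 = 2. Hence \<kappa> is \<i> or -\<i>.\<close>

lemma complex_orthogonal:
  assumes lin: "linear R" and nrm: "\<And>w :: complex. norm (R w) = norm w"
  obtains \<rho> where "norm \<rho> = 1" "(\<forall>w. R w = \<rho> * w) \<or> (\<forall>w. R w = \<rho> * cnj w)"
proof -
  define \<rho> where "\<rho> = R 1"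
  define \<sigma> where "\<sigma> = R \<i>"
  have 1: "norm \<rho> = 1" "norm \<sigma> = 1" by (simp_all add: \<rho>_def \<sigma>_def nrm)
  have R: "R w = Re w *\<^sub>R \<rho> + Im w *\<^sub>R \<sigma>" for w
  proof -
    have "w = Re w *\<^sub>R 1 + Im w *\<^sub>R \<i>" by (simp add: complex_eq_iff)
    then have "R w = R (Re w *\<^sub>R 1 + Im w *\<^sub>R \<i>)" by simp
    also have "\<dots> = Re w *\<^sub>R \<rho> + Im w *\<^sub>R \<sigma>"
      unfolding linear_add[OF lin] linear_scale[OF lin] \<rho>_def \<sigma>_def ..
    finally show ?thesis .
  qed
  define \<kappa> where "\<kappa> = \<sigma> * cnj \<rho>"
  have \<rho>\<rho>: "\<rho> * cnj \<rho> = 1" using 1(1) by (simp add: complex_norm_square[symmetric])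
  have \<sigma>: "\<sigma> = \<rho> * \<kappa>" using \<rho>\<rho> by (simp add: \<kappa>_def algebra_simps)
  have n\<kappa>: "norm \<kappa> = 1" using 1 by (simp add: \<kappa>_def norm_mult)
  have "norm (\<rho> + \<sigma>) = norm (Complex 1 1)" using nrm[of "Complex 1 1"] R[of "Complex 1 1"] by simp
  moreover have "\<rho> + \<sigma> = \<rho> * (1 + \<kappa>)" by (simp add: \<sigma> algebra_simps)
  ultimately have "norm (1 + \<kappa>) = norm (Complex 1 1)" using 1 by (simp add: norm_mult)
  then have "(norm (1 + \<kappa>))\<^sup>2 = 2" by (simp add: cmod_power2)
  then have "(1 + Re \<kappa>)\<^sup>2 + (Im \<kappa>)\<^sup>2 = 2" by (simp add: cmod_power2)
  moreover have sum1: "(Re \<kappa>)\<^sup>2 + (Im \<kappa>)\<^sup>2 = 1" using n\<kappa> by (simp add: cmod_def)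
  ultimately have "Re \<kappa> = 0" by (simp add: power2_eq_square algebra_simps)
  moreover have "(Im \<kappa>)\<^sup>2 = 1" using sum1 calculation by simp
  ultimately have "\<kappa> = \<i> \<or> \<kappa> = - \<i>" by (auto simp: power2_eq_1_iff complex_eq_iff)
  then show ?thesis
  proof
    assume "\<kappa> = \<i>"
    then have "R w = \<rho> * w" for w unfolding R \<sigma> by (simp add: complex_eq_iff algebra_simps)
    then show ?thesis using that 1 by blast
  next
    assume "\<kappa> = - \<i>"
    then have "R w = \<rho> * cnj w" for w unfolding R \<sigma> by (simp add: complex_eq_iff algebra_simps)
    then show ?thesis using that 1 by blast
  qed
qed

text \<open>The second coordinate is the pairing with the fixed direction up to a factor, so it is
  divided by \<mu>. The last coordinate transforms by an isometry of the complex plane plus a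
  multiple of the second coordinate; dividing by the second coordinate leaves a similarity.\<close>

lemma lorentz_fixing_infinity:
  assumes A: "lorentz A" and inf: "A null_infinity = \<mu> *\<^sub>R null_infinity" and \<mu>: "\<mu> > 0"
  obtains \<rho> s where "norm \<rho> = 1"
    "(\<forall>x\<in>H3. act A x = upt_pt (of_real \<mu> * (\<rho> * zpart x + s)) (\<mu> * x$3)) \<or>
     (\<forall>x\<in>H3. act A x = upt_pt (of_real \<mu> * (\<rho> * cnj (zpart x) + s)) (\<mu> * x$3))"
proof -
  note ad = linear_add[OF lorentz_linear[OF A]] and sc = linear_scale[OF lorentz_linear[OF A]]
  have b: "fst (snd (A v)) = fst (snd v) / \<mu>" for v
  proof -
    have "\<mu> * (fst (snd (A v)) / 2) = fst (snd v) / 2"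
      using lorentz_lf[OF A, of v null_infinity] by (simp add: inf lf_simps lf_null_infinity)
    then show ?thesis using \<mu> by (simp add: field_simps)
  qed
  define R where "R w = snd (snd (A (0, 0, w)))" for w
  define s where "s = snd (snd (A (0, 1, 0)))"
  have lin: "linear R"
  proof (rule linearI)
    fix w w' :: complex and r :: real
    have "(0 :: real, 0 :: real, w + w') = (0, 0, w) + (0, 0, w')" by simp
    then show "R (w + w') = R w + R w'" unfolding R_def by (metis ad snd_add)
    have "(0, 0, r *\<^sub>R w) = r *\<^sub>R (0 :: real, 0 :: real, w)" by simp
    then show "R (r *\<^sub>R w) = r *\<^sub>R R w" unfolding R_def by (metis sc snd_scaleR)
  qed
  have nrm: "norm (R w) = norm w" for w
  proof -
    have "fst (snd (A (0, 0, w))) = 0" using b[of "(0, 0, w)"] by simp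
    then have "(norm (R w))\<^sup>2 = (norm w)\<^sup>2"
      using lorentz_lf[OF A, of "(0, 0, w)" "(0, 0, w)"] unfolding lf_def R_def power2_norm_eq_inner by simp
    then show ?thesis by (simp add: power2_eq_iff_nonneg)
  qed
  have third: "snd (snd (A (a, c, w))) = R w + c *\<^sub>R s" for a c w
  proof -
    have "(a, c, w) = a *\<^sub>R null_infinity + (c *\<^sub>R (0, 1, 0) + (0, 0, w))" by (simp add: null_infinity_def)
    then have "A (a, c, w) = a *\<^sub>R \<mu> *\<^sub>R null_infinity + (c *\<^sub>R A (0, 1, 0) + A (0, 0, w))"
      by (metis ad sc inf)
    then show ?thesis by (simp add: R_def s_def null_infinity_def)
  qed
  have act: "act A x = upt_pt (of_real \<mu> * (R (zpart x) + s)) (\<mu> * x$3)" if x: "x \<in> H3" for x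
  proof -
    have x3: "x$3 > 0" using x by (simp add: H3_iff)
    have "Complex (x$1 / x$3) (x$2 / x$3) = (1 / x$3) *\<^sub>R zpart x" by (simp add: zpart_def complex_eq_iff)
    then have "snd (snd (A (lor x))) = (1 / x$3) *\<^sub>R (R (zpart x) + s)"
      unfolding lor_def third by (simp add: linear_scale[OF lin] algebra_simps)
    moreover have "fst (snd (A (lor x))) = 1 / (\<mu> * x$3)" by (simp add: b lor_def)
    ultimately show ?thesis
      using x3 \<mu> by (simp add: act_def unlor_def upt_pt_def vec_eq_iff forall_3)
  qed
  obtain \<rho> where "norm \<rho> = 1" "(\<forall>w. R w = \<rho> * w) \<or> (\<forall>w. R w = \<rho> * cnj w)"
    using complex_orthogonal[OF lin nrm] by blast
  then show ?thesis using that[of \<rho> s] act by auto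
qed

lemma similarities_no_inversion:
  assumes G: "\<forall>x\<in>H3. act G x = upt_pt (\<rho> * zpart x + s) (x$3)"
    and C: "\<forall>x\<in>H3. act C x = upt_pt (of_real \<mu> * (\<rho>' * zpart x + s')) (\<mu> * x$3)" and \<mu>: "\<mu> > 0" and \<rho>': "norm \<rho>' = 1"
    and rel: "\<And>x. x \<in> H3 \<Longrightarrow> act G (act C (act G x)) = act C x"
    and freeG: "\<And>x. x \<in> H3 \<Longrightarrow> act G x \<noteq> x"
    and freeC: "\<And>x. x \<in> H3 \<Longrightarrow> act C x \<noteq> x"
  shows False
proof -
  have H: "upt_pt z t \<in> H3 \<longleftrightarrow> t > 0" for z t by (simp add: H3_iff)
  have "\<rho> = 1"
  proof (rule ccontr)
    assume "\<rho> \<noteq> 1"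
    then have "\<rho> * (s / (1 - \<rho>)) + s = s / (1 - \<rho>)" by (simp add: field_simps)
    then have "act G (upt_pt (s / (1 - \<rho>)) 1) = upt_pt (s / (1 - \<rho>)) 1" using G H by simp
    then show False using freeG H by simp
  qed
  have "s \<noteq> 0"
  proof
    assume "s = 0"
    then have "act G (upt_pt 0 1) = upt_pt 0 1" using G H \<open>\<rho> = 1\<close> by simp
    then show False using freeG H by simp
  qed
  define x where "x = upt_pt 0 1"
  have "x \<in> H3" by (simp add: x_def H)
  \<comment> \<open>Comparing both sides over the point (0, 1) shows that \<open>C\<close>
    conjugates translation by \<open>s\<close> to translation by \<open>-s\<close>, so its linear
    part is -1.\<close>
  then have "of_real \<mu> * (\<rho>' * s + s') + s = of_real \<mu> * s'"
    using rel[of x] G C \<mu> by (simp add: x_def H \<open>\<rho> = 1\<close> upt_eq_iff)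
  then have "(of_real \<mu> * \<rho>' + 1) * s = 0" by (simp add: algebra_simps)
  then have "of_real \<mu> * \<rho>' + 1 = 0" using \<open>s \<noteq> 0\<close> by simp
  then have m: "of_real \<mu> * \<rho>' = -1" by (simp only: eq_neg_iff_add_eq_0)
  then have "norm (of_real \<mu> * \<rho>') = 1" by simp
  then have "\<mu> = 1" using \<mu> \<rho>' by (simp add: norm_mult)
  then have "\<rho>' = -1" using m by simp
  have "act C (upt_pt (s' / 2) 1) = upt_pt (s' / 2) 1"
    using C H by (simp add: \<open>\<mu> = 1\<close> \<open>\<rho>' = -1\<close> upt_eq_iff)
  then show False using freeC H by simp
qed

lemma linv_mult: "lorentz Q \<Longrightarrow> linv Q (Q v) = v" "lorentz Q \<Longrightarrow> Q (linv Q v) = v"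
  using linv_comp[of Q] comp_linv[of Q] by (metis comp_apply id_apply)+

text \<open>The geometric core; all topology is confined to \<open>ori\<close>. That hypothesis
  ranges over every \<open>Q\<close> because coordinates with the common null direction at infinity
  are found only inside the proof.\<close>

lemma no_inversion:
  assumes G: "lorentz G" and C: "lorentz C" and rel: "\<And>v. G (C (G v)) = C v" and ne: "G \<noteq> id"
    and freeG: "\<And>x. x \<in> H3 \<Longrightarrow> act G x = x \<Longrightarrow> G = id"
    and freeC: "\<And>x. x \<in> H3 \<Longrightarrow> act C x = x \<Longrightarrow> C = id"
    and ori: "\<And>A Q \<mu> \<rho> s. A \<in> {G, C} \<Longrightarrow> lorentz Q \<Longrightarrow> \<mu> > 0 \<Longrightarrow> norm \<rho> = 1 \<Longrightarrow>
      \<not> (\<forall>x\<in>H3. act (Q \<circ> A \<circ> linv Q) x = upt_pt (of_real \<mu> * (\<rho> * cnj (zpart x) + s)) (\<mu> * x$3))"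
  shows False
proof -
  have fG: "act G x \<noteq> x" if "x \<in> H3" for x using freeG that ne by blast
  have fC: "act C x \<noteq> x" if "x \<in> H3" for x
  proof
    assume "act C x = x"
    \<comment> \<open>Freeness does not exclude a trivial \<open>C\<close>; the relation then makes
      \<open>G\<close> an involution, which has a fixed point.\<close>
    then have "C = id" using freeC that by blast
    then have "G (G v) = v" for v using rel[of v] by simp
    then have "G \<circ> G = id" by (intro ext) (simp only: comp_apply id_apply)
    then obtain y where "y \<in> H3" "act G y = y" using involution_fixed[OF G] by blast
    then show False using fG by blast
  qed
  have "\<exists>n \<mu>. \<mu> > 0 \<and> tau n > 0 \<and> lf n n = 0 \<and> G n = n \<and> C n = \<mu> *\<^sub>R n"
    by (rule common_null_eigenvector[OF G C rel]) (use fG freeC in blast)+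
  then obtain n \<mu> where n: "\<mu> > 0" "tau n > 0" "lf n n = 0" "G n = n" "C n = \<mu> *\<^sub>R n"
    by blast
  obtain Q c where Q: "lorentz Q" "c > 0" "Q n = c *\<^sub>R null_infinity"
    using move_to_infinity[OF n(3,2)] by blast
  define cj where "cj A = Q \<circ> A \<circ> linv Q" for A
  have cjl: "lorentz (cj A)" if "lorentz A" for A
    unfolding cj_def by (intro lorentz_comp lorentz_inv Q that)
  have cja: "act (cj A) (act Q x) = act Q (act A x)" if "lorentz A" "x \<in> H3" for A x
  proof -
    have "cj A (lor (act Q x)) = Q (A (lor x))" by (simp add: cj_def lor_act[OF Q(1) that(2)] linv_mult[OF Q(1)])
    then show ?thesis by (simp add: act_def[of "cj A"] act_def[of Q "act A x"] lor_act[OF that])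
  qed
  have free: "act (cj A) x \<noteq> x" if A: "lorentz A" "\<And>x. x \<in> H3 \<Longrightarrow> act A x \<noteq> x" and x: "x \<in> H3" for A x
  proof
    assume eq: "act (cj A) x = x"
    define y where "y = act (linv Q) x"
    have y: "y \<in> H3" "act Q y = x" using x Q(1) by (simp_all add: y_def act_in_H3 lorentz_inv act_act_inv)
    have "act Q (act A y) = act Q y" using cja[OF A(1) y(1)] eq y(2) by simp
    then have "act A y = y" using act_inv_act[OF Q(1)] y(1) act_in_H3[OF A(1) y(1)] by metis
    then show False using A(2)[OF y(1)] by blast
  qed
  have inf: "cj A null_infinity = \<nu> *\<^sub>R null_infinity" if "lorentz A" "A n = \<nu> *\<^sub>R n" for A \<nu>
  proof -
    have "null_infinity = (1 / c) *\<^sub>R Q n" using Q(2,3) by simp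
    then have "linv Q null_infinity = (1 / c) *\<^sub>R n"
      by (metis linear_scale[OF lorentz_linear[OF lorentz_inv[OF Q(1)]]] linv_mult(1)[OF Q(1)])
    then have "cj A null_infinity = (1 / c) *\<^sub>R \<nu> *\<^sub>R Q n"
      by (simp add: cj_def linear_scale[OF lorentz_linear[OF Q(1)]] linear_scale[OF lorentz_linear[OF that(1)]] that(2))
    then show ?thesis using Q(2,3) by (simp add: scaleR_left_commute)
  qed
  have Gn: "G n = 1 *\<^sub>R n" using n(4) by simp
  obtain \<rho> s where \<rho>: "norm \<rho> = 1" and "(\<forall>x\<in>H3. act (cj G) x = upt_pt (of_real 1 * (\<rho> * zpart x + s)) (1 * x$3)) \<or>
     (\<forall>x\<in>H3. act (cj G) x = upt_pt (of_real 1 * (\<rho> * cnj (zpart x) + s)) (1 * x$3))"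
    using lorentz_fixing_infinity[OF cjl[OF G] inf[OF G Gn] zero_less_one] by metis
  then have 1: "\<forall>x\<in>H3. act (cj G) x = upt_pt (\<rho> * zpart x + s) (x$3)"
    using ori[of G Q 1 \<rho> s] Q(1) by (auto simp: cj_def)
  obtain \<rho>' s' where \<rho>': "norm \<rho>' = 1" and "(\<forall>x\<in>H3. act (cj C) x = upt_pt (of_real \<mu> * (\<rho>' * zpart x + s')) (\<mu> * x$3)) \<or>
     (\<forall>x\<in>H3. act (cj C) x = upt_pt (of_real \<mu> * (\<rho>' * cnj (zpart x) + s')) (\<mu> * x$3))"
    using lorentz_fixing_infinity[OF cjl[OF C] inf[OF C n(5)] n(1)] by metis
  then have 2: "\<forall>x\<in>H3. act (cj C) x = upt_pt (of_real \<mu> * (\<rho>' * zpart x + s')) (\<mu> * x$3)"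
    using ori[of C Q \<mu> \<rho>' s'] Q(1) n(1) by (auto simp: cj_def)
  show False
  proof (rule similarities_no_inversion[OF 1 2 n(1) \<rho>'])
    fix x assume x: "x \<in> H3"
    have "cj G (cj C (cj G (lor x))) = cj C (lor x)" by (simp add: cj_def linv_mult[OF Q(1)] rel)
    then have "act (cj G \<circ> (cj C \<circ> cj G)) x = act (cj C) x" by (simp add: act_def)
    then show "act (cj G) (act (cj C) (act (cj G) x)) = act (cj C) x"
      using x cjl[OF G] cjl[OF C] by (simp add: act_comp lorentz_comp)
  qed (use free G C fG fC in blast)+
qed

section \<open>Orientation\<close>

lemma reflection_nsphere2_degree:
  "\<not> homotopic_with (\<lambda>x. True) (nsphere 2) (nsphere 2) (\<lambda>x i. if i = 0 then - x i else x i) id"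
proof
  assume "homotopic_with (\<lambda>x. True) (nsphere 2) (nsphere 2) (\<lambda>x i. if i = 0 then - x i else x i) id"
  then have "Brouwer_degree2 2 (\<lambda>x i. if i = 0 then - x i else x i) = Brouwer_degree2 2 id"
    by (rule Brouwer_degree2_homotopic)
  then show False by (simp add: Brouwer_degree2_reflection)
qed

definition refl1 :: "real^3 \<Rightarrow> real^3"
  where "refl1 x = vector [- x$1, x$2, x$3]"

text \<open>The degree is available for the sphere of sequences \<open>nsphere 2\<close>; the maps
  \<open>F\<close> and \<open>H\<close> identify it with the unit sphere of \<open>real^3\<close>
  and match the reflections in the first coordinate.\<close>

lemma reflection_not_homotopic_id:
  "\<not> homotopic_with_canon (\<lambda>x. True) (sphere 0 1) (sphere 0 1) refl1 id"
proof
  assume hom: "homotopic_with_canon (\<lambda>x. True) (sphere 0 1) (sphere 0 1) refl1 id"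
  define F where "F x = (vector [x 0, x 1, x 2] :: real^3)" for x :: "nat \<Rightarrow> real"
  define H where "H y i = (if i = 0 then y$1 else if i = 1 then y$2 else if i = 2 then y$3 else 0)"
    for y :: "real^3" and i :: nat
  have ts: "x \<in> topspace (nsphere 2) \<longleftrightarrow> (x 0)\<^sup>2 + (x 1)\<^sup>2 + (x 2)\<^sup>2 = 1 \<and> (\<forall>i>2. x i = 0)" for x
    by (auto simp: nsphere numeral_2_eq_2 atMost_Suc add_ac)
  have sph: "y \<in> sphere 0 1 \<longleftrightarrow> (y$1)\<^sup>2 + (y$2)\<^sup>2 + (y$3)\<^sup>2 = 1" for y :: "real^3"
    unfolding norm_vec3[symmetric] by (simp add: norm_eq_1 power2_norm_eq_inner)
  have FH: "F (H y) = y" for y by (simp add: F_def H_def vec_eq_iff forall_3)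
  have HF: "H (F x) = x" if "x \<in> topspace (nsphere 2)" for x
  proof
    fix i :: nat
    consider "i = 0" | "i = 1" | "i = 2" | "i > 2" by linarith
    then show "H (F x) i = x i" using that unfolding ts by cases (auto simp: F_def H_def)
  qed
  have Fs: "F x \<in> sphere 0 1" if "x \<in> topspace (nsphere 2)" for x
    using that unfolding ts sph by (simp add: F_def)
  have Hs: "H y \<in> topspace (nsphere 2)" if "y \<in> sphere 0 1" for y
    using that unfolding ts sph by (simp add: H_def)
  have contF: "continuous_map (nsphere 2) (top_of_set (sphere 0 1)) F"
  proof -
    have "continuous_map (nsphere 2) euclidean F"
      unfolding F_def
    proof -
      have *: "vector [x 0, x 1, x 2] = x 0 *\<^sub>R axis 1 1 + x 1 *\<^sub>R axis 2 1 + x 2 *\<^sub>R (axis 3 1 :: real^3)" for x :: "nat \<Rightarrow> real"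
        by (simp add: vec_eq_iff forall_3 axis_def)
      have c: "continuous_map (nsphere 2) euclidean (\<lambda>x. x k *\<^sub>R v)" for k and v :: "real^3"
        using continuous_map_compose[OF continuous_map_nsphere_projection[of 2 k], of euclidean "\<lambda>r. r *\<^sub>R v"]
        by (simp add: comp_def continuous_intros)
      show "continuous_map (nsphere 2) euclidean (\<lambda>x. vector [x 0, x 1, x 2] :: real^3)"
        unfolding * by (intro continuous_map_add c)
    qed
    then show ?thesis using Fs by (auto simp: continuous_map_in_subtopology)
  qed
  have contH: "continuous_map (top_of_set (sphere 0 1)) (nsphere 2) H"
  proof -
    have "continuous_map (top_of_set (sphere 0 1)) (powertop_real UNIV) H"
      unfolding continuous_map_componentwise_UNIV
    proof
      fix k :: nat
      show "continuous_map (top_of_set (sphere 0 1)) euclideanreal (\<lambda>y. H y k)"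
        unfolding H_def by (cases "k = 0"; cases "k = 1"; cases "k = 2") (simp_all add: continuous_intros)
    qed
    then show ?thesis using Hs by (auto simp: nsphere continuous_map_in_subtopology)
  qed
  have "homotopic_with (\<lambda>x. True) (nsphere 2) (nsphere 2) (H \<circ> (refl1 \<circ> F)) (H \<circ> (id \<circ> F))"
    using homotopic_with_compose_continuous_map_left[OF homotopic_with_compose_continuous_map_right[OF hom contF] contH]
    by simp
  then have "homotopic_with (\<lambda>x. True) (nsphere 2) (nsphere 2) (\<lambda>x i. if i = 0 then - x i else x i) id"
  proof (rule homotopic_with_eq)
    fix x assume x: "x \<in> topspace (nsphere 2)"
    define r where "r = (\<lambda>i. if i = 0 then - x i else x i)"
    have "r \<in> topspace (nsphere 2)" using x unfolding ts by (simp add: r_def)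
    moreover have "F r = refl1 (F x)" by (simp add: F_def r_def refl1_def)
    ultimately show "(\<lambda>i. if i = 0 then - x i else x i) = (H \<circ> (refl1 \<circ> F)) x"
      using HF[of r] by (simp add: r_def)
    show "id x = (H \<circ> (id \<circ> F)) x" using HF[OF x] by simp
  qed simp
  then show False using reflection_nsphere2_degree by simp
qed

lemma homotopic_canonI:
  fixes h :: "real \<times> 'a::topological_space \<Rightarrow> 'b::topological_space"
  assumes "continuous_on ({0..1} \<times> S) h" "\<And>t x. t \<in> {0..1} \<Longrightarrow> x \<in> S \<Longrightarrow> h (t, x) \<in> T"
    "\<And>x. x \<in> S \<Longrightarrow> h (0, x) = f x" "\<And>x. x \<in> S \<Longrightarrow> h (1, x) = g x"
  shows "homotopic_with_canon (\<lambda>x. True) S T f g"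
proof (rule iffD2[OF homotopic_with])
  have "continuous_map (prod_topology (top_of_set {0..1}) (top_of_set S)) (top_of_set T) h"
    using assms(1,2) by (auto simp: continuous_map_in_subtopology simp flip: subtopology_Times euclidean_product_topology)
  then show "\<exists>h. continuous_map (prod_topology (top_of_set {0..1::real}) (top_of_set S)) (top_of_set T) h \<and>
      (\<forall>x\<in>topspace (top_of_set S). h (0, x) = f x) \<and> (\<forall>x\<in>topspace (top_of_set S). h (1, x) = g x) \<and>
      (\<forall>t\<in>{0..1::real}. True)"
    using assms(3,4) by (intro exI[of _ h]) simp
qed simp

text \<open>The homotopy class of the difference map of a locally injective map near a point plays the role of
  its local degree; the difference map is a homotopy equivalence by invariance of domain.\<close>

definition spread :: "(real^3 \<Rightarrow> real^3) \<Rightarrow> real^3 \<Rightarrow> real \<Rightarrow> real^3 \<Rightarrow> real^3"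
  where "spread q x e u = q (x + e *\<^sub>R u) - q x"

definition good_radius :: "(real^3) set \<Rightarrow> (real^3 \<Rightarrow> real^3) \<Rightarrow> real^3 \<Rightarrow> real \<Rightarrow> bool"
  where "good_radius W q x e \<longleftrightarrow> e > 0 \<and> cball x e \<subseteq> W \<and> inj_on q (cball x e)"

text \<open>The target is punctured space because spreads at good radii are nonzero on the unit
  sphere but need not be of unit length.\<close>

abbreviation hom0 :: "(real^3 \<Rightarrow> real^3) \<Rightarrow> (real^3 \<Rightarrow> real^3) \<Rightarrow> bool"
  where "hom0 \<equiv> homotopic_with_canon (\<lambda>x. True) (sphere 0 1) (- {0})"

text \<open>Centre and radius are interpolated linearly. All intermediate balls stay in the large
  one, where injectivity of \<open>q\<close> keeps the difference away from zero.\<close>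

lemma spread_homotopic:
  assumes q: "continuous_on W q" and g: "good_radius W q x e" and y: "cball y e' \<subseteq> cball x e" and e': "e' > 0"
  shows "hom0 (spread q x e) (spread q y e')"
proof -
  have e: "e > 0" "cball x e \<subseteq> W" "inj_on q (cball x e)" using g by (auto simp: good_radius_def)
  define X where "X s = (1 - s) *\<^sub>R x + s *\<^sub>R y" for s :: real
  define E where "E s = (1 - s) * e + s * e'" for s :: real
  have Ep: "E s > 0" if "s \<in> {0..1}" for s
  proof (cases "s = 0")
    case False
    then show ?thesis using that e(1) e' unfolding E_def by (intro add_nonneg_pos mult_pos_pos mult_nonneg_nonneg) auto
  qed (simp add: E_def e)
  have yx: "dist x y + e' \<le> e" using y e' by (simp add: cball_subset_cball_iff dist_commute)
  have in1: "X s + E s *\<^sub>R u \<in> cball x e" if s: "s \<in> {0..1}" and u: "norm u \<le> 1" for s u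
  proof -
    have "x - (X s + E s *\<^sub>R u) = s *\<^sub>R (x - y) - E s *\<^sub>R u" by (simp add: X_def algebra_simps)
    then have "dist x (X s + E s *\<^sub>R u) \<le> norm (s *\<^sub>R (x - y)) + norm (E s *\<^sub>R u)"
      unfolding dist_norm by (metis norm_triangle_ineq4)
    also have "\<dots> \<le> s * dist x y + E s"
      using Ep[OF s] u s by (auto simp: dist_norm mult_left_le)
    also have "\<dots> = s * (dist x y + e') + (1 - s) * e" by (simp add: E_def algebra_simps)
    also have "\<dots> \<le> s * e + (1 - s) * e" using s yx by (intro add_right_mono mult_left_mono) auto
    finally show ?thesis by (simp add: algebra_simps)
  qed
  have in0: "X s \<in> cball x e" if "s \<in> {0..1}" for s using in1[OF that, of 0] by simp
  have sub: "\<And>z. z \<in> cball x e \<Longrightarrow> z \<in> W" using e by blast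
  have X01: "X 0 = x" "X 1 = y" "E 0 = e" "E 1 = e'" by (simp_all add: X_def E_def)
  define h where "h su = q (X (fst su) + E (fst su) *\<^sub>R snd su) - q (X (fst su))" for su :: "real \<times> (real^3)"
  show ?thesis
  proof (rule homotopic_canonI[of _ h])
    have "continuous_on ({0..1} \<times> sphere 0 1) (\<lambda>su. q (X (fst su) + E (fst su) *\<^sub>R snd su))"
      by (rule continuous_on_compose2[OF q]) (auto simp: X_def E_def intro!: continuous_intros sub in1[unfolded X_def E_def])
    moreover have "continuous_on ({0..1} \<times> sphere 0 1) (\<lambda>su. q (X (fst su)))"
      by (rule continuous_on_compose2[OF q]) (auto simp: X_def intro!: continuous_intros sub in0[unfolded X_def])
    ultimately show "continuous_on ({0..1} \<times> sphere 0 1) h"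
      unfolding h_def by (rule continuous_on_diff)
    fix s :: real and u :: "real^3" assume s: "s \<in> {0..1}" and u: "u \<in> sphere 0 1"
    show "h (s, u) \<in> - {0}"
    proof
      assume "h (s, u) \<in> {0}"
      then have "q (X s + E s *\<^sub>R u) = q (X s)" by (simp add: h_def)
      then have "X s + E s *\<^sub>R u = X s"
        by (rule inj_onD[OF e(3)]) (use in1[OF s, of u] in0[OF s] u in simp_all)
      then have "E s = 0" using u by auto
      then show False using Ep[OF s] by simp
    qed
  qed (simp_all add: h_def spread_def X01)
qed

lemma good_radius_le:
  assumes "good_radius W q x e" "cball y e' \<subseteq> cball x e" "e' > 0"
  shows "good_radius W q y e'"
  using assms unfolding good_radius_def by (meson inj_on_subset subset_trans)

lemma spread_same_point:
  assumes q: "continuous_on W q" and g: "good_radius W q x e" "good_radius W q x e'"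
  shows "hom0 (spread q x e) (spread q x e')"
proof (cases "e' \<le> e")
  case True
  then show ?thesis
    by (intro spread_homotopic[OF q g(1)]) (use g(2) in \<open>auto simp: good_radius_def\<close>)
next
  case False
  then have "hom0 (spread q x e') (spread q x e)"
    by (intro spread_homotopic[OF q g(2)]) (use g(1) in \<open>auto simp: good_radius_def\<close>)
  then show ?thesis by (rule homotopic_with_symD)
qed

lemma spread_locally_constant:
  assumes W: "connected W" and q: "continuous_on W q" and ex: "\<And>x. x \<in> W \<Longrightarrow> \<exists>e. good_radius W q x e"
    and xy: "x \<in> W" "y \<in> W" "good_radius W q x e" "good_radius W q y e'"
  shows "hom0 (spread q x e) (spread q y e')"
proof -
  \<comment> \<open>Quantifying over all good radii gives an equivalence relation with locally
    constant classes; its transitivity uses a good radius at the middle point.\<close>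
  define R where "R x y \<longleftrightarrow> (\<forall>e e'. good_radius W q x e \<and> good_radius W q y e' \<longrightarrow> hom0 (spread q x e) (spread q y e'))" for x y
  have "R x y"
  proof (rule connected_equivalence_relation[OF W xy(1,2)])
    show "R y x" if "R x y" for x y using that unfolding R_def by (meson homotopic_with_symD)
    show "R x z" if "R x y" "R y z" "x \<in> W" "y \<in> W" "z \<in> W" for x y z
      using that ex[of y] unfolding R_def by (meson homotopic_with_trans)
    fix a assume a: "a \<in> W"
    obtain e0 where e0: "good_radius W q a e0" using ex[OF a] by blast
    have "R a x" if x: "x \<in> ball a e0" for x
      unfolding R_def
    proof (intro allI impI, elim conjE)
      fix e e' assume e: "good_radius W q a e" and e': "good_radius W q x e'"
      define \<delta> where "\<delta> = e0 - dist a x"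
      have \<delta>: "\<delta> > 0" "cball x \<delta> \<subseteq> cball a e0"
        using x by (auto simp: \<delta>_def cball_subset_cball_iff dist_commute)
      have g: "good_radius W q x \<delta>" by (rule good_radius_le[OF e0 \<delta>(2,1)])
      have "hom0 (spread q a e) (spread q a e0)" by (rule spread_same_point[OF q e e0])
      moreover have "hom0 (spread q a e0) (spread q x \<delta>)" by (rule spread_homotopic[OF q e0 \<delta>(2,1)])
      moreover have "hom0 (spread q x \<delta>) (spread q x e')" by (rule spread_same_point[OF q g e'])
      ultimately show "hom0 (spread q a e) (spread q x e')" by (meson homotopic_with_trans)
    qed
    moreover have "ball a e0 \<subseteq> W" "e0 > 0" using e0 ball_subset_cball unfolding good_radius_def by blast+
    ultimately show "\<exists>T. openin (top_of_set W) T \<and> a \<in> T \<and> (\<forall>x\<in>T. R a x)"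
      by (intro exI[of _ "ball a e0"]) (auto simp: openin_open intro!: exI[of _ "ball a e0"])
  qed
  then show ?thesis using xy(3,4) unfolding R_def by blast
qed

text \<open>A device for cancelling a spread in a homotopy: by invariance of domain \<open>q\<close>
  is a homeomorphism near \<open>x\<close>, so the direction \<open>u\<close> can be recovered from
  the difference of values.\<close>

lemma spread_left_inverse:
  assumes q: "continuous_on W q" and g: "good_radius W q x e"
  obtains e' \<Psi> where "good_radius W q x e'" "continuous_on (- {0}) \<Psi>" "\<Psi> ` (- {0}) \<subseteq> sphere 0 1"
    "\<And>u. u \<in> sphere 0 1 \<Longrightarrow> \<Psi> (spread q x e' u) = u"
proof -
  have e: "e > 0" "cball x e \<subseteq> W" "inj_on q (cball x e)" using g by (auto simp: good_radius_def)
  have sub: "ball x e \<subseteq> cball x e" by (rule ball_subset_cball)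
  have qb: "continuous_on (ball x e) q" "inj_on q (ball x e)"
    using continuous_on_subset[OF q] inj_on_subset[OF e(3)] e(2) sub by blast+
  obtain h where h: "homeomorphism (ball x e) (q ` ball x e) q h"
    using invariance_of_domain_homeomorphism[OF open_ball qb(1) _ qb(2)] by auto
  have "open (q ` ball x e)" by (rule invariance_of_domain[OF qb(1) open_ball qb(2)])
  moreover have "q x \<in> q ` ball x e" using e by auto
  ultimately obtain r where r: "r > 0" "ball (q x) r \<subseteq> q ` ball x e" by (meson open_contains_ball)
  have xb: "x \<in> ball x e" using e by simp
  obtain \<delta> where \<delta>: "\<delta> > 0" "\<And>y. y \<in> ball x e \<Longrightarrow> dist y x < \<delta> \<Longrightarrow> dist (q y) (q x) < r / 2"
    using qb(1) xb r(1) unfolding continuous_on_iff by (meson half_gt_zero)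
  define e' where "e' = min e \<delta> / 2"
  have e': "e' > 0" "e' < e" "e' < \<delta>" using e(1) \<delta>(1) by (auto simp: e'_def)
  have g': "good_radius W q x e'" by (rule good_radius_le[OF g]) (use e' in auto)
  \<comment> \<open>The local inverse is defined only near \<open>q x\<close>. Truncating vectors to
    length \<open>r / 2\<close> extends the recovery to all of punctured space without changing it
    on the spread itself.\<close>
  define \<kappa> where "\<kappa> v = min 1 (r / 2 / norm v) *\<^sub>R v" for v :: "real^3"
  have \<kappa>: "norm (\<kappa> v) < r" "\<kappa> v \<noteq> 0" if "v \<noteq> 0" for v
  proof -
    have "norm (\<kappa> v) \<le> r / 2 / norm v * norm v"
      using that r(1) unfolding \<kappa>_def norm_scaleR by (intro mult_right_mono) auto
    then show "norm (\<kappa> v) < r" using that r(1) by simp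
    show "\<kappa> v \<noteq> 0" using that r(1) by (auto simp: \<kappa>_def min_def)
  qed
  define \<Phi> where "\<Phi> v = h (q x + \<kappa> v) - x" for v
  have im: "q x + \<kappa> v \<in> q ` ball x e" if "v \<noteq> 0" for v
    using r(2) \<kappa>(1)[OF that] by (auto simp: subset_iff dist_norm)
  have \<Phi>0: "\<Phi> v \<noteq> 0" if "v \<noteq> 0" for v
  proof
    assume "\<Phi> v = 0"
    then have "q (h (q x + \<kappa> v)) = q x" by (simp add: \<Phi>_def)
    then have "\<kappa> v = 0" using homeomorphism_apply2[OF h im[OF that]] by simp
    then show False using \<kappa>(2)[OF that] by simp
  qed
  have "continuous_on (- {0}) \<kappa>" unfolding \<kappa>_def by (intro continuous_intros) auto
  then have "continuous_on (- {0}) (\<lambda>v. q x + \<kappa> v)" by (intro continuous_intros)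
  moreover have "(\<lambda>v. q x + \<kappa> v) ` (- {0}) \<subseteq> q ` ball x e" using im by (intro image_subsetI) simp
  ultimately have "continuous_on (- {0}) (\<lambda>v. h (q x + \<kappa> v))"
    by (rule continuous_on_compose2[OF homeomorphism_cont2[OF h]])
  then have c\<Phi>: "continuous_on (- {0}) \<Phi>" unfolding \<Phi>_def by (intro continuous_intros)
  define \<Psi> where "\<Psi> v = (1 / norm (\<Phi> v)) *\<^sub>R \<Phi> v" for v
  have "continuous_on (- {0}) \<Psi>" unfolding \<Psi>_def by (intro continuous_intros c\<Phi>) (use \<Phi>0 in auto)
  moreover have "\<Psi> ` (- {0}) \<subseteq> sphere 0 1"
  proof (rule image_subsetI)
    fix v :: "real^3" assume "v \<in> - {0}"
    then have "norm (\<Phi> v) \<noteq> 0" using \<Phi>0[of v] by simp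
    then show "\<Psi> v \<in> sphere 0 1" by (simp add: \<Psi>_def)
  qed
  moreover have "\<Psi> (spread q x e' u) = u" if u: "u \<in> sphere 0 1" for u
  proof -
    have xu: "x + e' *\<^sub>R u \<in> ball x e" "dist (x + e' *\<^sub>R u) x < \<delta>" using u e' by (auto simp: dist_norm)
    have n: "norm (spread q x e' u) < r / 2" using \<delta>(2)[OF xu] by (simp add: spread_def dist_norm)
    have "\<kappa> (spread q x e' u) = spread q x e' u"
    proof (cases "spread q x e' u = 0")
      case False
      then have "r / 2 / norm (spread q x e' u) \<ge> 1" using n by simp
      then show ?thesis by (simp add: \<kappa>_def)
    qed (simp add: \<kappa>_def)
    then have "\<Phi> (spread q x e' u) = e' *\<^sub>R u"
      using homeomorphism_apply1[OF h xu(1)] by (simp add: \<Phi>_def spread_def)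
    then show ?thesis using u e'(1) by (simp add: \<Psi>_def)
  qed
  ultimately show ?thesis using that g' by blast
qed

text \<open>Invariance of \<open>q\<close> under \<open>c\<close> says that the spread at
  \<open>c x\<close>, precomposed with \<open>R\<close>, is the spread at \<open>x\<close>. By
  connectedness the two spreads are also homotopic, so precomposition with \<open>R\<close>
  preserves the class, and the left inverse removes the spread.\<close>

lemma deck_similarity_homotopic_id:
  assumes W: "connected W" and q: "continuous_on W q" and ex: "\<And>x. x \<in> W \<Longrightarrow> \<exists>e. good_radius W q x e"
    and ne: "W \<noteq> {}" and cW: "\<And>x. x \<in> W \<Longrightarrow> c x \<in> W" and qc: "\<And>x. x \<in> W \<Longrightarrow> q (c x) = q x"
    and \<mu>: "\<mu> > 0" and c: "\<And>x u. c (x + u) = c x + \<mu> *\<^sub>R R u"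
    and R: "linear R" "surj R" "\<And>u. norm (R u) = norm u"
  shows "homotopic_with_canon (\<lambda>x. True) (sphere 0 1) (sphere 0 1) R id"
proof -
  obtain x e where x: "x \<in> W" and "good_radius W q x e" using ne ex by blast
  then obtain e' \<Psi> where e': "good_radius W q x e'" and \<Psi>: "continuous_on (- {0}) \<Psi>" "\<Psi> ` (- {0}) \<subseteq> sphere 0 1"
    "\<And>u. u \<in> sphere 0 1 \<Longrightarrow> \<Psi> (spread q x e' u) = u"
    using spread_left_inverse[OF q] by blast
  have e: "e' > 0" "cball x e' \<subseteq> W" "inj_on q (cball x e')" using e' by (auto simp: good_radius_def)
  have img: "\<exists>z\<in>cball x e'. y = c z" if "y \<in> cball (c x) (\<mu> * e')" for y
  proof -
    obtain u where u: "(1 / \<mu>) *\<^sub>R (y - c x) = R u" using R(2) by (metis surjD)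
    have "c (x + u) = y" using \<mu> by (simp add: c flip: u)
    moreover have "norm u = norm (y - c x) / \<mu>" using R(3)[of u] \<mu> by (simp flip: u)
    then have "norm u \<le> e'" using that \<mu> by (simp add: dist_norm norm_minus_commute pos_divide_le_eq mult.commute)
    then have "x + u \<in> cball x e'" by (simp add: dist_norm)
    ultimately show ?thesis by blast
  qed
  have g2: "good_radius W q (c x) (\<mu> * e')"
    unfolding good_radius_def
  proof (intro conjI)
    show "\<mu> * e' > 0" using \<mu> e by simp
    show "cball (c x) (\<mu> * e') \<subseteq> W" using img cW e(2) by blast
    show "inj_on q (cball (c x) (\<mu> * e'))"
    proof (rule inj_onI)
      fix y y' assume y: "y \<in> cball (c x) (\<mu> * e')" and y': "y' \<in> cball (c x) (\<mu> * e')" and eq: "q y = q y'"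
      obtain z where z: "z \<in> cball x e'" "y = c z" using img[OF y] by blast
      obtain z' where z': "z' \<in> cball x e'" "y' = c z'" using img[OF y'] by blast
      have "q (c z) = q z" "q (c z') = q z'" by (intro qc; use z z' e(2) in blast)+
      then have "q z = q z'" using eq z z' by simp
      then have "z = z'" by (rule inj_onD[OF e(3) _ z(1) z'(1)])
      then show "y = y'" using z z' by simp
    qed
  qed
  have "hom0 (spread q (c x) (\<mu> * e')) (spread q x e')"
    by (rule spread_locally_constant[OF W q ex cW[OF x] x g2 e'])
  moreover have contR: "continuous_map (top_of_set (sphere 0 1)) (top_of_set (sphere 0 1)) R"
    using linear_continuous_on[OF linear_conv_bounded_linear[THEN iffD1, OF R(1)]] R(3)
    by (auto simp: continuous_map_in_subtopology)
  ultimately have "hom0 (spread q (c x) (\<mu> * e') \<circ> R) (spread q x e' \<circ> R)"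
    by (intro homotopic_with_compose_continuous_map_right) auto
  moreover have "(spread q (c x) (\<mu> * e') \<circ> R) u = spread q x e' u" if u: "u \<in> sphere 0 1" for u
  proof -
    have "x + e' *\<^sub>R u \<in> W" using e u by (auto simp: subset_iff dist_norm)
    then have "q (c (x + e' *\<^sub>R u)) = q (x + e' *\<^sub>R u)" by (rule qc)
    moreover have "c (x + e' *\<^sub>R u) = c x + (\<mu> * e') *\<^sub>R R u" by (simp add: c linear_scale[OF R(1)])
    ultimately show ?thesis using qc[OF x] by (simp add: spread_def)
  qed
  ultimately have "hom0 (spread q x e') (spread q x e' \<circ> R)"
    by (elim homotopic_with_eq) auto
  then have "homotopic_with_canon (\<lambda>x. True) (sphere 0 1) (sphere 0 1) (\<Psi> \<circ> spread q x e') (\<Psi> \<circ> (spread q x e' \<circ> R))"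
    by (rule homotopic_with_compose_continuous_map_left) (use \<Psi> in \<open>auto simp: continuous_map_in_subtopology\<close>)
  then have "homotopic_with_canon (\<lambda>x. True) (sphere 0 1) (sphere 0 1) id R"
  proof (rule homotopic_with_eq)
    fix u :: "real^3" assume "u \<in> topspace (top_of_set (sphere 0 1))"
    then have u: "u \<in> sphere 0 1" "R u \<in> sphere 0 1" using R(3) by auto
    show "id u = (\<Psi> \<circ> spread q x e') u" "R u = (\<Psi> \<circ> (spread q x e' \<circ> R)) u"
      using \<Psi>(3)[OF u(1)] \<Psi>(3)[OF u(2)] by simp_all
  qed simp
  then show ?thesis by (rule homotopic_with_symD)
qed

text \<open>The orthogonal part of an orientation-reversing similarity: a planar reflection times
  the identity on the vertical axis.\<close>

definition reflrot :: "complex \<Rightarrow> real^3 \<Rightarrow> real^3"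
  where "reflrot \<rho> x = upt_pt (\<rho> * cnj (zpart x)) (x$3)"

lemma norm_upt: "norm (upt_pt z t) = sqrt ((norm z)\<^sup>2 + t\<^sup>2)"
proof -
  have "(norm (upt_pt z t))\<^sup>2 = (norm z)\<^sup>2 + t\<^sup>2"
    unfolding norm_vec3 by (simp add: upt_pt_def cmod_power2)
  then show ?thesis by (metis norm_ge_zero real_sqrt_unique)
qed

lemma norm_zpart: "norm x = sqrt ((norm (zpart x))\<^sup>2 + (x$3)\<^sup>2)"
  using norm_upt[of "zpart x" "x$3"] by simp

lemma norm_reflrot: "norm \<rho> = 1 \<Longrightarrow> norm (reflrot \<rho> x) = norm x"
  unfolding reflrot_def norm_upt norm_zpart[of x] by (simp add: norm_mult)

lemma linear_reflrot: "linear (reflrot \<rho>)"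
  by (rule linearI) (simp_all add: reflrot_def upt_pt_def zpart_def vec_eq_iff forall_3 algebra_simps)

lemma surj_reflrot:
  assumes "norm \<rho> = 1"
  shows "surj (reflrot \<rho>)"
proof (rule linear_injective_imp_surjective[OF linear_reflrot])
  show "inj (reflrot \<rho>)"
    unfolding linear_injective_0[OF linear_reflrot] using norm_reflrot[OF assms] by (metis norm_eq_zero)
qed simp

lemma reflrot_not_homotopic_id:
  assumes "norm \<rho> = 1"
  shows "\<not> homotopic_with_canon (\<lambda>x. True) (sphere 0 1) (sphere 0 1) (reflrot \<rho>) id"
proof
  assume hom: "homotopic_with_canon (\<lambda>x. True) (sphere 0 1) (sphere 0 1) (reflrot \<rho>) id"
  define \<theta> where "\<theta> = Arg \<rho>"
  have \<theta>: "\<rho> = cis \<theta>" using assms cis_Arg[of \<rho>] by (simp add: \<theta>_def sgn_div_norm split: if_splits) (metis norm_zero sgn_eq div_by_1 zero_neq_one of_real_1)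
  \<comment> \<open>At angle \<open>pi\<close> the map w -> - cnj w negates the real part and is
    \<open>refl1\<close>; turning the angle to that of \<rho> deforms it into
    \<open>reflrot \<rho>\<close>.\<close>
  define h where "h su = reflrot (cis ((1 - fst su) * pi + fst su * \<theta>)) (snd su)" for su :: "real \<times> (real^3)"
  have "homotopic_with_canon (\<lambda>x. True) (sphere 0 1) (sphere 0 1) refl1 (reflrot \<rho>)"
  proof (rule homotopic_canonI[of _ h])
    have "continuous_on ({0..1} \<times> sphere 0 1) (\<lambda>su. h su $ i)" for i
      using exhaust_3[of i] unfolding h_def reflrot_def upt_pt_def zpart_def
      by (elim disjE) (simp_all add: continuous_intros)
    then have "continuous_on ({0..1} \<times> sphere 0 1) (\<lambda>su. \<chi> i. h su $ i)" by (intro continuous_on_vec_lambda)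
    then show "continuous_on ({0..1} \<times> sphere 0 1) h" by simp
    show "h (t, x) \<in> sphere 0 1" if "x \<in> sphere 0 1" for t x using that by (simp add: h_def norm_reflrot)
    show "h (0, x) = refl1 x" for x by (simp add: h_def reflrot_def refl1_def upt_pt_def zpart_def vec_eq_iff forall_3)
    show "h (1, x) = reflrot \<rho> x" for x by (simp add: h_def \<theta>)
  qed
  then show False using hom homotopic_with_trans reflection_not_homotopic_id by blast
qed

theorem orientation_reversing_similarity_no_deck:
  fixes q :: "real^3 \<Rightarrow> real^3"
  assumes q: "continuous_on H3 q" and inj: "\<And>x. x \<in> H3 \<Longrightarrow> \<exists>e>0. inj_on q (ball x e)"
    and \<mu>: "\<mu> > 0" and \<rho>: "norm \<rho> = 1"
    and qc: "\<And>x. x \<in> H3 \<Longrightarrow> q (upt_pt (of_real \<mu> * (\<rho> * cnj (zpart x) + s)) (\<mu> * x$3)) = q x"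
  shows False
proof -
  define c where "c x = upt_pt (of_real \<mu> * (\<rho> * cnj (zpart x) + s)) (\<mu> * x$3)" for x
  have "homotopic_with_canon (\<lambda>x. True) (sphere 0 1) (sphere 0 1) (reflrot \<rho>) id"
  proof (rule deck_similarity_homotopic_id[of H3 q c \<mu>])
    show "connected H3" by (rule convex_connected[OF convex_H3])
    show "\<exists>e. good_radius H3 q x e" if x: "x \<in> H3" for x
    proof -
      obtain e where e: "e > 0" "inj_on q (ball x e)" using inj[OF x] by blast
      obtain e2 where e2: "e2 > 0" "ball x e2 \<subseteq> H3" using open_H3 x by (meson open_contains_ball)
      have "cball x (min e e2 / 2) \<subseteq> ball x e" "cball x (min e e2 / 2) \<subseteq> ball x e2"
        using e(1) e2(1) by (auto simp: cball_subset_ball_iff)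
      then have "good_radius H3 q x (min e e2 / 2)"
        unfolding good_radius_def using e e2 inj_on_subset by (auto simp: subset_trans)
      then show ?thesis by blast
    qed
    have "e3 \<in> H3" by (simp add: H3_iff)
    then show "H3 \<noteq> {}" by blast
    show "c x \<in> H3" if "x \<in> H3" for x using that \<mu> by (simp add: c_def H3_iff)
    show "q (c x) = q x" if "x \<in> H3" for x using qc[OF that] by (simp add: c_def)
    show "c (x + u) = c x + \<mu> *\<^sub>R reflrot \<rho> u" for x u
      by (simp add: c_def reflrot_def upt_pt_def zpart_def vec_eq_iff forall_3 algebra_simps)
  qed (use q \<mu> \<rho> linear_reflrot surj_reflrot norm_reflrot in auto)
  then show False using reflrot_not_homotopic_id[OF \<rho>] by blast
qed

section \<open>Retraction onto the knot exterior\<close>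

text \<open>Stereographic projection. It makes invariance of domain applicable in the 3-sphere, and
  it places the knot complement in \<open>real^3\<close>, where differences of points make
  sense.\<close>

lemma punctured_S3_homeomorphic:
  assumes "k \<in> S3"
  obtains \<phi> :: "real^4 \<Rightarrow> real^3" and \<psi> where "homeomorphism (S3 - {k}) UNIV \<phi> \<psi>"
proof -
  have nz: "axis 1 1 \<noteq> (0 :: real^4)" by (simp add: axis_eq_0_iff)
  have "(S3 - {k}) homeomorphic {x :: real^4. axis 1 1 \<bullet> x = 0}"
    by (rule homeomorphic_punctured_sphere_hyperplane[OF _ assms nz]) simp
  also have "{x :: real^4. axis 1 1 \<bullet> x = 0} homeomorphic (UNIV :: (real^3) set)"
    by (rule homeomorphic_affine_sets) (simp_all add: affine_hyperplane aff_dim_hyperplane[OF nz])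
  finally show ?thesis using that unfolding homeomorphic_def by blast
qed

lemma cis_eq_close:
  assumes "cis s = cis t" "\<bar>s - t\<bar> < 2 * pi"
  shows "s = t"
proof -
  have "sin s = sin t \<and> cos s = cos t" using assms(1) by (simp add: complex_eq_iff)
  then obtain n :: int where n: "s = t + 2 * pi * n" unfolding sin_cos_eq_iff by blast
  then have "2 * pi * \<bar>real_of_int n\<bar> < 2 * pi * 1" using assms(2) by (simp add: abs_mult)
  then have "\<bar>real_of_int n\<bar> < 1" by (subst (asm) mult_less_cancel_left_pos) simp_all
  then show ?thesis using n by simp
qed

locale knot_tube =
  fixes h :: "real \<times> (real^2) \<Rightarrow> real^4" and r :: real
  assumes r: "r > 1" and cont: "continuous_on (UNIV \<times> ball 0 r) h"
    and periodic: "\<And>s z. z \<in> ball 0 r \<Longrightarrow> h (s + 2 * pi, z) = h (s, z)"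
    and inj: "\<And>s t z w. z \<in> ball 0 r \<Longrightarrow> w \<in> ball 0 r \<Longrightarrow> h (s, z) = h (t, w) \<Longrightarrow> cis s = cis t \<and> z = w"
    and range_S3: "h ` (UNIV \<times> ball 0 r) \<subseteq> S3"
begin

lemma in_S3: "norm z < r \<Longrightarrow> h (s, z) \<in> S3"
  using range_S3 by (auto simp: image_subset_iff)

lemma periodic_nat: "z \<in> ball 0 r \<Longrightarrow> h (s + 2 * pi * real n, z) = h (s, z)"
proof (induction n)
  case (Suc n)
  have "s + 2 * pi * real (Suc n) = (s + 2 * pi * real n) + 2 * pi" by (simp add: algebra_simps)
  then have "h (s + 2 * pi * real (Suc n), z) = h (s + 2 * pi * real n, z)"
    using periodic[OF Suc.prems, of "s + 2 * pi * real n"] by (simp only:)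
  then show ?case using Suc by simp
qed simp

lemma periodic_cis:
  assumes "cis s = cis t" "z \<in> ball 0 r"
  shows "h (s, z) = h (t, z)"
proof -
  have "sin s = sin t \<and> cos s = cos t" using assms(1) by (simp add: complex_eq_iff)
  then obtain n :: int where n: "s = t + 2 * pi * n" unfolding sin_cos_eq_iff by blast
  show ?thesis
  proof (cases "n \<ge> 0")
    case True
    then have "s = t + 2 * pi * real (nat n)" using n by simp
    then show ?thesis using periodic_nat[OF assms(2)] by simp
  next
    case False
    then have "t = s + 2 * pi * real (nat (- n))" using n by simp
    then show ?thesis using periodic_nat[OF assms(2)] by simp
  qed
qed

lemma angle_representative:
  assumes "z \<in> ball 0 r"
  obtains t where "t \<in> {0..2 * pi}" "cis t = cis s" "h (s, z) = h (t, z)"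
proof -
  obtain t where t: "0 \<le> t" "t < 2 * pi" "cos s = cos t" "sin s = sin t"
    by (rule sincos_total_2pi[of "cos s" "sin s"]) simp_all
  then have c: "cis s = cis t" by (simp add: complex_eq_iff)
  show ?thesis
    by (rule that[OF _ c[symmetric] periodic_cis[OF c assms]]) (use t in simp)
qed

text \<open>Invariance of domain wants a Euclidean target, so each short piece of the tube is
  studied after removing from the sphere a point of the core that the piece misses.\<close>

lemma openin_tube: "openin (top_of_set S3) (h ` (UNIV \<times> ball 0 1))"
proof (subst openin_subopen, intro ballI)
  fix y assume "y \<in> h ` (UNIV \<times> ball 0 1)"
  then obtain s0 z0 where y: "y = h (s0, z0)" "norm z0 < 1" by auto
  define P where "P = {s0 - 1<..<s0 + 1} \<times> ball (0 :: real^2) 1"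
  \<comment> \<open>The angle \<open>s0 + 2\<close> differs from every angle of the piece by less
    than 3, hence by less than a full turn, and equals none of them; so injectivity of the tube
    keeps \<open>k\<close> off the piece.\<close>
  define k where "k = h (s0 + 2, 0)"
  have P: "open P" "(s0, z0) \<in> P" using y(2) by (auto simp: P_def open_Times)
  have Psub: "P \<subseteq> UNIV \<times> ball 0 r" using r by (auto simp: P_def)
  have k: "k \<in> S3" unfolding k_def using in_S3[of 0 "s0 + 2"] r by simp
  have pi: "pi \<ge> 2" by (rule pi_ge_two)
  have hP: "h ` P \<subseteq> S3 - {k}"
  proof
    fix w assume "w \<in> h ` P"
    then obtain s z where sz: "w = h (s, z)" "s0 - 1 < s" "s < s0 + 1" "norm z < 1" by (auto simp: P_def)
    have "w \<noteq> k"
    proof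
      assume "w = k"
      then have "cis s = cis (s0 + 2)" using inj[of z 0 s "s0 + 2"] sz r by (simp add: k_def)
      then have "s = s0 + 2" by (rule cis_eq_close) (use sz pi in linarith)
      then show False using sz by simp
    qed
    then show "w \<in> S3 - {k}" using in_S3[of z s] sz r by simp
  qed
  have injP: "inj_on h P"
  proof (rule inj_onI)
    fix a b assume a: "a \<in> P" and b: "b \<in> P" and eq: "h a = h b"
    obtain s z where a': "a = (s, z)" by (cases a)
    obtain t w where b': "b = (t, w)" by (cases b)
    have *: "cis s = cis t \<and> z = w" using inj[of z w s t] a b eq a' b' r by (auto simp: P_def)
    have "\<bar>s - t\<bar> < 2 * pi" using a b a' b' pi by (auto simp: P_def)
    then show "a = b" using cis_eq_close * a' b' by blast
  qed
  obtain \<phi> :: "real^4 \<Rightarrow> real^3" and \<psi> where \<phi>: "homeomorphism (S3 - {k}) UNIV \<phi> \<psi>"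
    using punctured_S3_homeomorphic[OF k] by blast
  have contP: "continuous_on P h" using continuous_on_subset[OF cont Psub] .
  have "open ((\<phi> \<circ> h) ` P)"
  proof (rule invariance_of_domain_gen[OF P(1)])
    show "continuous_on P (\<phi> \<circ> h)"
      by (rule continuous_on_compose[OF contP continuous_on_subset[OF homeomorphism_cont1[OF \<phi>] hP]])
    have "inj_on \<phi> (h ` P)"
      using homeomorphism_apply1[OF \<phi>] hP by (metis inj_on_inverseI subsetD)
    then show "inj_on (\<phi> \<circ> h) P" by (rule comp_inj_on[OF injP])
  qed simp
  then have "openin (top_of_set (S3 - {k})) (\<psi> ` ((\<phi> \<circ> h) ` P))"
    by (intro homeomorphism_imp_open_map[OF homeomorphism_symD[OF \<phi>]]) simp
  moreover have "\<psi> ` ((\<phi> \<circ> h) ` P) = h ` P"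
  proof -
    have "\<psi> (\<phi> (h a)) = h a" if "a \<in> P" for a using homeomorphism_apply1[OF \<phi>] hP that by blast
    then show ?thesis unfolding image_comp by (intro image_cong) auto
  qed
  moreover have "openin (top_of_set S3) (S3 - {k})" by (simp add: openin_delete)
  ultimately have "openin (top_of_set S3) (h ` P)" using openin_trans by metis
  moreover have "y \<in> h ` P" "h ` P \<subseteq> h ` (UNIV \<times> ball 0 1)" using y P(2) by (auto simp: P_def)
  ultimately show "\<exists>T. openin (top_of_set S3) T \<and> y \<in> T \<and> T \<subseteq> h ` (UNIV \<times> ball 0 1)" by blast
qed

section \<open>Radial retraction of the tube minus its core\<close>

definition radial :: "real^4 \<Rightarrow> real^4"
  where "radial y = (let sz = (SOME sz. snd sz \<in> ball 0 r \<and> h sz = y) in h (fst sz, (1 / norm (snd sz)) *\<^sub>R snd sz))"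

text \<open>The chosen preimage has the right disk coordinate, and its angle is right up to full
  turns, which periodicity absorbs.\<close>

lemma radial_h:
  assumes z: "z \<in> ball 0 r" "z \<noteq> 0"
  shows "radial (h (s, z)) = h (s, (1 / norm z) *\<^sub>R z)"
proof -
  define sz where "sz = (SOME sz. snd sz \<in> ball 0 r \<and> h sz = h (s, z))"
  have "snd sz \<in> ball 0 r \<and> h sz = h (s, z)" unfolding sz_def by (rule someI[of _ "(s, z)"]) (use z in simp)
  then have c: "cis (fst sz) = cis s" and e: "snd sz = z" using inj[of "snd sz" z "fst sz" s] z by auto
  have "(1 / norm z) *\<^sub>R z \<in> ball 0 r" using z r by simp
  then have "h (fst sz, (1 / norm z) *\<^sub>R z) = h (s, (1 / norm z) *\<^sub>R z)" by (rule periodic_cis[OF c])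
  then show ?thesis by (simp only: radial_def Let_def sz_def[symmetric] e)
qed

text \<open>One period of the closed tube is compact, so \<open>h\<close> restricted to it is a
  quotient map onto its image. Continuity can therefore be tested in the coordinates (s, z), where
  only the core z = 0 has to be avoided.\<close>

lemma continuous_on_radial:
  "continuous_on (h ` (UNIV \<times> cball 0 1) - h ` (UNIV \<times> {0})) radial"
proof -
  define D where "D = {0..2 * pi} \<times> cball (0 :: real^2) 1"
  define T where "T = h ` (UNIV \<times> cball 0 1)"
  define K where "K = h ` (UNIV \<times> {0})"
  have Dsub: "D \<subseteq> UNIV \<times> ball 0 r" using r by (auto simp: D_def)
  have cD: "continuous_on D h" by (rule continuous_on_subset[OF cont Dsub])
  have compD: "compact D" unfolding D_def by (intro compact_Times compact_Icc compact_cball)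
  have hD: "h ` D = T"
  proof
    show "h ` D \<subseteq> T" by (auto simp: D_def T_def)
    show "T \<subseteq> h ` D"
    proof
      fix y assume "y \<in> T"
      then obtain s z where y: "y = h (s, z)" "norm z \<le> 1" by (auto simp: T_def)
      then have "z \<in> ball 0 r" using r by simp
      then obtain t where "t \<in> {0..2 * pi}" "h (s, z) = h (t, z)" using angle_representative by metis
      then show "y \<in> h ` D" using y by (auto simp: D_def)
    qed
  qed
  define D' where "D' = {sz \<in> D. snd sz \<noteq> 0}"
  have D'K: "h sz \<notin> K \<longleftrightarrow> snd sz \<noteq> 0" if "sz \<in> D" for sz
  proof
    assume "h sz \<notin> K"
    then show "snd sz \<noteq> 0" by (cases sz) (auto simp: K_def)
  next
    assume nz: "snd sz \<noteq> 0"
    show "h sz \<notin> K"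
    proof
      assume "h sz \<in> K"
      then obtain t where "h (fst sz, snd sz) = h (t, 0)" by (auto simp: K_def)
      then show False using inj[of "snd sz" 0 "fst sz" t] nz that Dsub r by auto
    qed
  qed
  have "openin (top_of_set D) (D \<inter> {sz. snd sz \<noteq> 0})"
    by (intro openin_open_Int open_Collect_neq continuous_intros)
  moreover have "D \<inter> {sz. snd sz \<noteq> 0} = D'" unfolding D'_def by blast
  ultimately have oD': "openin (top_of_set D) D'" by (simp only:)
  define g where "g sz = h (fst sz, (1 / norm (snd sz)) *\<^sub>R snd sz)" for sz :: "real \<times> (real^2)"
  have cg: "continuous_on D' g"
    unfolding g_def
    by (rule continuous_on_compose2[OF cont]) (use r in \<open>auto simp: D'_def intro!: continuous_intros\<close>)
  have gr: "radial (h sz) = g sz" if "sz \<in> D'" for sz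
    using that radial_h[of "snd sz" "fst sz"] Dsub by (auto simp: g_def D'_def)
  show ?thesis
    unfolding T_def[symmetric] K_def[symmetric] continuous_on_open_invariant[of "T - K"]
  proof (intro allI impI)
    fix B :: "(real^4) set" assume B: "open B"
    define U where "U = {y \<in> T - K. radial y \<in> B}"
    have "D \<inter> h -` U = D' \<inter> g -` B"
    proof (intro equalityI subsetI)
      fix sz assume a: "sz \<in> D \<inter> h -` U"
      then have "sz \<in> D'" using D'K[of sz] by (auto simp: U_def D'_def)
      then show "sz \<in> D' \<inter> g -` B" using a gr[of sz] by (auto simp: U_def)
    next
      fix sz assume a: "sz \<in> D' \<inter> g -` B"
      then have "sz \<in> D" "h sz \<in> T" "h sz \<notin> K" using D'K[of sz] hD by (auto simp: D'_def)
      then show "sz \<in> D \<inter> h -` U" using a gr[of sz] by (auto simp: U_def)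
    qed
    moreover have "openin (top_of_set D') (D' \<inter> g -` B)" by (rule continuous_openin_preimage_gen[OF cg B])
    ultimately have "openin (top_of_set D) (D \<inter> h -` U)" using openin_trans oD' by metis
    moreover have "U \<subseteq> T" by (auto simp: U_def)
    ultimately have "openin (top_of_set T) U"
      using Abstract_Topology_2.continuous_imp_quotient_map[OF cD hD compD] by blast
    then obtain V where "open V" "U = T \<inter> V" by (auto simp: openin_open)
    then show "\<exists>A. open A \<and> A \<inter> (T - K) = radial -` B \<inter> (T - K)"
      by (intro exI[of _ V]) (auto simp: U_def set_eq_iff)
  qed
qed

lemma exterior_retraction:
  fixes K E
  assumes K: "K = h ` (UNIV \<times> {0})" and E: "E = S3 - h ` (UNIV \<times> ball 0 1)"
  obtains \<rho> where "continuous_on (S3 - K) \<rho>" "\<rho> ` (S3 - K) \<subseteq> E" "\<And>y. y \<in> E \<Longrightarrow> \<rho> y = y"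
proof -
  define T where "T = h ` (UNIV \<times> cball 0 1)"
  define N where "N = h ` (UNIV \<times> ball 0 1)"
  have NT: "N \<subseteq> T" by (auto simp: N_def T_def)
  have TS: "T \<subseteq> S3" using in_S3 r by (auto simp: T_def image_subset_iff)
  have KN: "K \<subseteq> N" by (auto simp: K N_def)
  have EN: "E = S3 - N" by (simp add: E N_def)
  have un: "S3 - K = E \<union> (T - K)" using KN NT TS by (auto simp: EN)
  have TK: "\<exists>s z. y = h (s, z) \<and> z \<noteq> 0 \<and> norm z \<le> 1 \<and> radial y = h (s, (1 / norm z) *\<^sub>R z)" if y: "y \<in> T - K" for y
  proof -
    obtain s z where sz: "y = h (s, z)" "norm z \<le> 1" using y by (auto simp: T_def)
    then have "z \<noteq> 0" using y by (auto simp: K)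
    then show ?thesis using radial_h[of z s] sz r by auto
  qed
  have radE: "radial y \<in> E" if y: "y \<in> T - K" for y
  proof -
    obtain s z where sz: "z \<noteq> 0" "radial y = h (s, (1 / norm z) *\<^sub>R z)" using TK[OF y] by blast
    have n: "norm ((1 / norm z) *\<^sub>R z) = 1" using sz by simp
    have "radial y \<notin> N"
    proof
      assume "radial y \<in> N"
      then obtain t w where tw: "norm w < 1" "h (s, (1 / norm z) *\<^sub>R z) = h (t, w)" using sz by (auto simp: N_def)
      then have "(1 / norm z) *\<^sub>R z = w" using inj[of "(1 / norm z) *\<^sub>R z" w s t] n r by simp
      then show False using n tw(1) by simp
    qed
    then show ?thesis using in_S3[of "(1 / norm z) *\<^sub>R z" s] n r sz by (simp add: EN)
  qed
  have rad_id: "radial y = y" if y: "y \<in> E" "y \<in> T - K" for y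
  proof -
    obtain s z where sz: "y = h (s, z)" "z \<noteq> 0" "norm z \<le> 1" "radial y = h (s, (1 / norm z) *\<^sub>R z)"
      using TK[OF y(2)] by blast
    have "\<not> norm z < 1" using y(1) sz(1) by (auto simp: EN N_def)
    then show ?thesis using sz by simp
  qed
  have cE: "closed E"
  proof -
    have "closedin (top_of_set S3) E" using openin_tube by (auto simp: EN N_def closedin_def Diff_Diff_Int Int_absorb1 openin_imp_subset)
    then show ?thesis using closedin_closed_trans closed_sphere by blast
  qed
  have cT: "closed T"
  proof -
    have "T = h ` ({0..2 * pi} \<times> cball 0 1)"
    proof
      show "T \<subseteq> h ` ({0..2 * pi} \<times> cball 0 1)"
      proof
        fix y assume "y \<in> T"
        then obtain s z where y: "y = h (s, z)" "norm z \<le> 1" by (auto simp: T_def)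
        then have "z \<in> ball 0 r" using r by simp
        then obtain t where "t \<in> {0..2 * pi}" "h (s, z) = h (t, z)" using angle_representative by metis
        then show "y \<in> h ` ({0..2 * pi} \<times> cball 0 1)" using y by auto
      qed
    qed (auto simp: T_def)
    moreover have "compact (h ` ({0..2 * pi} \<times> cball 0 1))"
      by (intro compact_continuous_image compact_Times compact_Icc compact_cball continuous_on_subset[OF cont]) (use r in auto)
    ultimately show ?thesis by (simp add: compact_imp_closed)
  qed
  \<comment> \<open>Both pieces are relatively closed. They overlap only where the disk coordinate
    has norm 1, and there the radial map is the identity.\<close>
  have "continuous_on (E \<union> (T - K)) (\<lambda>y. if y \<in> E then y else radial y)"
  proof (rule continuous_on_cases_local)
    show "closedin (top_of_set (E \<union> (T - K))) E" by (rule closed_subset[OF _ cE]) blast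
    have "T - K = (E \<union> (T - K)) \<inter> T" using KN by (auto simp: EN)
    then show "closedin (top_of_set (E \<union> (T - K))) (T - K)" using cT by (metis closedin_closed_Int)
    show "continuous_on (T - K) radial" using continuous_on_radial by (simp add: T_def K)
    show "y = radial y" if "y \<in> E \<and> y \<notin> E \<or> y \<in> T - K \<and> y \<in> E" for y using that rad_id by metis
  qed (rule continuous_on_id)
  then show ?thesis
    using that[of "\<lambda>y. if y \<in> E then y else radial y"] radE unfolding un by auto
qed

end

lemma knot_exterior_tube:
  assumes "knot_exterior K E"
  obtains h r where "knot_tube h r" "K = h ` (UNIV \<times> {0})" "E = S3 - h ` (UNIV \<times> ball 0 1)"
proof -
  obtain N where tube: "open_tubular_neighborhood K N" and E: "E = S3 - N"
    using assms by (auto simp: knot_exterior_def)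
  obtain h :: "real \<times> (real^2) \<Rightarrow> real^4" and r where H: "r > 1 \<and>
    smooth_immersion_on (UNIV \<times> ball 0 r) h \<and>
    (\<forall>s. \<forall>z\<in>ball 0 r. h (s + 2 * pi, z) = h (s, z)) \<and>
    (\<forall>s t. \<forall>z\<in>ball 0 r. \<forall>w\<in>ball 0 r. h (s, z) = h (t, w) \<longrightarrow> cis s = cis t \<and> z = w) \<and>
    h ` (UNIV \<times> ball 0 r) \<subseteq> S3 \<and> h ` (UNIV \<times> {0}) = K \<and> h ` (UNIV \<times> ball 0 1) = N"
    using tube unfolding open_tubular_neighborhood_def by (elim exE) iprover
  note h = H[THEN conjunct1] H[THEN conjunct2, THEN conjunct1] H[THEN conjunct2, THEN conjunct2, THEN conjunct1]
    H[THEN conjunct2, THEN conjunct2, THEN conjunct2, THEN conjunct1]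
    H[THEN conjunct2, THEN conjunct2, THEN conjunct2, THEN conjunct2, THEN conjunct1]
    H[THEN conjunct2, THEN conjunct2, THEN conjunct2, THEN conjunct2, THEN conjunct2, THEN conjunct1]
    H[THEN conjunct2, THEN conjunct2, THEN conjunct2, THEN conjunct2, THEN conjunct2, THEN conjunct2]
  have "C_diff_on 0 (UNIV \<times> ball 0 r) h" using h(2) unfolding smooth_immersion_on_def by blast
  then have c: "continuous_on (UNIV \<times> ball 0 r) h" by simp
  have "knot_tube h r"
  proof (rule knot_tube.intro[OF h(1) c _ _ h(5)])
    show "h (s + 2 * pi, z) = h (s, z)" if "z \<in> ball 0 r" for s z
      by (rule h(3)[rule_format, OF that])
    show "cis s = cis t \<and> z = w" if "z \<in> ball 0 r" "w \<in> ball 0 r" "h (s, z) = h (t, w)" for s t z w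
      by (rule h(4)[rule_format, OF that])
  qed
  moreover have "K = h ` (UNIV \<times> {0})" "E = S3 - h ` (UNIV \<times> ball 0 1)" by (simp_all only: h(6,7) E)
  ultimately show ?thesis by (rule that)
qed

section \<open>Deck transformations and the fundamental group\<close>

locale developed_space = hyperbolic_space M d for M :: "'a::real_normed_vector set" and d +
  fixes p :: "real^3 \<Rightarrow> 'a" and x0 :: "real^3"
  assumes p: "loc_isom M d H3 p" and cover: "covering_space H3 p M" and x0: "x0 \<in> H3"
begin

definition deck :: "(lvec \<Rightarrow> lvec) \<Rightarrow> bool"
  where "deck A \<longleftrightarrow> lorentz A \<and> (\<forall>y\<in>H3. p (act A y) = p y)"

text \<open>The correspondence between loops and deck transformations is kept as a relation on
  loops, witnessed by a lift starting at \<open>x0\<close>; it descends to path classes by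
  monodromy.\<close>

definition deck_of :: "(real \<Rightarrow> 'a) \<Rightarrow> (lvec \<Rightarrow> lvec) \<Rightarrow> bool"
  where "deck_of \<gamma> A \<longleftrightarrow> deck A \<and> (\<exists>h. path h \<and> path_image h \<subseteq> H3 \<and> pathstart h = x0 \<and>
     pathfinish h = act A x0 \<and> (\<forall>t\<in>{0..1}. p (h t) = \<gamma> t))"

lemma deck_lorentz: "deck A \<Longrightarrow> lorentz A"
  and deck_p: "deck A \<Longrightarrow> y \<in> H3 \<Longrightarrow> p (act A y) = p y"
  by (auto simp: deck_def)

lemma deck_id: "deck id"
  by (simp add: deck_def lorentz_id act_id)

lemma deck_comp:
  assumes "deck A" "deck B"
  shows "deck (A \<circ> B)"
  using assms lorentz_comp act_comp[of B] act_in_H3 unfolding deck_def by simp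

lemma deck_fixed: "deck A \<Longrightarrow> y \<in> H3 \<Longrightarrow> act A y = y \<Longrightarrow> A = id"
  using deck_free[OF p, of A y] deck_lorentz deck_p by blast

lemma deck_inv:
  assumes "deck A"
  shows "deck (linv A)"
proof -
  have A: "lorentz A" by (rule deck_lorentz[OF assms])
  have "p (act (linv A) y) = p y" if y: "y \<in> H3" for y
  proof -
    have "act (linv A) y \<in> H3" by (rule act_in_H3[OF lorentz_inv[OF A] y])
    then have "p (act A (act (linv A) y)) = p (act (linv A) y)" by (rule deck_p[OF assms])
    then show ?thesis using act_act_inv[OF A y] by simp
  qed
  then show ?thesis using lorentz_inv[OF A] by (simp add: deck_def)
qed

lemma deck_eqI:
  assumes "deck A" "deck B" "act A x0 = act B x0"
  shows "A = B"
proof -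
  have "act (linv A \<circ> B) x0 = x0"
    using act_comp[OF deck_lorentz[OF assms(2)] x0, of "linv A"] act_inv_act[OF deck_lorentz[OF assms(1)] x0]
    by (simp flip: assms(3))
  then have "linv A \<circ> B = id" using deck_fixed[OF deck_comp[OF deck_inv[OF assms(1)] assms(2)] x0] by blast
  then have "A \<circ> (linv A \<circ> B) = A \<circ> id" by (simp only:)
  then have "(A \<circ> linv A) \<circ> B = A" by (simp only: comp_assoc comp_id)
  then show ?thesis by (simp add: comp_linv[OF deck_lorentz[OF assms(1)]])
qed

lemma deck_of_exists:
  assumes "\<gamma> \<in> based_loops M (p x0)"
  shows "\<exists>A. deck_of \<gamma> A"
proof -
  have g: "path \<gamma>" "path_image \<gamma> \<subseteq> M" "pathstart \<gamma> = p x0" "pathfinish \<gamma> = p x0"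
    using assms by (auto simp: based_loops_def)
  obtain h where h: "path h" "path_image h \<subseteq> H3" "pathstart h = x0" "\<And>t. t \<in> {0..1} \<Longrightarrow> p (h t) = \<gamma> t"
    using covering_space_lift_path_strong[OF cover x0 g(1,2,3)] by metis
  have e: "pathfinish h \<in> H3" using h(2) by (auto simp: path_image_def pathfinish_def)
  have "p x0 = p (pathfinish h)" using h(4)[of 1] g(4) by (simp add: pathfinish_def)
  then obtain A where "lorentz A" "act A x0 = pathfinish h" "\<And>y. y \<in> H3 \<Longrightarrow> p (act A y) = p y"
    using deck_exists[OF p x0 e] by metis
  then show ?thesis unfolding deck_of_def deck_def using h by (intro exI[of _ A]) auto
qed

lemma deck_of_homotopic:
  assumes "deck_of \<gamma> A" "deck_of \<gamma>' B" "homotopic_paths M \<gamma> \<gamma>'"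
  shows "A = B"
proof -
  obtain h where h: "path h" "path_image h \<subseteq> H3" "pathstart h = x0" "pathfinish h = act A x0"
    "\<And>t. t \<in> {0..1} \<Longrightarrow> p (h t) = \<gamma> t" using assms(1) unfolding deck_of_def by blast
  obtain k where k: "path k" "path_image k \<subseteq> H3" "pathstart k = x0" "pathfinish k = act B x0"
    "\<And>t. t \<in> {0..1} \<Longrightarrow> p (k t) = \<gamma>' t" using assms(2) unfolding deck_of_def by blast
  have "path \<gamma>" "path_image \<gamma> \<subseteq> M" "path \<gamma>'" "path_image \<gamma>' \<subseteq> M"
    using homotopic_paths_imp_path[OF assms(3)] homotopic_paths_imp_subset[OF assms(3)] by auto
  then have "pathfinish h = pathfinish k"
    using covering_space_monodromy[OF cover _ _ _ _ assms(3) h(1,2,5) k(1,2,5)] h(3) k(3) by simp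
  then show ?thesis using deck_eqI assms(1,2) h(4) k(4) unfolding deck_of_def by metis
qed

text \<open>The lift of \<delta> that starts where the lift of \<gamma> ends is the translate by
  \<open>A\<close> of its lift from \<open>x0\<close>. So concatenation corresponds to composition
  in the same order.\<close>

lemma deck_of_join:
  assumes "deck_of \<gamma> A" "deck_of \<delta> B"
  shows "deck_of (\<gamma> +++ \<delta>) (A \<circ> B)"
proof -
  obtain h where h: "path h" "path_image h \<subseteq> H3" "pathstart h = x0" "pathfinish h = act A x0"
    "\<And>t. t \<in> {0..1} \<Longrightarrow> p (h t) = \<gamma> t" using assms(1) unfolding deck_of_def by blast
  obtain k where k: "path k" "path_image k \<subseteq> H3" "pathstart k = x0" "pathfinish k = act B x0"
    "\<And>t. t \<in> {0..1} \<Longrightarrow> p (k t) = \<delta> t" using assms(2) unfolding deck_of_def by blast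
  have dA: "deck A" and dB: "deck B" using assms by (auto simp: deck_of_def)
  note lA = deck_lorentz[OF dA] and lB = deck_lorentz[OF dB]
  have kH: "k t \<in> H3" if "t \<in> {0..1}" for t using k(2) that by (auto simp: path_image_def)
  define k' where "k' = act A \<circ> k"
  have k': "path k'" "path_image k' \<subseteq> H3" "pathstart k' = act A x0" "pathfinish k' = act A (act B x0)"
    "\<And>t. t \<in> {0..1} \<Longrightarrow> p (k' t) = \<delta> t"
  proof -
    show "path k'" unfolding k'_def
      by (rule path_continuous_image[OF k(1) continuous_on_subset[OF continuous_on_act[OF lA] k(2)]])
    show "path_image k' \<subseteq> H3" using kH act_in_H3[OF lA] by (auto simp: path_image_def k'_def)
    show "pathstart k' = act A x0" using k(3) by (simp add: k'_def pathstart_def)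
    show "pathfinish k' = act A (act B x0)" using k(4) by (simp add: k'_def pathfinish_def)
    show "p (k' t) = \<delta> t" if "t \<in> {0..1}" for t using deck_p[OF dA kH[OF that]] k(5)[OF that] by (simp add: k'_def)
  qed
  have "path (h +++ k')" using h k' by simp
  moreover have "path_image (h +++ k') \<subseteq> H3" using h k' by (simp add: path_image_join)
  moreover have "pathstart (h +++ k') = x0" using h by simp
  moreover have "pathfinish (h +++ k') = act (A \<circ> B) x0" using k'(4) act_comp[OF lB x0] by simp
  moreover have "p ((h +++ k') t) = (\<gamma> +++ \<delta>) t" if "t \<in> {0..1}" for t
    using h(5)[of "2 * t"] k'(5)[of "2 * t - 1"] that by (simp add: joinpaths_def)
  ultimately show ?thesis unfolding deck_of_def using deck_comp[OF dA dB] by blast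
qed

lemma deck_of_const: "deck_of (\<lambda>_. p x0) id"
  unfolding deck_of_def using deck_id x0 act_id[OF x0]
  by (auto intro!: exI[of _ "\<lambda>_. x0"] simp: path_def path_image_def pathstart_def pathfinish_def)

text \<open>The lift closes up, contracts in the convex half-space, and the contraction is pushed
  down by \<open>p\<close>.\<close>

lemma deck_of_id_null:
  assumes "deck_of \<gamma> id"
  shows "homotopic_paths M \<gamma> (\<lambda>_. p x0)"
proof -
  obtain h where h: "path h" "path_image h \<subseteq> H3" "pathstart h = x0" "pathfinish h = x0"
    "\<And>t. t \<in> {0..1} \<Longrightarrow> p (h t) = \<gamma> t" using assms act_id[OF x0] unfolding deck_of_def by auto
  have pc: "continuous_on H3 p" by (rule covering_space_imp_continuous[OF cover])
  have pM: "p \<in> H3 \<rightarrow> M" using covering_space_imp_surjective[OF cover] by auto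
  have c: "path (\<lambda>_. x0)" "path_image (\<lambda>_. x0) \<subseteq> H3" "pathstart (\<lambda>_. x0) = x0" "pathfinish (\<lambda>_. x0) = x0"
    using x0 by (auto simp: path_def path_image_def pathstart_def pathfinish_def)
  have "homotopic_paths H3 h (\<lambda>_. x0)"
    using convex_imp_simply_connected[OF convex_H3] h c unfolding simply_connected_eq_homotopic_paths by metis
  then have 1: "homotopic_paths M (p \<circ> h) (p \<circ> (\<lambda>_. x0))"
    by (rule homotopic_paths_continuous_image[OF _ pc pM])
  have "homotopic_paths M (p \<circ> h) \<gamma>"
    using homotopic_paths_imp_path[OF 1] homotopic_paths_imp_subset[OF 1] h(5)
    by (intro homotopic_paths_eq) simp_all
  then have "homotopic_paths M \<gamma> (p \<circ> (\<lambda>_. x0))"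
    by (rule homotopic_paths_trans[OF homotopic_paths_sym 1])
  then show ?thesis by (simp only: comp_def)
qed

text \<open>Injectivity is the point of the retraction: a loop of \<open>E\<close> with trivial deck
  transformation contracts in \<open>M\<close>, and composing with \<open>r\<close> moves the
  contraction into \<open>E\<close> while leaving the loop in place.\<close>

lemma retract_group_to_deck:
  assumes x: "p x0 \<in> E" and E: "E \<subseteq> M"
    and r: "continuous_on M r" "r ` M \<subseteq> E" "\<And>y. y \<in> E \<Longrightarrow> r y = y"
  obtains \<Phi> where "\<And>c. c \<in> carrier (fundamental_group E (p x0)) \<Longrightarrow> deck (\<Phi> c)"
    "\<And>c c'. c \<in> carrier (fundamental_group E (p x0)) \<Longrightarrow> c' \<in> carrier (fundamental_group E (p x0)) \<Longrightarrow>
       \<Phi> (c \<otimes>\<^bsub>fundamental_group E (p x0)\<^esub> c') = \<Phi> c \<circ> \<Phi> c'"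
    "\<Phi> \<one>\<^bsub>fundamental_group E (p x0)\<^esub> = id"
    "\<And>c. c \<in> carrier (fundamental_group E (p x0)) \<Longrightarrow> \<Phi> c = id \<Longrightarrow> c = \<one>\<^bsub>fundamental_group E (p x0)\<^esub>"
proof -
  let ?G = "fundamental_group E (p x0)"
  have car: "carrier ?G = path_class E ` based_loops E (p x0)" and one: "\<one>\<^bsub>?G\<^esub> = path_class E (\<lambda>_. p x0)"
    by (simp_all add: fundamental_group_def)
  have loopM: "\<gamma> \<in> based_loops M (p x0)" if "\<gamma> \<in> based_loops E (p x0)" for \<gamma>
    using that E by (auto simp: based_loops_def)
  define D where "D c A \<longleftrightarrow> (\<exists>\<gamma>\<in>based_loops E (p x0). c = path_class E \<gamma> \<and> deck_of \<gamma> A)" for c A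
  have ex: "\<exists>A. D c A" if "c \<in> carrier ?G" for c
    using that deck_of_exists[OF loopM] unfolding car D_def by blast
  have uniq: "A = B" if D: "D c A" "D c B" for c A B
  proof -
    obtain \<gamma> where g: "\<gamma> \<in> based_loops E (p x0)" "c = path_class E \<gamma>" "deck_of \<gamma> A" using D(1) by (auto simp: D_def)
    obtain \<delta> where d: "\<delta> \<in> based_loops E (p x0)" "c = path_class E \<delta>" "deck_of \<delta> B" using D(2) by (auto simp: D_def)
    have "\<delta> \<in> path_class E \<delta>" using d(1) by (simp add: path_class_def based_loops_def)
    then have "\<delta> \<in> path_class E \<gamma>" by (simp only: g(2)[symmetric] d(2)[symmetric])
    then have "homotopic_paths E \<gamma> \<delta>" by (simp add: path_class_def)
    then show ?thesis using deck_of_homotopic[OF g(3) d(3)] homotopic_paths_subset[OF _ E] by blast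
  qed
  define \<Phi> where "\<Phi> c = (SOME A. D c A)" for c
  have \<Phi>: "D c (\<Phi> c)" if "c \<in> carrier ?G" for c unfolding \<Phi>_def by (rule someI_ex[OF ex[OF that]])
  have \<Phi>eq: "\<Phi> c = A" if "D c A" for c A
    using uniq[OF someI[of "D c", OF that] that] by (simp add: \<Phi>_def)
  show ?thesis
  proof (rule that)
    show "deck (\<Phi> c)" if "c \<in> carrier ?G" for c using \<Phi>[OF that] by (auto simp: D_def deck_of_def)
    show "\<Phi> (c \<otimes>\<^bsub>?G\<^esub> c') = \<Phi> c \<circ> \<Phi> c'" if c: "c \<in> carrier ?G" "c' \<in> carrier ?G" for c c'
    proof (rule \<Phi>eq)
      obtain \<gamma> where g: "\<gamma> \<in> based_loops E (p x0)" "c = path_class E \<gamma>" "deck_of \<gamma> (\<Phi> c)" using \<Phi>[OF c(1)] by (auto simp: D_def)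
      obtain \<delta> where d: "\<delta> \<in> based_loops E (p x0)" "c' = path_class E \<delta>" "deck_of \<delta> (\<Phi> c')" using \<Phi>[OF c(2)] by (auto simp: D_def)
      have "c \<otimes>\<^bsub>?G\<^esub> c' = path_class E (\<gamma> +++ \<delta>)" unfolding g(2) d(2) by (rule mult_path_class[OF g(1) d(1)])
      then show "D (c \<otimes>\<^bsub>?G\<^esub> c') (\<Phi> c \<circ> \<Phi> c')"
        unfolding D_def using join_in_based_loops[OF g(1) d(1)] deck_of_join[OF g(3) d(3)] by blast
    qed
    show "\<Phi> \<one>\<^bsub>?G\<^esub> = id"
      by (rule \<Phi>eq) (unfold D_def one, use const_in_based_loops[OF x] deck_of_const in blast)
    show "c = \<one>\<^bsub>?G\<^esub>" if c: "c \<in> carrier ?G" "\<Phi> c = id" for c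
    proof -
      obtain \<gamma> where g: "\<gamma> \<in> based_loops E (p x0)" "c = path_class E \<gamma>" "deck_of \<gamma> id"
        using \<Phi>[OF c(1)] c(2) by (auto simp: D_def)
      have "homotopic_paths M \<gamma> (\<lambda>_. p x0)" by (rule deck_of_id_null[OF g(3)])
      then have 1: "homotopic_paths E (r \<circ> \<gamma>) (r \<circ> (\<lambda>_. p x0))"
        by (rule homotopic_paths_continuous_image[OF _ r(1)]) (use r(2) in auto)
      have rg: "(r \<circ> \<gamma>) t = \<gamma> t" if "t \<in> {0..1}" for t
      proof -
        have "\<gamma> t \<in> E" using g(1) that by (auto simp: based_loops_def path_image_def)
        then show ?thesis using r(3) by simp
      qed
      have "homotopic_paths E (r \<circ> \<gamma>) \<gamma>"
        using homotopic_paths_imp_path[OF 1] homotopic_paths_imp_subset[OF 1] rg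
        by (intro homotopic_paths_eq) simp_all
      then have "homotopic_paths E \<gamma> (r \<circ> (\<lambda>_. p x0))"
        by (rule homotopic_paths_trans[OF homotopic_paths_sym 1])
      moreover have "r \<circ> (\<lambda>_ :: real. p x0) = (\<lambda>_. p x0)" using r(3)[OF x] by (simp add: comp_def)
      ultimately have "homotopic_paths E \<gamma> (\<lambda>_. p x0)" by (simp only:)
      then show ?thesis unfolding one g(2) by (rule path_class_cong)
    qed
  qed
qed

end

section \<open>From a product of two conjugates to the contradiction\<close>

lemma conjugates_yield_one_2:
  assumes "group G" "g \<in> carrier G" "conjugates_yield_one G g 2"
  obtains a b where "a \<in> carrier G" "b \<in> carrier G"
    "(inv\<^bsub>G\<^esub> a \<otimes>\<^bsub>G\<^esub> g \<otimes>\<^bsub>G\<^esub> a) \<otimes>\<^bsub>G\<^esub> (inv\<^bsub>G\<^esub> b \<otimes>\<^bsub>G\<^esub> g \<otimes>\<^bsub>G\<^esub> b) = \<one>\<^bsub>G\<^esub>"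
proof -
  interpret group G by fact
  obtain as where as: "set as \<subseteq> carrier G" "length as = 2" "conjugates_product G g as = \<one>\<^bsub>G\<^esub>"
    using assms(3) by (auto simp: conjugates_yield_one_def)
  then obtain a b where ab: "as = [a, b]" by (auto simp: numeral_2_eq_2 length_Suc_conv)
  then show ?thesis
    using that[of a b] as assms(2) by (simp add: conjugates_product_def conjugate_def)
qed

lemma order_two_yields_one:
  assumes "generalized_torsion_element G g" "generalized_torsion_order G g = 2"
  shows "conjugates_yield_one G g 2"
  using assms LeastI_ex[of "conjugates_yield_one G g"]
  by (auto simp: generalized_torsion_element_def generalized_torsion_order_def)

text \<open>Since \<open>M\<close> misses a point of the sphere, the developing map in the
  coordinates of \<open>Q\<close>, followed by stereographic projection, is a locally injective map
  into \<open>real^3\<close> invariant under the similarity. No such map exists.\<close>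

lemma deck_not_orientation_reversing:
  fixes M :: "(real^4) set"
  assumes p: "loc_isom M d H3 p" and MS: "M \<subseteq> S3 - {k}" and k: "k \<in> S3" and pc: "continuous_on H3 p"
    and pM: "p ` H3 \<subseteq> M" and M: "Metric_space M d"
    and A: "lorentz A" "\<And>y. y \<in> H3 \<Longrightarrow> p (act A y) = p y" and Q: "lorentz Q" and \<mu>: "\<mu> > 0" and \<rho>: "norm \<rho> = 1"
    and sim: "\<forall>x\<in>H3. act (Q \<circ> A \<circ> linv Q) x = upt_pt (of_real \<mu> * (\<rho> * cnj (zpart x) + s)) (\<mu> * x$3)"
  shows False
proof -
  obtain \<phi> :: "real^4 \<Rightarrow> real^3" and \<psi> where \<phi>: "homeomorphism (S3 - {k}) UNIV \<phi> \<psi>"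
    using punctured_S3_homeomorphic[OF k] by blast
  have pS: "p y \<in> S3 - {k}" if "y \<in> H3" for y using pM MS that by blast
  have lQ: "lorentz (linv Q)" by (rule lorentz_inv[OF Q])
  have aQ: "act (linv Q) y \<in> H3" if "y \<in> H3" for y by (rule act_in_H3[OF lQ that])
  define q where "q = \<phi> \<circ> (p \<circ> act (linv Q))"
  show False
  proof (rule orientation_reversing_similarity_no_deck[of q \<mu> \<rho> s])
    have "continuous_on H3 (p \<circ> act (linv Q))"
      by (rule continuous_on_compose[OF continuous_on_act[OF lQ] continuous_on_subset[OF pc]]) (use aQ in auto)
    then show "continuous_on H3 q"
      unfolding q_def by (rule continuous_on_compose) (rule continuous_on_subset[OF homeomorphism_cont1[OF \<phi>]], use pS aQ in auto)
    show "\<exists>e>0. inj_on q (ball x e)" if x: "x \<in> H3" for x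
    proof -
      obtain e where e: "e > 0" "e \<le> 1" "ball (act (linv Q) x) e \<subseteq> H3" "\<And>y. y \<in> ball (act (linv Q) x) e \<Longrightarrow> p y \<in> M"
        "\<And>y z. y \<in> ball (act (linv Q) x) e \<Longrightarrow> z \<in> ball (act (linv Q) x) e \<Longrightarrow> d (p y) (p z) = hyp_dist y z"
        by (fact loc_isomE[OF p aQ[OF x] zero_less_one])
      have "open (H3 \<inter> act (linv Q) -` ball (act (linv Q) x) e)"
        by (rule continuous_open_preimage[OF continuous_on_act[OF lQ] open_H3 open_ball])
      moreover have "x \<in> H3 \<inter> act (linv Q) -` ball (act (linv Q) x) e" using x e(1) by simp
      ultimately obtain e' where e': "e' > 0" "ball x e' \<subseteq> H3 \<inter> act (linv Q) -` ball (act (linv Q) x) e"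
        by (meson open_contains_ball)
      have "inj_on q (ball x e')"
      proof (rule inj_onI)
        fix y z assume y: "y \<in> ball x e'" and z: "z \<in> ball x e'" and eq: "q y = q z"
        have yH: "y \<in> H3" and zH: "z \<in> H3" using y z e'(2) by blast+
        have yb: "act (linv Q) y \<in> ball (act (linv Q) x) e" and zb: "act (linv Q) z \<in> ball (act (linv Q) x) e"
          using y z e'(2) by blast+
        have "\<psi> (q y) = \<psi> (q z)" by (simp only: eq)
        then have "p (act (linv Q) y) = p (act (linv Q) z)"
          using homeomorphism_apply1[OF \<phi> pS[OF aQ[OF yH]]] homeomorphism_apply1[OF \<phi> pS[OF aQ[OF zH]]] by (simp add: q_def)
        then have "hyp_dist (act (linv Q) y) (act (linv Q) z) = 0"
          using e(5)[OF yb zb] Metric_space.zero[OF M e(4)[OF yb] e(4)[OF zb]] by simp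
        then have "act Q (act (linv Q) y) = act Q (act (linv Q) z)"
          using hyp_dist_eq_0[OF aQ[OF yH] aQ[OF zH]] by simp
        then show "y = z" using act_act_inv[OF Q] yH zH by simp
      qed
      then show ?thesis using e'(1) by blast
    qed
    show "q (upt_pt (of_real \<mu> * (\<rho> * cnj (zpart x) + s)) (\<mu> * x$3)) = q x" if x: "x \<in> H3" for x
    proof -
      have AQ: "act A (act (linv Q) x) \<in> H3" by (rule act_in_H3[OF A(1) aQ[OF x]])
      have "act (Q \<circ> A \<circ> linv Q) x = act Q (act A (act (linv Q) x))"
        using act_comp[OF lQ x, of "Q \<circ> A"] act_comp[OF A(1) aQ[OF x], of Q] by simp
      then have "act (linv Q) (act (Q \<circ> A \<circ> linv Q) x) = act A (act (linv Q) x)"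
        using act_inv_act[OF Q AQ] by simp
      then have "q (act (Q \<circ> A \<circ> linv Q) x) = q x" using A(2)[OF aQ[OF x]] by (simp add: q_def)
      then show ?thesis using sim x by simp
    qed
  qed (rule \<mu> \<rho>)+
qed

theorem corollary1p8:
  fixes K E :: "(real^4) set" and x :: "real^4"
  assumes "hyperbolic_knot K"
    and "knot_exterior K E"
    and "x \<in> E"
  shows "\<not> (\<exists>g. generalized_torsion_element (fundamental_group E x) g \<and>
               generalized_torsion_order (fundamental_group E x) g = 2)"
proof
  assume "\<exists>g. generalized_torsion_element (fundamental_group E x) g \<and>
               generalized_torsion_order (fundamental_group E x) g = 2"
  then obtain g where g1: "generalized_torsion_element (fundamental_group E x) g"
    and ord: "generalized_torsion_order (fundamental_group E x) g = 2" by (elim exE conjE)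
  note g = g1 order_two_yields_one[OF g1 ord]
  define M where "M = S3 - K"
  obtain d where hyp: "hyperbolic_metric M d" and top: "Metric_space.mtopology M d = top_of_set M"
    and compl: "Metric_space.mcomplete M d"
    using assms(1) unfolding hyperbolic_knot_def M_def by (elim exE conjE)
  have ms: "Metric_space M d" and len: "length_metric M d"
    and ch: "\<And>y. y \<in> M \<Longrightarrow> \<exists>U f. y \<in> U \<and> hyperbolic_chart M d U f"
    using hyp by (auto simp: hyperbolic_metric_def)
  interpret hs: complete_hyperbolic_space M d
    by (intro complete_hyperbolic_space.intro hyperbolic_space.intro hyperbolic_space_axioms.intro
        complete_hyperbolic_space_axioms.intro ms ch compl)
  obtain h r where tube: "knot_tube h r" and K: "K = h ` (UNIV \<times> {0})" and E: "E = S3 - h ` (UNIV \<times> ball 0 1)"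
    using knot_exterior_tube[OF assms(2)] by blast
  interpret knot_tube h r by (rule tube)
  obtain \<rho> where \<rho>: "continuous_on M \<rho>" "\<rho> ` M \<subseteq> E" "\<And>y. y \<in> E \<Longrightarrow> \<rho> y = y"
    using exterior_retraction[OF K E] unfolding M_def by blast
  have EM: "E \<subseteq> M" by (auto simp: E K M_def)
  have xM: "x \<in> M" using assms(3) EM by blast
  \<comment> \<open>Any point of the knot serves as the puncture.\<close>
  define k where "k = h (0, 0)"
  have k: "k \<in> S3" "k \<in> K" using in_S3[of 0 0] r by (auto simp: k_def K)
  obtain p where p: "loc_isom M d H3 p" using hs.developing_map xM by blast
  have surj: "p ` H3 = M" by (rule hs.loc_isom_surj[OF p length_metric_connected[OF ms len]])
  have cover: "covering_space H3 p M"
    by (rule covering_space_developing_map[OF hs.hyperbolic_space_axioms top p surj])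
  obtain x0 where x0: "x0 \<in> H3" "p x0 = x" using xM surj by blast
  interpret dv: developed_space M d p x0
    by (intro developed_space.intro developed_space_axioms.intro hs.hyperbolic_space_axioms p cover x0(1))
  let ?G = "fundamental_group E x"
  interpret G: group ?G by (rule group_fundamental_group[OF assms(3)])
  have "\<exists>\<Phi>. (\<forall>c\<in>carrier ?G. dv.deck (\<Phi> c)) \<and> (\<forall>c\<in>carrier ?G. \<forall>c'\<in>carrier ?G. \<Phi> (c \<otimes>\<^bsub>?G\<^esub> c') = \<Phi> c \<circ> \<Phi> c') \<and>
     \<Phi> \<one>\<^bsub>?G\<^esub> = id \<and> (\<forall>c\<in>carrier ?G. \<Phi> c = id \<longrightarrow> c = \<one>\<^bsub>?G\<^esub>)"
  proof (rule dv.retract_group_to_deck[of E \<rho>, unfolded x0(2), OF assms(3) EM \<rho>(1,2)])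
    fix \<Phi> assume *: "\<And>c. c \<in> carrier ?G \<Longrightarrow> dv.deck (\<Phi> c)"
      "\<And>c c'. c \<in> carrier ?G \<Longrightarrow> c' \<in> carrier ?G \<Longrightarrow> \<Phi> (c \<otimes>\<^bsub>?G\<^esub> c') = \<Phi> c \<circ> \<Phi> c'"
      "\<Phi> \<one>\<^bsub>?G\<^esub> = id" "\<And>c. c \<in> carrier ?G \<Longrightarrow> \<Phi> c = id \<Longrightarrow> c = \<one>\<^bsub>?G\<^esub>"
    show "\<exists>\<Phi>. (\<forall>c\<in>carrier ?G. dv.deck (\<Phi> c)) \<and>
      (\<forall>c\<in>carrier ?G. \<forall>c'\<in>carrier ?G. \<Phi> (c \<otimes>\<^bsub>?G\<^esub> c') = \<Phi> c \<circ> \<Phi> c') \<and>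
      \<Phi> \<one>\<^bsub>?G\<^esub> = id \<and> (\<forall>c\<in>carrier ?G. \<Phi> c = id \<longrightarrow> c = \<one>\<^bsub>?G\<^esub>)"
      by (rule exI[of _ \<Phi>], intro conjI ballI impI) (erule *(1), erule (1) *(2), rule *(3), erule (1) *(4))
  qed (rule \<rho>(3))
  then obtain \<Phi> where D: "(\<forall>c\<in>carrier ?G. dv.deck (\<Phi> c)) \<and>
      (\<forall>c\<in>carrier ?G. \<forall>c'\<in>carrier ?G. \<Phi> (c \<otimes>\<^bsub>?G\<^esub> c') = \<Phi> c \<circ> \<Phi> c') \<and>
      \<Phi> \<one>\<^bsub>?G\<^esub> = id \<and> (\<forall>c\<in>carrier ?G. \<Phi> c = id \<longrightarrow> c = \<one>\<^bsub>?G\<^esub>)"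
    by (rule exE)
  note deck = D[THEN conjunct1, rule_format]
    and mult = D[THEN conjunct2, THEN conjunct1, rule_format]
    and inj\<Phi> = D[THEN conjunct2, THEN conjunct2, THEN conjunct2, rule_format]
  have gc: "g \<in> carrier ?G" "g \<noteq> \<one>\<^bsub>?G\<^esub>" using g(1) by (auto simp: generalized_torsion_element_def)
  obtain a b where ab: "a \<in> carrier ?G" "b \<in> carrier ?G"
    and rel: "(inv\<^bsub>?G\<^esub> a \<otimes>\<^bsub>?G\<^esub> g \<otimes>\<^bsub>?G\<^esub> a) \<otimes>\<^bsub>?G\<^esub> (inv\<^bsub>?G\<^esub> b \<otimes>\<^bsub>?G\<^esub> g \<otimes>\<^bsub>?G\<^esub> b) = \<one>\<^bsub>?G\<^esub>"
    using conjugates_yield_one_2[OF G.group_axioms gc(1) g(2)] by blast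
  \<comment> \<open>Multiplying the product of conjugates by \<open>a\<close> on the left and by the
    inverse of \<open>b\<close> on the right turns it into \<open>g c g\<close>, and the identity
    into \<open>c\<close>.\<close>
  define c where "c = a \<otimes>\<^bsub>?G\<^esub> inv\<^bsub>?G\<^esub> b"
  have c: "c \<in> carrier ?G" using ab by (simp add: c_def)
  have gcg: "g \<otimes>\<^bsub>?G\<^esub> c \<otimes>\<^bsub>?G\<^esub> g = c"
  proof -
    have "a \<otimes>\<^bsub>?G\<^esub> ((inv\<^bsub>?G\<^esub> a \<otimes>\<^bsub>?G\<^esub> g \<otimes>\<^bsub>?G\<^esub> a) \<otimes>\<^bsub>?G\<^esub> (inv\<^bsub>?G\<^esub> b \<otimes>\<^bsub>?G\<^esub> g \<otimes>\<^bsub>?G\<^esub> b)) \<otimes>\<^bsub>?G\<^esub> inv\<^bsub>?G\<^esub> b = c"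
      unfolding rel using ab by (simp add: c_def)
    moreover have "a \<otimes>\<^bsub>?G\<^esub> (inv\<^bsub>?G\<^esub> a \<otimes>\<^bsub>?G\<^esub> y) = y" if "y \<in> carrier ?G" for y
      using ab that by (simp flip: G.m_assoc)
    ultimately show ?thesis using ab gc(1) by (simp add: c_def G.m_assoc)
  qed
  have dg: "dv.deck (\<Phi> g)" and dc: "dv.deck (\<Phi> c)" using deck gc(1) c by auto
  show False
  proof (rule no_inversion[of "\<Phi> g" "\<Phi> c"])
    show "lorentz (\<Phi> g)" "lorentz (\<Phi> c)" using dv.deck_lorentz dg dc by auto
    have "\<Phi> g \<circ> \<Phi> c \<circ> \<Phi> g = \<Phi> c" using mult[of "g \<otimes>\<^bsub>?G\<^esub> c" g] mult[of g c] gc(1) c gcg by simp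
    then show "\<Phi> g (\<Phi> c (\<Phi> g v)) = \<Phi> c v" for v by (metis comp_apply)
    show "\<Phi> g \<noteq> id" using inj\<Phi> gc by blast
    show "\<Phi> g = id" if "y \<in> H3" "act (\<Phi> g) y = y" for y by (rule dv.deck_fixed[OF dg that])
    show "\<Phi> c = id" if "y \<in> H3" "act (\<Phi> c) y = y" for y by (rule dv.deck_fixed[OF dc that])
    fix A Q and \<mu> :: real and \<nu> s :: complex assume A: "A \<in> {\<Phi> g, \<Phi> c}" and Q: "lorentz Q" "\<mu> > 0" "norm \<nu> = 1"
    have dA: "dv.deck A" using A dg dc by auto
    show "\<not> (\<forall>x\<in>H3. act (Q \<circ> A \<circ> linv Q) x = upt_pt (of_real \<mu> * (\<nu> * cnj (zpart x) + s)) (\<mu> * x$3))"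
    proof
      assume sim: "\<forall>x\<in>H3. act (Q \<circ> A \<circ> linv Q) x = upt_pt (of_real \<mu> * (\<nu> * cnj (zpart x) + s)) (\<mu> * x$3)"
      have sub: "M \<subseteq> S3 - {k}" using k(2) by (auto simp: M_def)
      show False
        by (rule deck_not_orientation_reversing[OF p sub k(1) covering_space_imp_continuous[OF cover]
            equalityD1[OF surj] ms dv.deck_lorentz[OF dA] dv.deck_p[OF dA] Q sim])
    qed
  qed
qed

end
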